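(* Let $(M,J,g)$ be a Hermitian surface and let $f:\Sigma\to M$ be a generic Chern minimal immersion from a compact Riemann surface $\Sigma$ into $M$. Then $f$ is real with constant Kähler angle if and only if $K+K^\perp=0$ on $\Sigma$, where $K$ is the Gaussian curvature of $\Sigma$ and $K^\perp$ is the normal curvature of $f$.
   Context: A Hermitian surface $(M,J,g)$ is a complex surface (complex dimension 2, integrable complex structure $J$) with a Hermitian metric $g$; it is oriented by $J$. Riemann surfaces are connected, and oriented by their complex structure. Immersions $f:(\Sigma,\mathtt{j})\to M$ are smooth conformal isometric immersions, i.e. $ds^2_\Sigma=f^*g$ is a metric compatible with the conformal class of $\mathtt{j}$. Chern minimality: let $\nabla$ be the Chern connection on $TM$, i.e. the unique connection with $\nabla J=0$, $\nabla g=0$ and vanishing $(1,1)$-part of its torsion. Using the Levi-Civita connection of $ds^2_\Sigma$ on $T^*\Sigma$ and the pull-back of $\nabla$ on $f^{-1}TM$, the covariant derivative $\nabla df$ of the section $df$ of $T^*\Sigma\otimes f^{-1}TM$ is defined. The immersion $f$ is Chern minimal if $\mathrm{tr}\,\nabla df=0$ (trace with respect to $ds^2_\Sigma$). A Chern minimal $f$ is generic if it is neither holomorphic nor antiholomorphic. Kähler angle: write locally $ds^2_\Sigma=\varphi\bar\varphi$ with $\varphi$ a $(1,0)$-form on $\Sigma$ and the product meaning $\varphi\otimes\bar\varphi+\bar\varphi\otimes\varphi$ (so the area form is $dA=\sqrt{-1}\,\varphi\wedge\bar\varphi$); likewise for $g=\sum_i\omega^i\overline{\omega^i}$. Locally one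 can choose a unitary coframe $\{\omega^1,\omega^2\}$ of $M$ along $f$ with $f^*\omega^1=s\varphi$, $f^*\omega^2=t\bar\varphi$, with $s,t$ smooth complex-valued functions; the Kähler angle $\alpha:\Sigma\to[0,\pi]$ is defined by $|s|=\cos\frac{\alpha}{2}$, $|t|=\sin\frac{\alpha}{2}$. A point $x\in \Sigma$ is real if $0<\alpha(x)<\pi$ (equivalently, $df\circ\mathtt{j}\neq\pm J\circ df$ at $x$), and $f$ is real if every point of $\Sigma$ is real. Normal curvature: the normal bundle $T^\perp\Sigma$ is the orthogonal complement of $df(T\Sigma)$ in $f^*TM$, oriented so that $T\Sigma\oplus T^\perp\Sigma=f^*TM$ as oriented bundles. With $D$ the Levi-Civita connection of $g$ and $\{\nu_1,\nu_2\}$ a local positively oriented orthonormal frame of $T^\perp\Sigma$, set $\rho^\perp=\langle D\nu_1,\nu_2\rangle$; then $K^\perp$ is defined by $d\rho^\perp=-K^\perp\,dA$. (With the same convention for $T\Sigma$, $\rho=\langle DE_1,E_2\rangle$ satisfies $d\rho=-K\,dA$ with $K$ the Gaussian curvature.) *)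

theory Defs
  imports "HOL-Analysis.Analysis"
begin

section \<open>Smooth maps on open subsets of Euclidean spaces\<close>

primrec C_k_on :: "nat \<Rightarrow> 'a::euclidean_space set \<Rightarrow> ('a \<Rightarrow> 'b::real_normed_vector) \<Rightarrow> bool" where
  "C_k_on 0 S f = continuous_on S f"
| "C_k_on (Suc k) S f =
     (f differentiable_on S \<and> (\<forall>v. C_k_on k S (\<lambda>x. frechet_derivative f (at x) v)))"

text \<open>Only meaningful for open \<open>S\<close>.\<close>
definition smooth_on :: "'a::euclidean_space set \<Rightarrow> ('a \<Rightarrow> 'b::real_normed_vector) \<Rightarrow> bool" where
  "smooth_on S f \<longleftrightarrow> (\<forall>k. C_k_on k S f)"


section \<open>Complex linear algebra\<close>

text \<open>Holomorphic charts take values in \<open>complex\<close> or \<open>complex ^ 2\<close>, where \<open>J\<close> is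
  multiplication by the imaginary unit.\<close>

abbreviation J :: "complex ^ 2 \<Rightarrow> complex ^ 2" where
  "J v \<equiv> \<i> *s v"

definition complex_linear :: "('a::real_vector \<Rightarrow> 'a) \<Rightarrow> ('b::real_vector \<Rightarrow> 'b) \<Rightarrow> ('a \<Rightarrow> 'b) \<Rightarrow> bool" where
  "complex_linear j j' L \<longleftrightarrow> linear L \<and> (\<forall>v. L (j v) = j' (L v))"

definition complex_antilinear :: "('a::real_vector \<Rightarrow> 'a) \<Rightarrow> ('b::real_vector \<Rightarrow> 'b) \<Rightarrow> ('a \<Rightarrow> 'b) \<Rightarrow> bool" where
  "complex_antilinear j j' L \<longleftrightarrow> linear L \<and> (\<forall>v. L (j v) = - j' (L v))"

text \<open>Both spaces are oriented by their complex structure: \<open>(1, \<i>)\<close> is a positive basis of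
  \<open>complex\<close>, and \<open>(u, J u, v, J v)\<close> is a positive basis of \<open>complex ^ 2\<close>.\<close>

definition real_coords :: "complex ^ 2 \<Rightarrow> real ^ 4" where
  "real_coords v = vector [Re (v $ 1), Im (v $ 1), Re (v $ 2), Im (v $ 2)]"

definition positive_basis2 :: "complex \<Rightarrow> complex \<Rightarrow> bool" where
  "positive_basis2 u v \<longleftrightarrow> Re u * Im v - Im u * Re v > 0"

definition positive_basis4 :: "complex ^ 2 \<Rightarrow> complex ^ 2 \<Rightarrow> complex ^ 2 \<Rightarrow> complex ^ 2 \<Rightarrow> bool" where
  "positive_basis4 a b c d \<longleftrightarrow>
     det (vector [real_coords a, real_coords b, real_coords c, real_coords d] :: real ^ 4 ^ 4) > 0"


section \<open>Metrics and connections in coordinates\<close>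

text \<open>A (local) metric is \<open>G p v w\<close>, the inner product of the tangent vectors \<open>v\<close>, \<open>w\<close> at \<open>p\<close>.\<close>
type_synonym 'e metric = "'e \<Rightarrow> 'e \<Rightarrow> 'e \<Rightarrow> real"

text \<open>A connection is given by its Christoffel symbols \<open>\<Gamma> p\<close>: for constant coordinate fields
  \<open>u\<close>, \<open>v\<close>, the covariant derivative \<open>\<nabla>\<^sub>u v\<close> at \<open>p\<close> is \<open>\<Gamma> p u v\<close>.\<close>
type_synonym 'e christoffel = "'e \<Rightarrow> 'e \<Rightarrow> 'e \<Rightarrow> 'e"

text \<open>\<open>\<nabla> g = 0\<close> at \<open>p\<close>, tested on constant coordinate fields.\<close>
definition metric_parallel :: "'e::euclidean_space metric \<Rightarrow> 'e \<Rightarrow> ('e \<Rightarrow> 'e \<Rightarrow> 'e) \<Rightarrow> bool" where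
  "metric_parallel G p \<Gamma> \<longleftrightarrow>
     (\<forall>u v w. frechet_derivative (\<lambda>q. G q v w) (at p) u = G p (\<Gamma> u v) w + G p v (\<Gamma> u w))"

text \<open>Constant coordinate fields commute, so no bracket term occurs.\<close>
definition torsion :: "('e::real_vector \<Rightarrow> 'e \<Rightarrow> 'e) \<Rightarrow> 'e \<Rightarrow> 'e \<Rightarrow> 'e" where
  "torsion \<Gamma> u v = \<Gamma> u v - \<Gamma> v u"

text \<open>The \<open>(1,1)\<close>-part of a two-form: the part invariant under \<open>J\<close>.\<close>
definition part11 :: "(complex ^ 2 \<Rightarrow> complex ^ 2 \<Rightarrow> complex ^ 2) \<Rightarrow> complex ^ 2 \<Rightarrow> complex ^ 2 \<Rightarrow> complex ^ 2" where
  "part11 T u v = (1 / 2) *\<^sub>R (T u v + T (J u) (J v))"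

definition levi_civita :: "'e::euclidean_space metric \<Rightarrow> 'e christoffel" where
  "levi_civita G p =
     (THE \<Gamma>. bilinear \<Gamma> \<and> metric_parallel G p \<Gamma> \<and> (\<forall>u v. torsion \<Gamma> u v = 0))"

text \<open>In a holomorphic chart \<open>J\<close> is constant, so \<open>\<nabla> J = 0\<close> says that \<open>\<Gamma> u\<close> commutes with \<open>J\<close>.\<close>
definition chern_connection :: "(complex ^ 2) metric \<Rightarrow> (complex ^ 2) christoffel" where
  "chern_connection G p =
     (THE \<Gamma>. bilinear \<Gamma> \<and> (\<forall>u v. \<Gamma> u (J v) = J (\<Gamma> u v)) \<and> metric_parallel G p \<Gamma> \<and>
              (\<forall>u v. part11 (torsion \<Gamma>) u v = 0))"


section \<open>Maps from plane domains\<close>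

text \<open>\<open>F\<close> is a map from an open subset of \<open>complex\<close> (a chart of the Riemann surface) to the model
  space \<open>'e\<close> of the target, \<open>G\<close> a metric and \<open>\<Gamma>\<close> a connection on the target.\<close>

abbreviation differential :: "(complex \<Rightarrow> 'e::euclidean_space) \<Rightarrow> complex \<Rightarrow> complex \<Rightarrow> 'e" where
  "differential F z \<equiv> frechet_derivative F (at z)"

definition pullback_metric :: "'e::euclidean_space metric \<Rightarrow> (complex \<Rightarrow> 'e) \<Rightarrow> complex metric" where
  "pullback_metric G F z v w = G (F z) (differential F z v) (differential F z w)"

text \<open>Covariant derivative, in direction \<open>v\<close>, of a vector field \<open>Y\<close> along \<open>F\<close>, with respect to the
  pulled-back connection.\<close>
definition cov_along ::
  "'e::euclidean_space christoffel \<Rightarrow> (complex \<Rightarrow> 'e) \<Rightarrow> (complex \<Rightarrow> 'e) \<Rightarrow> complex \<Rightarrow> complex \<Rightarrow> 'e" where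
  "cov_along \<Gamma> F Y z v = differential Y z v + \<Gamma> (F z) (differential F z v) (Y z)"

text \<open>\<open>(\<nabla>\<^sub>v dF)(w) = \<nabla>\<^sub>v (dF w) - dF (\<nabla>\<^sub>v w)\<close> for constant \<open>w\<close>, where the domain carries the
  Levi-Civita connection of the induced metric.\<close>
definition nabla_df ::
  "(complex ^ 2) metric \<Rightarrow> (complex ^ 2) christoffel \<Rightarrow> (complex \<Rightarrow> complex ^ 2) \<Rightarrow> complex \<Rightarrow>
     complex \<Rightarrow> complex \<Rightarrow> complex ^ 2" where
  "nabla_df G \<Gamma> F z v w =
     cov_along \<Gamma> F (\<lambda>z'. differential F z' w) z v
     - differential F z (levi_civita (pullback_metric G F) z v w)"

text \<open>The connection form \<open>\<langle>D e\<^sub>1, e\<^sub>2\<rangle>\<close> of a pair of fields along \<open>F\<close>.\<close>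
definition connection_form ::
  "'e::euclidean_space metric \<Rightarrow> 'e christoffel \<Rightarrow> (complex \<Rightarrow> 'e) \<Rightarrow> (complex \<Rightarrow> 'e) \<Rightarrow> (complex \<Rightarrow> 'e) \<Rightarrow>
     complex \<Rightarrow> complex \<Rightarrow> real" where
  "connection_form G \<Gamma> F e1 e2 z v = G (F z) (cov_along \<Gamma> F e1 z v) (e2 z)"

definition ext_deriv :: "(complex \<Rightarrow> complex \<Rightarrow> real) \<Rightarrow> complex \<Rightarrow> complex \<Rightarrow> complex \<Rightarrow> real" where
  "ext_deriv \<rho> z v w =
     frechet_derivative (\<lambda>z'. \<rho> z' w) (at z) v - frechet_derivative (\<lambda>z'. \<rho> z' v) (at z) w"

definition area_form :: "complex metric \<Rightarrow> complex \<Rightarrow> complex \<Rightarrow> complex \<Rightarrow> real" where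
  "area_form h z v w =
     sqrt (h z 1 1 * h z \<i> \<i> - (h z 1 \<i>)\<^sup>2) * (Re v * Im w - Im v * Re w)"

definition orthonormal_pair :: "('e \<Rightarrow> 'e \<Rightarrow> real) \<Rightarrow> 'e \<Rightarrow> 'e \<Rightarrow> bool" where
  "orthonormal_pair b u v \<longleftrightarrow> b u u = 1 \<and> b v v = 1 \<and> b u v = 0"

text \<open>\<open>k\<close> is the Gaussian curvature at \<open>z\<close> of the metric \<open>h\<close>: \<open>d\<rho> = - k dA\<close> for
  \<open>\<rho> = \<langle>D E\<^sub>1, E\<^sub>2\<rangle>\<close>, where \<open>(E\<^sub>1, E\<^sub>2)\<close> is a positive orthonormal frame near \<open>z\<close>.\<close>
definition has_gauss_curvature :: "complex metric \<Rightarrow> complex \<Rightarrow> real \<Rightarrow> bool" where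
  "has_gauss_curvature h z k \<longleftrightarrow>
     (\<exists>W E1 E2. open W \<and> z \<in> W \<and> smooth_on W E1 \<and> smooth_on W E2 \<and>
        (\<forall>y\<in>W. orthonormal_pair (h y) (E1 y) (E2 y) \<and> positive_basis2 (E1 y) (E2 y)) \<and>
        (\<forall>v w. ext_deriv (connection_form h (levi_civita h) (\<lambda>y. y) E1 E2) z v w
               = - k * area_form h z v w))"

text \<open>\<open>n1\<close>, \<open>n2\<close> is a positive orthonormal basis of the normal space of \<open>F\<close> at \<open>z\<close>, the normal
  space being oriented such that tangent plus normal space is positively oriented.\<close>
definition normal_basis ::
  "(complex ^ 2) metric \<Rightarrow> (complex \<Rightarrow> complex ^ 2) \<Rightarrow> complex \<Rightarrow> complex ^ 2 \<Rightarrow> complex ^ 2 \<Rightarrow> bool" where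
  "normal_basis G F z n1 n2 \<longleftrightarrow>
     orthonormal_pair (G (F z)) n1 n2 \<and>
     (\<forall>v. G (F z) n1 (differential F z v) = 0 \<and> G (F z) n2 (differential F z v) = 0) \<and>
     positive_basis4 (differential F z 1) (differential F z \<i>) n1 n2"

definition has_normal_curvature ::
  "(complex ^ 2) metric \<Rightarrow> (complex \<Rightarrow> complex ^ 2) \<Rightarrow> complex \<Rightarrow> real \<Rightarrow> bool" where
  "has_normal_curvature G F z k \<longleftrightarrow>
     (\<exists>W n1 n2. open W \<and> z \<in> W \<and> smooth_on W n1 \<and> smooth_on W n2 \<and>
        (\<forall>y\<in>W. normal_basis G F y (n1 y) (n2 y)) \<and>
        (\<forall>v w. ext_deriv (connection_form G (levi_civita G) F n1 n2) z v w
               = - k * area_form (pullback_metric G F) z v w))"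

text \<open>For complex valued linear forms, \<open>\<phi> \<phi>\<^sup>-\<close> means \<open>\<phi> \<otimes> \<phi>\<^sup>- + \<phi>\<^sup>- \<otimes> \<phi>\<close> (so it is
  \<open>2 \<bar>\<phi>\<bar>\<^sup>2\<close> on the diagonal).\<close>
definition sym_prod :: "('e \<Rightarrow> complex) \<Rightarrow> 'e \<Rightarrow> 'e \<Rightarrow> complex" where
  "sym_prod \<phi> v w = \<phi> v * cnj (\<phi> w) + cnj (\<phi> v) * \<phi> w"

text \<open>A local statement at the point \<open>z\<close>: \<open>\<omega>1\<close>, \<open>\<omega>2\<close> is a unitary coframe at \<open>F z\<close> with
  \<open>F\<^sup>* \<omega>1 = s \<phi>\<close> and \<open>F\<^sup>* \<omega>2 = t \<phi>\<^sup>-\<close>.\<close>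
definition has_kahler_angle ::
  "(complex ^ 2) metric \<Rightarrow> (complex \<Rightarrow> complex ^ 2) \<Rightarrow> complex \<Rightarrow> real \<Rightarrow> bool" where
  "has_kahler_angle G F z \<alpha> \<longleftrightarrow> 0 \<le> \<alpha> \<and> \<alpha> \<le> pi \<and>
     (\<exists>\<phi> \<omega>1 \<omega>2 s t.
        complex_linear ((*) \<i>) ((*) \<i>) \<phi> \<and>
        complex_linear J ((*) \<i>) \<omega>1 \<and> complex_linear J ((*) \<i>) \<omega>2 \<and>
        (\<forall>v w. of_real (pullback_metric G F z v w) = sym_prod \<phi> v w) \<and>
        (\<forall>v w. of_real (G (F z) v w) = sym_prod \<omega>1 v w + sym_prod \<omega>2 v w) \<and>
        (\<forall>v. \<omega>1 (differential F z v) = s * \<phi> v) \<and>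
        (\<forall>v. \<omega>2 (differential F z v) = t * cnj (\<phi> v)) \<and>
        cmod s = cos (\<alpha> / 2) \<and> cmod t = sin (\<alpha> / 2))"


section \<open>Complex manifolds of dimension one and two\<close>

type_synonym ('m, 'e) chart = "'m set \<times> ('m \<Rightarrow> 'e)"

definition is_chart :: "('m::topological_space, 'e::euclidean_space) chart \<Rightarrow> bool" where
  "is_chart c \<longleftrightarrow> open (fst c) \<and> open (snd c ` fst c) \<and>
     homeomorphism (fst c) (snd c ` fst c) (snd c) (inv_into (fst c) (snd c))"

text \<open>The representative of a map \<open>f\<close> in charts \<open>c\<close> of the source and \<open>d\<close> of the target, and the
  set on which it is defined.\<close>
definition local_rep :: "('m, 'e) chart \<Rightarrow> ('n, 'd) chart \<Rightarrow> ('m \<Rightarrow> 'n) \<Rightarrow> 'e \<Rightarrow> 'd" where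
  "local_rep c d f = snd d \<circ> f \<circ> inv_into (fst c) (snd c)"

definition rep_dom :: "('m, 'e) chart \<Rightarrow> ('n, 'd) chart \<Rightarrow> ('m \<Rightarrow> 'n) \<Rightarrow> 'e set" where
  "rep_dom c d f = snd c ` (fst c \<inter> f -` fst d)"

text \<open>The manifold is the whole type; its Hausdorff and countability axioms are sort constraints.\<close>
definition atlas ::
  "('m::{t2_space,second_countable_topology}, 'e::euclidean_space) chart set \<Rightarrow> bool" where
  "atlas A \<longleftrightarrow> (\<forall>c\<in>A. is_chart c) \<and> (\<Union>c\<in>A. fst c) = UNIV"

definition riemann_surface ::
  "('s::{t2_space,second_countable_topology}, complex) chart set \<Rightarrow> bool" where
  "riemann_surface A \<longleftrightarrow> atlas A \<and> connected (UNIV :: 's set) \<and>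
     (\<forall>c\<in>A. \<forall>d\<in>A. local_rep c d id holomorphic_on rep_dom c d id)"

definition complex_surface ::
  "('m::{t2_space,second_countable_topology}, complex ^ 2) chart set \<Rightarrow> bool" where
  "complex_surface A \<longleftrightarrow> atlas A \<and>
     (\<forall>c\<in>A. \<forall>d\<in>A. \<forall>p\<in>rep_dom c d id.
        local_rep c d id differentiable at p \<and>
        complex_linear J J (frechet_derivative (local_rep c d id) (at p)))"

text \<open>A metric on the manifold is given by its representatives \<open>g c\<close> in the charts \<open>c\<close> of the
  atlas, which are related by the tensor transformation rule.\<close>
type_synonym 'm hmetric = "('m, complex ^ 2) chart \<Rightarrow> (complex ^ 2) metric"

definition hermitian_metric ::
  "('m::{t2_space,second_countable_topology}, complex ^ 2) chart set \<Rightarrow> 'm hmetric \<Rightarrow> bool" where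
  "hermitian_metric A g \<longleftrightarrow>
     (\<forall>c\<in>A. (\<forall>v w. smooth_on (snd c ` fst c) (\<lambda>p. g c p v w)) \<and>
        (\<forall>p\<in>snd c ` fst c. bilinear (g c p) \<and>
           (\<forall>v w. g c p v w = g c p w v) \<and>
           (\<forall>v. v \<noteq> 0 \<longrightarrow> g c p v v > 0) \<and>
           (\<forall>v w. g c p (J v) (J w) = g c p v w))) \<and>
     (\<forall>c\<in>A. \<forall>d\<in>A. \<forall>p\<in>rep_dom c d id. \<forall>v w.
        g c p v w = g d (local_rep c d id p)
          (frechet_derivative (local_rep c d id) (at p) v)
          (frechet_derivative (local_rep c d id) (at p) w))"

definition hermitian_surface ::
  "('m::{t2_space,second_countable_topology}, complex ^ 2) chart set \<Rightarrow> 'm hmetric \<Rightarrow> bool" where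
  "hermitian_surface A g \<longleftrightarrow> complex_surface A \<and> hermitian_metric A g"


section \<open>Immersed surfaces\<close>

text \<open>\<open>S\<close> is an atlas of the Riemann surface, \<open>A\<close> an atlas of the complex surface. Since the metric
  of the surface is by definition the induced one, the condition on \<open>f\<close> is that the induced metric
  is a positive multiple of the Euclidean metric in every holomorphic chart.\<close>
definition conformal_immersion ::
  "('s::{t2_space,second_countable_topology}, complex) chart set \<Rightarrow>
   ('m::{t2_space,second_countable_topology}, complex ^ 2) chart set \<Rightarrow> 'm hmetric \<Rightarrow> ('s \<Rightarrow> 'm) \<Rightarrow> bool" where
  "conformal_immersion S A g f \<longleftrightarrow> continuous_on UNIV f \<and>
     (\<forall>c\<in>S. \<forall>d\<in>A. smooth_on (rep_dom c d f) (local_rep c d f) \<and>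
        (\<forall>z\<in>rep_dom c d f. \<exists>r>0. \<forall>v w.
           pullback_metric (g d) (local_rep c d f) z v w = r * (v \<bullet> w)))"

text \<open>The vanishing of the trace is expressed in orthonormal bases of the induced metric.\<close>
definition chern_minimal ::
  "('s::{t2_space,second_countable_topology}, complex) chart set \<Rightarrow>
   ('m::{t2_space,second_countable_topology}, complex ^ 2) chart set \<Rightarrow> 'm hmetric \<Rightarrow> ('s \<Rightarrow> 'm) \<Rightarrow> bool" where
  "chern_minimal S A g f \<longleftrightarrow>
     (\<forall>c\<in>S. \<forall>d\<in>A. \<forall>z\<in>rep_dom c d f. \<forall>e1 e2.
        orthonormal_pair (pullback_metric (g d) (local_rep c d f) z) e1 e2 \<longrightarrow>
        nabla_df (g d) (chern_connection (g d)) (local_rep c d f) z e1 e1 +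
        nabla_df (g d) (chern_connection (g d)) (local_rep c d f) z e2 e2 = 0)"

definition holomorphic_map ::
  "('s::{t2_space,second_countable_topology}, complex) chart set \<Rightarrow>
   ('m::{t2_space,second_countable_topology}, complex ^ 2) chart set \<Rightarrow> ('s \<Rightarrow> 'm) \<Rightarrow> bool" where
  "holomorphic_map S A f \<longleftrightarrow>
     (\<forall>c\<in>S. \<forall>d\<in>A. \<forall>z\<in>rep_dom c d f. complex_linear ((*) \<i>) J (differential (local_rep c d f) z))"

definition antiholomorphic_map ::
  "('s::{t2_space,second_countable_topology}, complex) chart set \<Rightarrow>
   ('m::{t2_space,second_countable_topology}, complex ^ 2) chart set \<Rightarrow> ('s \<Rightarrow> 'm) \<Rightarrow> bool" where
  "antiholomorphic_map S A f \<longleftrightarrow>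
     (\<forall>c\<in>S. \<forall>d\<in>A. \<forall>z\<in>rep_dom c d f. complex_antilinear ((*) \<i>) J (differential (local_rep c d f) z))"

definition generic_chern_minimal ::
  "('s::{t2_space,second_countable_topology}, complex) chart set \<Rightarrow>
   ('m::{t2_space,second_countable_topology}, complex ^ 2) chart set \<Rightarrow> 'm hmetric \<Rightarrow> ('s \<Rightarrow> 'm) \<Rightarrow> bool" where
  "generic_chern_minimal S A g f \<longleftrightarrow> chern_minimal S A g f \<and>
     \<not> holomorphic_map S A f \<and> \<not> antiholomorphic_map S A f"

text \<open>The following values do not depend on the charts (nor on the frames) used.\<close>

definition kahler_angle ::
  "('s::{t2_space,second_countable_topology}, complex) chart set \<Rightarrow>
   ('m::{t2_space,second_countable_topology}, complex ^ 2) chart set \<Rightarrow> 'm hmetric \<Rightarrow> ('s \<Rightarrow> 'm) \<Rightarrow> 's \<Rightarrow> real" where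
  "kahler_angle S A g f x =
     (THE \<alpha>. \<exists>c\<in>S. \<exists>d\<in>A. x \<in> fst c \<and> f x \<in> fst d \<and>
        has_kahler_angle (g d) (local_rep c d f) (snd c x) \<alpha>)"

definition gauss_curvature ::
  "('s::{t2_space,second_countable_topology}, complex) chart set \<Rightarrow>
   ('m::{t2_space,second_countable_topology}, complex ^ 2) chart set \<Rightarrow> 'm hmetric \<Rightarrow> ('s \<Rightarrow> 'm) \<Rightarrow> 's \<Rightarrow> real" where
  "gauss_curvature S A g f x =
     (THE k. \<exists>c\<in>S. \<exists>d\<in>A. x \<in> fst c \<and> f x \<in> fst d \<and>
        has_gauss_curvature (pullback_metric (g d) (local_rep c d f)) (snd c x) k)"

definition normal_curvature ::
  "('s::{t2_space,second_countable_topology}, complex) chart set \<Rightarrow>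
   ('m::{t2_space,second_countable_topology}, complex ^ 2) chart set \<Rightarrow> 'm hmetric \<Rightarrow> ('s \<Rightarrow> 'm) \<Rightarrow> 's \<Rightarrow> real" where
  "normal_curvature S A g f x =
     (THE k. \<exists>c\<in>S. \<exists>d\<in>A. x \<in> fst c \<and> f x \<in> fst d \<and>
        has_normal_curvature (g d) (local_rep c d f) (snd c x) k)"

definition real_point ::
  "('s::{t2_space,second_countable_topology}, complex) chart set \<Rightarrow>
   ('m::{t2_space,second_countable_topology}, complex ^ 2) chart set \<Rightarrow> 'm hmetric \<Rightarrow> ('s \<Rightarrow> 'm) \<Rightarrow> 's \<Rightarrow> bool" where
  "real_point S A g f x \<longleftrightarrow> 0 < kahler_angle S A g f x \<and> kahler_angle S A g f x < pi"

definition real_immersion ::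
  "('s::{t2_space,second_countable_topology}, complex) chart set \<Rightarrow>
   ('m::{t2_space,second_countable_topology}, complex ^ 2) chart set \<Rightarrow> 'm hmetric \<Rightarrow> ('s \<Rightarrow> 'm) \<Rightarrow> bool" where
  "real_immersion S A g f \<longleftrightarrow> (\<forall>x. real_point S A g f x)"

end

theory Submission
  imports Defs "HOL-Complex_Analysis.Conformal_Mappings"
begin

text \<open>In a holomorphic chart \<open>z = x + \<i> y\<close> of the surface and a holomorphic chart of the Hermitian
  surface the immersion is a map \<open>F\<close> into \<open>complex ^ 2\<close>. Its differential splits into
  \<open>F10 = (F\<^sub>x - J F\<^sub>y) / 2\<close> and \<open>F01 = (F\<^sub>x + J F\<^sub>y) / 2\<close>, and conformality says that these two
  vectors are Hermitian orthogonal. With \<open>e10\<close>, \<open>e01\<close> their squared lengths, the conformal factor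
  of the induced metric is \<open>conf = e10 + e01\<close>, and the Kaehler angle \<open>\<alpha>\<close> satisfies
  \<open>cos \<alpha> = (e10 - e01) / conf\<close>, hence \<open>sin\<^sup>2 \<alpha> = 4 e10 e01 / conf\<^sup>2\<close>. A point is real iff
  neither component vanishes there.

  The theorem rests on one identity: at real points
  \<open>K + K\<^sup>\<bottom> = \<Delta> ln (sin\<^sup>2 \<alpha>) / (2 conf)\<close>, where \<open>\<Delta>\<close> is the Laplacian of the chart. The Gaussian
  curvature is \<open>- \<Delta> ln conf / (2 conf)\<close>, as for every conformal metric
  (\<open>has_gauss_curvature_iff\<close>). For the normal curvature, Chern minimality is rewritten as a
  Cauchy-Riemann system for \<open>F10\<close> and \<open>F01\<close> with respect to the Chern connection, in which the
  torsion \<open>T(F10, F01)\<close> is the only zeroth order term (\<open>cauchy_riemann\<close>). The normal bundle is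
  spanned at real points by explicit combinations of \<open>F10\<close> and \<open>F01\<close>, and their connection form is
  computed from this system. Replacing the Chern connection by the Levi-Civita connection produces
  further torsion terms, and all torsion terms cancel (\<open>normal_connection_algebra\<close>). What remains is
  the differential of \<open>ln (e10 e01 / conf) / 2\<close>, rotated by a right angle, so that
  \<open>K\<^sup>\<bottom> = \<Delta> ln (e10 e01 / conf) / (2 conf)\<close> (\<open>has_normal_curvature_iff\<close>).

  If the immersion is real with constant angle, then \<open>sin\<^sup>2 \<alpha>\<close> is a positive constant and the identity
  gives \<open>K + K\<^sup>\<bottom> = 0\<close>. Conversely, let \<open>K + K\<^sup>\<bottom> = 0\<close>. By compactness \<open>sin\<^sup>2 \<alpha>\<close> has a maximum, and it
  is positive, since otherwise \<open>cos \<alpha> = \<plusminus>1\<close> everywhere, with constant sign by connectedness, and the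
  immersion would be holomorphic or antiholomorphic. Near a maximum point all points are real and
  \<open>ln (sin\<^sup>2 \<alpha>)\<close> is harmonic, hence constant by the maximum principle. So the set of maximum points
  is open; it is also closed, hence it is the whole surface. Thus \<open>sin\<^sup>2 \<alpha>\<close> is a positive
  constant, and \<open>\<alpha>\<close> is constant because \<open>cos \<alpha>\<close> is continuous.\<close>

section \<open>Rules for the derivative\<close>

abbreviation fderiv :: "('a::real_normed_vector \<Rightarrow> 'b::real_normed_vector) \<Rightarrow> 'a \<Rightarrow> 'a \<Rightarrow> 'b" where
  "fderiv f x \<equiv> frechet_derivative f (at x)"

lemma fderivI: "(f has_derivative f') (at x) \<Longrightarrow> fderiv f x = f'"
  by (rule frechet_derivative_at[symmetric])

lemma fderiv_cong_open:
  assumes "open S" "x \<in> S" "\<And>y. y \<in> S \<Longrightarrow> f y = g y"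
  shows "fderiv f x = fderiv g x"
proof -
  have "(f has_derivative f') (at x) \<longleftrightarrow> (g has_derivative f') (at x)" for f'
    using assms has_derivative_transform_within_open[of f f' x UNIV S g]
      has_derivative_transform_within_open[of g f' x UNIV S f] by auto
  then show ?thesis unfolding frechet_derivative_def by simp
qed

lemma fderiv_bounded_linear:
  assumes "bounded_linear l" "f differentiable at x"
  shows "fderiv (\<lambda>x. l (f x)) x v = l (fderiv f x v)"
  using fderivI[OF bounded_linear.has_derivative[OF assms(1) assms(2)[unfolded frechet_derivative_works]]]
  by simp

lemma fderiv_add:
  "f differentiable at x \<Longrightarrow> g differentiable at x \<Longrightarrow>
    fderiv (\<lambda>x. f x + g x) x v = fderiv f x v + fderiv g x v"
  unfolding frechet_derivative_works by (rule fderivI[OF has_derivative_add, THEN fun_cong])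

lemma fderiv_minus:
  "f differentiable at x \<Longrightarrow> fderiv (\<lambda>x. - f x) x v = - fderiv f x v"
  unfolding frechet_derivative_works by (rule fderivI[OF has_derivative_minus, THEN fun_cong])

lemma fderiv_diff:
  "f differentiable at x \<Longrightarrow> g differentiable at x \<Longrightarrow>
    fderiv (\<lambda>x. f x - g x) x v = fderiv f x v - fderiv g x v"
  unfolding frechet_derivative_works by (rule fderivI[OF has_derivative_diff, THEN fun_cong])

lemma fderiv_prod:
  assumes "bounded_bilinear p" "f differentiable at x" "g differentiable at x"
  shows "fderiv (\<lambda>x. p (f x) (g x)) x v = p (f x) (fderiv g x v) + p (fderiv f x v) (g x)"
  using fderivI[OF bounded_bilinear.FDERIV[OF assms(1) assms(2,3)[unfolded frechet_derivative_works]]]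
  by simp

lemmas fderiv_scaleR = fderiv_prod[OF bounded_bilinear_scaleR]
lemmas fderiv_mult = fderiv_prod[OF bounded_bilinear_mult]

lemma fderiv_compose:
  "g differentiable at x \<Longrightarrow> f differentiable at (g x) \<Longrightarrow>
    fderiv (\<lambda>x. f (g x)) x v = fderiv f (g x) (fderiv g x v)"
  using frechet_derivative_compose[of g x f] by (simp add: o_def)

lemma linear_fderiv: "f differentiable at x \<Longrightarrow> linear (fderiv f x)"
  by (rule linear_frechet_derivative)

lemma fderiv_real_compose:
  assumes "(f has_field_derivative f') (at (g x))" "g differentiable at x"
  shows "fderiv (\<lambda>x. f (g x)) x v = f' * fderiv g x v"
  using fderivI[OF has_derivative_compose[OF assms(2)[unfolded frechet_derivative_works]
    assms(1)[unfolded has_field_derivative_def]]]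
  by simp

section \<open>Calculus of smooth maps\<close>

lemma C_k_on_cong:
  assumes "open S" "\<And>x. x \<in> S \<Longrightarrow> f x = g x" "C_k_on k S f"
  shows "C_k_on k S g"
  using assms(2,3)
proof (induction k arbitrary: f g)
  case 0 then show ?case using continuous_on_cong by force
next
  case (Suc k)
  have "g differentiable_on S"
  proof -
    have "f differentiable at x" if "x \<in> S" for x
      using Suc.prems(2) that by (simp add: differentiable_on_eq_differentiable_at[OF assms(1)])
    then show ?thesis
      unfolding differentiable_on_eq_differentiable_at[OF assms(1)] differentiable_def
      using has_derivative_transform_within_open[where f = f and g = g and s = S, OF _ assms(1)] Suc.prems(1)
      by blast
  qed
  moreover have "C_k_on k S (\<lambda>x. fderiv g x v)" for v
  proof (rule Suc.IH[of "\<lambda>x. fderiv f x v"])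
    show "fderiv f x v = fderiv g x v" if "x \<in> S" for x
      using fderiv_cong_open[OF assms(1) that, of f g] Suc.prems(1) by simp
  qed (use Suc.prems(2) in simp)
  ultimately show ?case by simp
qed

lemma C_k_on_subset: "C_k_on k S f \<Longrightarrow> T \<subseteq> S \<Longrightarrow> C_k_on k T f"
proof (induction k arbitrary: f)
  case (Suc k)
  then show ?case using differentiable_on_subset by (simp, blast)
qed (simp, metis continuous_on_subset)

lemma C_k_on_Suc_imp: "C_k_on (Suc k) S f \<Longrightarrow> C_k_on k S f"
proof (induction k arbitrary: f)
  case (Suc k)
  then show ?case by (simp only: C_k_on.simps(2)) blast
qed (simp add: differentiable_imp_continuous_on)

lemma C_k_on_const: "C_k_on k S (\<lambda>x. c)"
  by (induction k arbitrary: c) simp_all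

lemma C_k_on_add:
  assumes "open S" "C_k_on k S f" "C_k_on k S g"
  shows "C_k_on k S (\<lambda>x. f x + g x)"
  using assms(2,3)
proof (induction k arbitrary: f g)
  case 0 then show ?case by (auto intro: continuous_on_add)
next
  case (Suc k)
  have "C_k_on k S (\<lambda>x. fderiv (\<lambda>x. f x + g x) x v)" for v
  proof (rule C_k_on_cong[OF assms(1)])
    show "C_k_on k S (\<lambda>x. fderiv f x v + fderiv g x v)" using Suc by auto
  qed (use Suc.prems assms(1) in \<open>simp add: fderiv_add differentiable_on_eq_differentiable_at\<close>)
  then show ?case using Suc.prems by simp
qed

lemma C_k_on_bounded_linear:
  assumes "open S" "bounded_linear l" "C_k_on k S f"
  shows "C_k_on k S (\<lambda>x. l (f x))"
  using assms(3)
proof (induction k arbitrary: f)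
  case 0 then show ?case by (auto intro: bounded_linear.continuous_on[OF assms(2)])
next
  case (Suc k)
  have d: "f differentiable at x" if "x \<in> S" for x
    using Suc.prems that assms(1) by (simp add: differentiable_on_eq_differentiable_at)
  have "C_k_on k S (\<lambda>x. fderiv (\<lambda>x. l (f x)) x v)" for v
  proof (rule C_k_on_cong[OF assms(1)])
    show "C_k_on k S (\<lambda>x. l (fderiv f x v))" using Suc by auto
  qed (simp add: d fderiv_bounded_linear[OF assms(2)])
  moreover have "(\<lambda>x. l (f x)) differentiable_on S"
    unfolding differentiable_on_eq_differentiable_at[OF assms(1)]
    using bounded_linear.has_derivative[OF assms(2)] d unfolding differentiable_def by blast
  ultimately show ?case by simp
qed

lemma C_k_on_sum:
  assumes "open S" "\<And>i. i \<in> I \<Longrightarrow> C_k_on k S (f i)"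
  shows "C_k_on k S (\<lambda>x. \<Sum>i\<in>I. f i x)"
  using assms(2) by (induction I rule: infinite_finite_induct) (auto intro: C_k_on_const C_k_on_add assms(1))

lemma C_k_on_prod:
  assumes "open S" "bounded_bilinear p" "C_k_on k S f" "C_k_on k S g"
  shows "C_k_on k S (\<lambda>x. p (f x) (g x))"
  using assms(3,4)
proof (induction k arbitrary: f g)
  case 0 then show ?case by (auto intro: bounded_bilinear.continuous_on[OF assms(2)])
next
  case (Suc k)
  have d: "f differentiable at x" "g differentiable at x" if "x \<in> S" for x
    using Suc.prems that assms(1) by (auto simp add: differentiable_on_eq_differentiable_at)
  have "C_k_on k S (\<lambda>x. fderiv (\<lambda>x. p (f x) (g x)) x v)" for v
  proof (rule C_k_on_cong[OF assms(1)])
    show "C_k_on k S (\<lambda>x. p (f x) (fderiv g x v) + p (fderiv f x v) (g x))"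
      using Suc.prems C_k_on_Suc_imp[OF Suc.prems(1)] C_k_on_Suc_imp[OF Suc.prems(2)]
      by (intro C_k_on_add assms(1) Suc.IH) simp_all
  qed (simp add: d fderiv_prod[OF assms(2)])
  moreover have "(\<lambda>x. p (f x) (g x)) differentiable_on S"
    unfolding differentiable_on_eq_differentiable_at[OF assms(1)]
    using bounded_bilinear.FDERIV[OF assms(2)] d unfolding differentiable_def by blast
  ultimately show ?case by simp
qed

lemma fderiv_basis_expansion:
  fixes g :: "'a::real_normed_vector \<Rightarrow> 'b::euclidean_space"
  assumes "f differentiable at y"
  shows "fderiv f y w = (\<Sum>i\<in>Basis. (w \<bullet> i) *\<^sub>R fderiv f y i)"
proof -
  interpret linear "fderiv f y" by (rule linear_fderiv[OF assms])
  show ?thesis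
    by (subst euclidean_representation[of w, symmetric]) (simp add: sum scale)
qed

text \<open>The chain rule has to be expanded in a basis, since \<open>C_k_on\<close> sees the derivative only through its
  values at constant vectors.\<close>

lemma C_k_on_compose:
  fixes g :: "'a::euclidean_space \<Rightarrow> 'b::euclidean_space"
  assumes "open S" "open T" "g ` S \<subseteq> T" "C_k_on k S g" "C_k_on k T f"
  shows "C_k_on k S (\<lambda>x. f (g x))"
  using assms(4,5)
proof (induction k arbitrary: f)
  case 0 then show ?case using continuous_on_compose2[OF _ _ assms(3), of f] by simp
next
  case (Suc k)
  have d: "g differentiable at x" "f differentiable at (g x)" if "x \<in> S" for x
    using Suc.prems that assms(1-3) by (auto simp add: differentiable_on_eq_differentiable_at)
  have "C_k_on k S (\<lambda>x. fderiv (\<lambda>x. f (g x)) x v)" for v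
  proof (rule C_k_on_cong[OF assms(1)])
    show "C_k_on k S (\<lambda>x. \<Sum>i\<in>Basis. (fderiv g x v \<bullet> i) *\<^sub>R fderiv f (g x) i)"
    proof (rule C_k_on_sum[OF assms(1)], rule C_k_on_prod[OF assms(1) bounded_bilinear_scaleR])
      show "C_k_on k S (\<lambda>x. fderiv g x v \<bullet> i)" for i
        using C_k_on_bounded_linear[OF assms(1) bounded_linear_inner_left[of i]] Suc.prems(1) by simp
      show "C_k_on k S (\<lambda>x. fderiv f (g x) i)" for i
        using Suc.IH[of "\<lambda>y. fderiv f y i"] Suc.prems C_k_on_Suc_imp[of k S g] by simp
    qed
  next
    fix x assume "x \<in> S"
    then show "(\<Sum>i\<in>Basis. (fderiv g x v \<bullet> i) *\<^sub>R fderiv f (g x) i) = fderiv (\<lambda>x. f (g x)) x v"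
      using fderiv_basis_expansion[OF d(2), of x "fderiv g x v"] fderiv_compose[OF d, of x v] by simp
  qed
  moreover have "(\<lambda>x. f (g x)) differentiable_on S"
    unfolding differentiable_on_eq_differentiable_at[OF assms(1)]
    using d differentiable_chain_at[of g _ f] by (simp add: o_def)
  ultimately show ?case by simp
qed

lemma smooth_on_cong:
  "open S \<Longrightarrow> (\<And>x. x \<in> S \<Longrightarrow> f x = g x) \<Longrightarrow> smooth_on S f \<Longrightarrow> smooth_on S g"
  by (auto simp: smooth_on_def intro: C_k_on_cong)

lemma smooth_on_subset: "smooth_on S f \<Longrightarrow> T \<subseteq> S \<Longrightarrow> smooth_on T f"
  by (auto simp: smooth_on_def intro: C_k_on_subset)

lemma smooth_on_differentiable:
  "smooth_on S f \<Longrightarrow> open S \<Longrightarrow> x \<in> S \<Longrightarrow> f differentiable at x"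
  using differentiable_on_eq_differentiable_at[of S f]
  unfolding smooth_on_def by (metis C_k_on.simps(2))

lemma smooth_on_continuous_on: "smooth_on S f \<Longrightarrow> continuous_on S f"
  unfolding smooth_on_def by (metis C_k_on.simps(1))

lemma smooth_on_fderiv: "smooth_on S f \<Longrightarrow> smooth_on S (\<lambda>x. fderiv f x v)"
  unfolding smooth_on_def by (metis C_k_on.simps(2))

lemma smooth_on_const: "smooth_on S (\<lambda>x. c)"
  by (auto simp: smooth_on_def intro: C_k_on_const)

lemma smooth_on_bounded_linear:
  "open S \<Longrightarrow> bounded_linear l \<Longrightarrow> smooth_on S f \<Longrightarrow> smooth_on S (\<lambda>x. l (f x))"
  by (simp add: smooth_on_def C_k_on_bounded_linear)

lemma smooth_on_add:
  "open S \<Longrightarrow> smooth_on S f \<Longrightarrow> smooth_on S g \<Longrightarrow> smooth_on S (\<lambda>x. f x + g x)"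
  by (auto simp: smooth_on_def intro: C_k_on_add)

lemma smooth_on_minus: "open S \<Longrightarrow> smooth_on S f \<Longrightarrow> smooth_on S (\<lambda>x. - f x)"
  by (rule smooth_on_bounded_linear[OF _ bounded_linear_minus[OF bounded_linear_ident]])

lemma smooth_on_diff:
  "open S \<Longrightarrow> smooth_on S f \<Longrightarrow> smooth_on S g \<Longrightarrow> smooth_on S (\<lambda>x. f x - g x)"
  unfolding diff_conv_add_uminus by (intro smooth_on_add smooth_on_minus)

lemma smooth_on_sum:
  "open S \<Longrightarrow> (\<And>i. i \<in> I \<Longrightarrow> smooth_on S (f i)) \<Longrightarrow> smooth_on S (\<lambda>x. \<Sum>i\<in>I. f i x)"
  by (simp add: smooth_on_def C_k_on_sum)

lemma smooth_on_prod:
  "open S \<Longrightarrow> bounded_bilinear p \<Longrightarrow> smooth_on S f \<Longrightarrow> smooth_on S g \<Longrightarrow> smooth_on S (\<lambda>x. p (f x) (g x))"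
  by (simp add: smooth_on_def C_k_on_prod)

lemma smooth_on_scaleR:
  "open S \<Longrightarrow> smooth_on S f \<Longrightarrow> smooth_on S g \<Longrightarrow> smooth_on S (\<lambda>x. f x *\<^sub>R g x)"
  by (rule smooth_on_prod[OF _ bounded_bilinear_scaleR])

lemma smooth_on_mult:
  fixes f g :: "'a::euclidean_space \<Rightarrow> 'b::real_normed_algebra"
  shows "open S \<Longrightarrow> smooth_on S f \<Longrightarrow> smooth_on S g \<Longrightarrow> smooth_on S (\<lambda>x. f x * g x)"
  by (rule smooth_on_prod[OF _ bounded_bilinear_mult])

lemma smooth_on_compose:
  fixes g :: "'a::euclidean_space \<Rightarrow> 'b::euclidean_space"
  shows "open S \<Longrightarrow> open T \<Longrightarrow> g ` S \<subseteq> T \<Longrightarrow> smooth_on S g \<Longrightarrow> smooth_on T f \<Longrightarrow> smooth_on S (\<lambda>x. f (g x))"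
  by (simp add: smooth_on_def C_k_on_compose)

lemma C_k_on_powr: "C_k_on k {0<..} (\<lambda>x::real. x powr p)"
proof (induction k arbitrary: p)
  case 0 show ?case by (auto intro!: continuous_intros)
next
  case (Suc k)
  have der: "((\<lambda>x::real. x powr p) has_derivative (\<lambda>v. (p * x powr (p - 1)) * v)) (at x)" if "x > 0" for x
    using has_real_derivative_powr[of x p] that by (simp add: has_field_derivative_def)
  have "C_k_on k {0<..} (\<lambda>x. fderiv (\<lambda>x::real. x powr p) x v)" for v
  proof (rule C_k_on_cong[OF open_greaterThan])
    show "C_k_on k {0<..} (\<lambda>x::real. (p * v) *\<^sub>R (x powr (p - 1)))"
      by (rule C_k_on_bounded_linear[OF open_greaterThan bounded_linear_scaleR_right Suc.IH])
  qed (simp add: fderivI[OF der])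
  moreover have "(\<lambda>x::real. x powr p) differentiable_on {0<..}"
    using der by (auto simp: differentiable_on_def differentiable_def intro: has_derivative_at_withinI)
  ultimately show ?case by simp
qed

lemma smooth_on_powr:
  fixes f :: "'a::euclidean_space \<Rightarrow> real"
  assumes "open S" "smooth_on S f" "\<And>x. x \<in> S \<Longrightarrow> f x > 0"
  shows "smooth_on S (\<lambda>x. f x powr p)"
proof (rule smooth_on_compose[where T = "{0<..}" and f = "\<lambda>x. x powr p"])
  show "smooth_on {0<..} (\<lambda>x::real. x powr p)" by (simp add: smooth_on_def C_k_on_powr)
qed (use assms in auto)

lemma smooth_on_ln:
  fixes f :: "'a::euclidean_space \<Rightarrow> real"
  assumes "open S" "smooth_on S f" "\<And>x. x \<in> S \<Longrightarrow> f x > 0"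
  shows "smooth_on S (\<lambda>x. ln (f x))"
proof (rule smooth_on_compose[where T = "{0<..}" and f = ln])
  have der: "(ln has_derivative (\<lambda>v. (x powr (- 1)) * v)) (at x)" if "x > 0" for x :: real
    using DERIV_ln[OF that] that by (simp add: has_field_derivative_def powr_minus)
  have "C_k_on k {0<..} (ln :: real \<Rightarrow> real)" for k
  proof (cases k)
    case 0 then show ?thesis by (auto intro!: continuous_intros)
  next
    case (Suc k')
    have "C_k_on k' {0<..} (\<lambda>x. fderiv (ln :: real \<Rightarrow> real) x v)" for v
    proof (rule C_k_on_cong[OF open_greaterThan])
      show "C_k_on k' {0<..} (\<lambda>x::real. v *\<^sub>R (x powr (- 1)))"
        by (rule C_k_on_bounded_linear[OF open_greaterThan bounded_linear_scaleR_right C_k_on_powr])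
    qed (simp add: fderivI[OF der])
    moreover have "(ln :: real \<Rightarrow> real) differentiable_on {0<..}"
      using der by (auto simp: differentiable_on_def differentiable_def intro: has_derivative_at_withinI)
    ultimately show ?thesis using Suc by simp
  qed
  then show "smooth_on {0<..} (ln :: real \<Rightarrow> real)" by (simp add: smooth_on_def)
qed (use assms in auto)

section \<open>Symmetry of second derivatives\<close>

lemma line_has_real_derivative:
  fixes f :: "'a::real_normed_vector \<Rightarrow> real"
  assumes "f differentiable at (p + s *\<^sub>R u)"
  shows "((\<lambda>s. f (p + s *\<^sub>R u)) has_real_derivative fderiv f (p + s *\<^sub>R u) u) (at s)"
proof -
  have l: "((\<lambda>s. p + s *\<^sub>R u) has_derivative (\<lambda>t. t *\<^sub>R u)) (at s)"
    by (auto intro!: derivative_eq_intros)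
  have "((\<lambda>s. f (p + s *\<^sub>R u)) has_derivative (\<lambda>t. fderiv f (p + s *\<^sub>R u) (t *\<^sub>R u))) (at s)"
    by (rule has_derivative_compose[OF l assms[unfolded frechet_derivative_works]])
  moreover have "fderiv f (p + s *\<^sub>R u) (t *\<^sub>R u) = fderiv f (p + s *\<^sub>R u) u * t" for t
    using linear_scale[OF linear_fderiv[OF assms], of t u] by simp
  ultimately show ?thesis by (simp add: has_field_derivative_def)
qed

text \<open>The second difference over a parallelogram equals a second derivative at an inner point, by the mean
  value theorem in one direction and then in the other. Exchanging the two directions leaves the
  second difference unchanged, which yields the symmetry of second derivatives in the limit.\<close>

lemma second_difference_mean_value:
  fixes f :: "'a::euclidean_space \<Rightarrow> real"
  assumes "open S" "C_k_on 2 S f" "h > 0"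
    and sub: "\<And>s t. s \<in> {0..h} \<Longrightarrow> t \<in> {0..h} \<Longrightarrow> z + s *\<^sub>R u + t *\<^sub>R v \<in> S"
  obtains s t where "0 < s" "s < h" "0 < t" "t < h"
    "f (z + h *\<^sub>R u + h *\<^sub>R v) - f (z + h *\<^sub>R u) - f (z + h *\<^sub>R v) + f z
      = h * h * fderiv (\<lambda>x. fderiv f x u) (z + s *\<^sub>R u + t *\<^sub>R v) v"
proof -
  have C2: "f differentiable_on S" "\<And>w. (\<lambda>x. fderiv f x w) differentiable_on S"
    using assms(2) by (auto simp: numeral_2_eq_2)
  have df: "f differentiable at x" "(\<lambda>x. fderiv f x w) differentiable at x" if "x \<in> S" for x w
    using C2 that differentiable_on_eq_differentiable_at[OF assms(1)] by blast+
  define g where "g s = f ((z + h *\<^sub>R v) + s *\<^sub>R u) - f (z + s *\<^sub>R u)" for s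
  have "\<exists>s. 0 < s \<and> s < h \<and> g h - g 0 =
      (h - 0) * (fderiv f ((z + h *\<^sub>R v) + s *\<^sub>R u) u - fderiv f (z + s *\<^sub>R u) u)"
  proof (rule MVT2[OF assms(3)])
    fix s assume s: "0 \<le> s" "s \<le> h"
    have "(z + h *\<^sub>R v) + s *\<^sub>R u \<in> S" "z + s *\<^sub>R u \<in> S"
      using sub[of s h] sub[of s 0] s assms(3) by (auto simp: algebra_simps)
    then show "(g has_real_derivative
        (fderiv f ((z + h *\<^sub>R v) + s *\<^sub>R u) u - fderiv f (z + s *\<^sub>R u) u)) (at s)"
      unfolding g_def by (intro DERIV_diff line_has_real_derivative df)
  qed
  then obtain s where s: "0 < s" "s < h" and gs: "g h - g 0 =
      h * (fderiv f ((z + h *\<^sub>R v) + s *\<^sub>R u) u - fderiv f (z + s *\<^sub>R u) u)" by auto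
  have "\<exists>t. 0 < t \<and> t < h \<and>
      fderiv f ((z + s *\<^sub>R u) + h *\<^sub>R v) u - fderiv f ((z + s *\<^sub>R u) + 0 *\<^sub>R v) u
      = (h - 0) * fderiv (\<lambda>x. fderiv f x u) ((z + s *\<^sub>R u) + t *\<^sub>R v) v"
  proof (rule MVT2[OF assms(3)])
    fix t assume t: "0 \<le> t" "t \<le> h"
    then have "(z + s *\<^sub>R u) + t *\<^sub>R v \<in> S" using sub[of s t] s by auto
    then show "((\<lambda>t. fderiv f ((z + s *\<^sub>R u) + t *\<^sub>R v) u) has_real_derivative
        fderiv (\<lambda>x. fderiv f x u) ((z + s *\<^sub>R u) + t *\<^sub>R v) v) (at t)"
      by (intro line_has_real_derivative df)
  qed
  then obtain t where t: "0 < t" "t < h"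
      "fderiv f ((z + s *\<^sub>R u) + h *\<^sub>R v) u - fderiv f (z + s *\<^sub>R u) u
      = h * fderiv (\<lambda>x. fderiv f x u) ((z + s *\<^sub>R u) + t *\<^sub>R v) v" by auto
  have "g h - g 0 = h * (h * fderiv (\<lambda>x. fderiv f x u) ((z + s *\<^sub>R u) + t *\<^sub>R v) v)"
    unfolding gs t(3)[symmetric] by (simp add: add_ac)
  moreover have "g h - g 0 = f (z + h *\<^sub>R u + h *\<^sub>R v) - f (z + h *\<^sub>R u) - f (z + h *\<^sub>R v) + f z"
    unfolding g_def by (simp add: add_ac)
  ultimately show ?thesis using that[OF s t(1,2)] by (simp add: mult.assoc)
qed

lemma second_fderiv_commute_real:
  fixes f :: "'a::euclidean_space \<Rightarrow> real"
  assumes S: "open S" and C2: "C_k_on 2 S f" and "z \<in> S"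
  shows "fderiv (\<lambda>x. fderiv f x u) z v = fderiv (\<lambda>x. fderiv f x v) z u"
proof (rule ccontr)
  let ?A = "\<lambda>x. fderiv (\<lambda>x. fderiv f x u) x v" and ?B = "\<lambda>x. fderiv (\<lambda>x. fderiv f x v) x u"
  assume "?A z \<noteq> ?B z"
  define e where "e = \<bar>?A z - ?B z\<bar> / 2"
  have e: "e > 0" using \<open>?A z \<noteq> ?B z\<close> by (simp add: e_def)
  have "continuous_on S ?A" "continuous_on S ?B"
    using C2 by (auto simp: numeral_2_eq_2)
  then have lim: "(?A \<longlongrightarrow> ?A z) (nhds z)" "(?B \<longlongrightarrow> ?B z) (nhds z)"
    using continuous_on_eq_continuous_at[OF S] \<open>z \<in> S\<close>
    by (auto simp: isCont_def tendsto_at_iff_tendsto_nhds)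
  have "\<forall>\<^sub>F x in nhds z. dist (?A x) (?A z) < e" "\<forall>\<^sub>F x in nhds z. dist (?B x) (?B z) < e"
    by (rule tendstoD[OF lim(1) e], rule tendstoD[OF lim(2) e])
  moreover have "\<forall>\<^sub>F x in nhds z. x \<in> S" using S \<open>z \<in> S\<close> by (rule eventually_nhds_in_open)
  ultimately have "\<forall>\<^sub>F x in nhds z. x \<in> S \<and> dist (?A x) (?A z) < e \<and> dist (?B x) (?B z) < e"
    by (intro eventually_conj)
  then obtain d where d: "d > 0" "\<And>x. dist x z < d \<Longrightarrow>
      x \<in> S \<and> dist (?A x) (?A z) < e \<and> dist (?B x) (?B z) < e"
    unfolding eventually_nhds_metric by blast
  \<comment> \<open>The factor 2 keeps the whole parallelogram of side \<open>h\<close> inside the ball of radius \<open>d\<close>.\<close>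
  define h where "h = d / (2 * (norm u + norm v + 1))"
  have n: "norm u + norm v + 1 > 0" by (smt (verit) norm_ge_zero)
  then have h: "h > 0" using d by (simp add: h_def)
  have near: "dist (z + s *\<^sub>R u + t *\<^sub>R v) z < d" if "0 \<le> s" "s \<le> h" "0 \<le> t" "t \<le> h" for s t
  proof -
    have "dist (z + s *\<^sub>R u + t *\<^sub>R v) z = norm (s *\<^sub>R u + t *\<^sub>R v)" by (simp add: dist_norm add.assoc)
    also have "\<dots> \<le> s * norm u + t * norm v"
      using norm_triangle_ineq[of "s *\<^sub>R u" "t *\<^sub>R v"] that by simp
    also have "\<dots> \<le> h * norm u + h * norm v" using that by (intro add_mono mult_right_mono) auto
    also have "\<dots> \<le> h * (norm u + norm v + 1)" using h by (simp add: algebra_simps)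
    also have "h * (norm u + norm v + 1) = d / 2"
      using n unfolding h_def by (metis less_numeral_extra(3) mult.commute nonzero_mult_divide_mult_cancel_right times_divide_eq_left)
    also have "\<dots> < d" using d by simp
    finally show ?thesis .
  qed
  obtain s t where 1: "0 < s" "s < h" "0 < t" "t < h"
    "f (z + h *\<^sub>R u + h *\<^sub>R v) - f (z + h *\<^sub>R u) - f (z + h *\<^sub>R v) + f z
      = h * h * ?A (z + s *\<^sub>R u + t *\<^sub>R v)"
    by (rule second_difference_mean_value[OF S C2 h, of z u v]) (use near d in auto)
  obtain s' t' where 2: "0 < s'" "s' < h" "0 < t'" "t' < h"
    "f (z + h *\<^sub>R v + h *\<^sub>R u) - f (z + h *\<^sub>R v) - f (z + h *\<^sub>R u) + f z
      = h * h * ?B (z + s' *\<^sub>R v + t' *\<^sub>R u)"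
  proof (rule second_difference_mean_value[OF S C2 h, of z v u])
    show "z + s *\<^sub>R v + t *\<^sub>R u \<in> S" if "s \<in> {0..h}" "t \<in> {0..h}" for s t
      using near[of t s] that d by (simp add: add_ac)
  qed
  have "h * h * ?A (z + s *\<^sub>R u + t *\<^sub>R v) = h * h * ?B (z + s' *\<^sub>R v + t' *\<^sub>R u)"
    unfolding 1(5)[symmetric] 2(5)[symmetric] by (simp add: add_ac)
  then have "?A (z + s *\<^sub>R u + t *\<^sub>R v) = ?B (z + t' *\<^sub>R u + s' *\<^sub>R v)" using h by (simp add: add_ac)
  moreover have "dist (?A (z + s *\<^sub>R u + t *\<^sub>R v)) (?A z) < e" using near[of s t] d 1 by auto
  moreover have "dist (?B (z + t' *\<^sub>R u + s' *\<^sub>R v)) (?B z) < e" using near[of t' s'] d 2 by auto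
  moreover have "\<bar>?A z - ?B z\<bar> = 2 * e" by (simp add: e_def)
  ultimately show False unfolding dist_real_def by linarith
qed

lemma second_fderiv_commute:
  fixes f :: "'a::euclidean_space \<Rightarrow> 'b::euclidean_space"
  assumes S: "open S" and f: "smooth_on S f" and z: "z \<in> S"
  shows "fderiv (\<lambda>x. fderiv f x u) z v = fderiv (\<lambda>x. fderiv f x v) z u"
proof (rule euclidean_eqI)
  fix i :: 'b assume "i \<in> Basis"
  have l: "bounded_linear (\<lambda>y. y \<bullet> i)" by (rule bounded_linear_inner_left)
  have d: "fderiv (\<lambda>x. f x \<bullet> i) x w = fderiv f x w \<bullet> i" if "x \<in> S" for x w
    by (rule fderiv_bounded_linear[OF l smooth_on_differentiable[OF f S that]])
  have dd: "fderiv (\<lambda>x. fderiv (\<lambda>x. f x \<bullet> i) x w) z w' = fderiv (\<lambda>x. fderiv f x w) z w' \<bullet> i" for w w'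
    by (subst fderiv_cong_open[OF S z d])
      (auto intro: fderiv_bounded_linear[OF l] smooth_on_differentiable[OF smooth_on_fderiv[OF f] S z])
  have "C_k_on 2 S (\<lambda>x. f x \<bullet> i)"
    using smooth_on_bounded_linear[OF S l f] by (simp add: smooth_on_def)
  from second_fderiv_commute_real[OF S this z, of u v]
  show "fderiv (\<lambda>x. fderiv f x u) z v \<bullet> i = fderiv (\<lambda>x. fderiv f x v) z u \<bullet> i"
    unfolding dd .
qed

section \<open>Metrics and their connections\<close>

lemma linear_basis_expansion:
  fixes l :: "'a::euclidean_space \<Rightarrow> 'b::real_vector"
  assumes "linear l"
  shows "l w = (\<Sum>i\<in>Basis. (w \<bullet> i) *\<^sub>R l i)"
proof -
  have "l w = l (\<Sum>i\<in>Basis. (w \<bullet> i) *\<^sub>R i)" by (simp add: euclidean_representation)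
  then show ?thesis by (simp only: linear_sum[OF assms] linear_scale[OF assms])
qed

lemma bilinear_basis_expansion:
  fixes B :: "'a::euclidean_space \<Rightarrow> 'b::euclidean_space \<Rightarrow> real"
  assumes "bilinear B"
  shows "B y w = (\<Sum>i\<in>Basis. \<Sum>j\<in>Basis. (y \<bullet> i) * ((w \<bullet> j) * B i j))"
proof -
  have "B y w = B (\<Sum>i\<in>Basis. (y \<bullet> i) *\<^sub>R i) (\<Sum>j\<in>Basis. (w \<bullet> j) *\<^sub>R j)"
    by (simp add: euclidean_representation)
  also have "\<dots> = (\<Sum>i\<in>Basis. \<Sum>j\<in>Basis. (y \<bullet> i) * ((w \<bullet> j) * B i j))"
    unfolding bilinear_sum[OF assms] sum.cartesian_product
    by (intro sum.cong) (auto simp: bilinear_lmul[OF assms] bilinear_rmul[OF assms])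
  finally show ?thesis .
qed

lemma nondegenerate_cancel:
  assumes "bilinear B" "\<And>v. v \<noteq> 0 \<Longrightarrow> B v v > (0::real)" "\<And>w. B x w = B y w"
  shows "x = y"
proof (rule ccontr)
  assume "x \<noteq> y"
  then have "B (x - y) (x - y) > 0" using assms(2)[of "x - y"] by simp
  then show False using assms(3)[of "x - y"] bilinear_lsub[OF assms(1)] by simp
qed

text \<open>Christoffel symbols are defined by their inner products with all vectors, as in the Koszul formula;
  this lemma and the next turn such inner products into vectors, and in a bilinear way.\<close>

lemma riesz_representer:
  fixes B :: "'e::euclidean_space \<Rightarrow> 'e \<Rightarrow> real"
  assumes B: "bilinear B" and pos: "\<And>v. v \<noteq> 0 \<Longrightarrow> B v v > 0" and l: "linear l"
  shows "\<exists>x. \<forall>w. B x w = l w"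
proof -
  define L where "L v = (\<Sum>i\<in>Basis. B v i *\<^sub>R i)" for v
  have Bl: "linear (B v)" for v using B by (simp add: bilinear_def)
  have BL: "B v w = L v \<bullet> w" for v w
    unfolding linear_basis_expansion[OF Bl, of v w] L_def inner_sum_left
    by (simp add: inner_commute mult.commute)
  have "linear L"
    by (rule linearI) (simp_all add: L_def bilinear_ladd[OF B] bilinear_lmul[OF B] scaleR_add_left
        sum.distrib scaleR_sum_right)
  moreover have "inj L"
    using BL by (auto intro!: injI nondegenerate_cancel[OF B pos])
  ultimately have "surj L" by (rule linear_inj_imp_surj)
  then obtain x where "L x = (\<Sum>i\<in>Basis. l i *\<^sub>R i)" by (metis surjD)
  then have "B x w = l w" for w
    unfolding BL linear_basis_expansion[OF l, of w]
    by (simp add: inner_sum_left inner_commute[of w] mult.commute)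
  then show ?thesis by blast
qed

lemma bilinear_representer:
  fixes B :: "'e::euclidean_space \<Rightarrow> 'e \<Rightarrow> real"
  assumes B: "bilinear B" and pos: "\<And>v. v \<noteq> 0 \<Longrightarrow> B v v > 0"
    and K: "\<And>u v. linear (K u v)" "\<And>u w. linear (\<lambda>v. K u v w)" "\<And>v w. linear (\<lambda>u. K u v w)"
  obtains \<Gamma> where "bilinear \<Gamma>" "\<And>u v w. B (\<Gamma> u v) w = (K u v w :: real)"
proof -
  obtain \<Gamma> where G: "B (\<Gamma> u v) w = K u v w" for u v w
    using riesz_representer[OF B pos K(1)] by metis
  have eq: "x = y" if "\<And>w. B x w = B y w" for x y by (rule nondegenerate_cancel[OF B pos that])
  have "linear (\<lambda>y. \<Gamma> x y)" for x
    by (rule linearI; rule eq)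
      (simp_all add: G bilinear_ladd[OF B] bilinear_lmul[OF B] linear_add[OF K(2)] linear_scale[OF K(2)])
  moreover have "linear (\<lambda>x. \<Gamma> x y)" for y
    by (rule linearI; rule eq)
      (simp_all add: G bilinear_ladd[OF B] bilinear_lmul[OF B] linear_add[OF K(3)] linear_scale[OF K(3)])
  ultimately have "bilinear \<Gamma>" by (simp add: bilinear_def)
  then show ?thesis using G that by blast
qed

locale metric_patch =
  fixes V :: "'e::euclidean_space set" and G :: "'e metric"
  assumes open_V: "open V"
    and smooth_G: "\<And>v w. smooth_on V (\<lambda>p. G p v w)"
    and bilinear_G: "\<And>p. p \<in> V \<Longrightarrow> bilinear (G p)"
    and sym_G: "\<And>p v w. p \<in> V \<Longrightarrow> G p v w = G p w v"
    and pos_G: "\<And>p v. p \<in> V \<Longrightarrow> v \<noteq> 0 \<Longrightarrow> G p v v > 0"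
begin

abbreviation dG :: "'e \<Rightarrow> 'e \<Rightarrow> 'e \<Rightarrow> 'e \<Rightarrow> real" where
  "dG p u v w \<equiv> fderiv (\<lambda>q. G q v w) p u"

lemma differentiable_G: "p \<in> V \<Longrightarrow> (\<lambda>q. G q v w) differentiable at p"
  by (rule smooth_on_differentiable[OF smooth_G open_V])

lemma G_cancel: "p \<in> V \<Longrightarrow> (\<And>w. G p x w = G p y w) \<Longrightarrow> x = y"
  by (rule nondegenerate_cancel[OF bilinear_G pos_G])

lemma dG_linear1: "p \<in> V \<Longrightarrow> linear (\<lambda>u. dG p u v w)"
  by (rule linear_fderiv[OF differentiable_G])

lemma dG_sym: "p \<in> V \<Longrightarrow> dG p u v w = dG p u w v"
  by (rule arg_cong[where f = "\<lambda>D. D u"], rule fderiv_cong_open[OF open_V]) (auto simp: sym_G)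

lemma dG_linear3:
  assumes p: "p \<in> V" shows "linear (\<lambda>w. dG p u v w)"
proof (rule linearI)
  show "dG p u v (w + w') = dG p u v w + dG p u v w'" for w w'
    by (subst fderiv_cong_open[OF open_V p, of _ "\<lambda>q. G q v w + G q v w'"])
      (auto simp: bilinear_radd[OF bilinear_G] fderiv_add[OF differentiable_G differentiable_G] p)
  show "dG p u v (c *\<^sub>R w) = c *\<^sub>R dG p u v w" for c w
    by (subst fderiv_cong_open[OF open_V p, of _ "\<lambda>q. c *\<^sub>R G q v w"])
      (auto simp: bilinear_rmul[OF bilinear_G] p
        fderiv_bounded_linear[OF bounded_linear_mult_right differentiable_G])
qed

lemma dG_linear2:
  assumes "p \<in> V" shows "linear (\<lambda>v. dG p u v w)"
proof -
  have "(\<lambda>v. dG p u v w) = (\<lambda>v. dG p u w v)" by (rule ext, rule dG_sym[OF assms])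
  then show ?thesis using dG_linear3[OF assms] by simp
qed

lemma dG_bilinear: "p \<in> V \<Longrightarrow> bilinear (dG p u)"
  using dG_linear2 dG_linear3 by (simp add: bilinear_def)

lemmas dG_linear = dG_linear1 dG_linear2 dG_linear3

text \<open>The Koszul formula for constant fields, whose Lie brackets vanish.\<close>

lemma koszul:
  assumes p: "p \<in> V" and "metric_parallel G p \<Gamma>" "\<forall>u v. torsion \<Gamma> u v = 0"
  shows "G p (\<Gamma> u v) w = (dG p u v w + dG p v u w - dG p w u v) / 2"
proof -
  have t: "\<Gamma> v u = \<Gamma> u v" "\<Gamma> w u = \<Gamma> u w" "\<Gamma> w v = \<Gamma> v w" using assms(3) by (simp_all add: torsion_def)
  have d: "dG p u v w = G p (\<Gamma> u v) w + G p v (\<Gamma> u w)" for u v w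
    using assms(2) unfolding metric_parallel_def by blast
  show ?thesis
    unfolding d t using sym_G[OF p, of u "\<Gamma> v w"] sym_G[OF p, of v "\<Gamma> u w"] by simp
qed

lemma levi_civita_ex1:
  assumes p: "p \<in> V"
  shows "\<exists>!\<Gamma>. bilinear \<Gamma> \<and> metric_parallel G p \<Gamma> \<and> (\<forall>u v. torsion \<Gamma> u v = 0)"
proof (rule ex_ex1I)
  let ?K = "\<lambda>u v w. (1/2) *\<^sub>R (dG p u v w + dG p v u w - dG p w u v)"
  have K: "linear (?K u v)" "linear (\<lambda>v. ?K u v w)" "linear (\<lambda>u. ?K u v w)" for u v w
    by (intro linear_compose_scale_right linear_compose_add linear_compose_sub dG_linear p)+
  obtain \<Gamma> where \<Gamma>: "bilinear \<Gamma>" "\<And>u v w. G p (\<Gamma> u v) w = ?K u v w"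
    by (rule bilinear_representer[OF bilinear_G[OF p] pos_G[OF p] K]) auto
  have "metric_parallel G p \<Gamma>"
    unfolding metric_parallel_def
  proof (intro allI)
    fix u v w
    show "dG p u v w = G p (\<Gamma> u v) w + G p v (\<Gamma> u w)"
      unfolding sym_G[OF p, of v "\<Gamma> u w"] \<Gamma>(2) using dG_sym[OF p, of u w v] dG_sym[OF p, of v w u] dG_sym[OF p, of w v u]
      by (simp add: field_simps)
  qed
  moreover have "\<Gamma> u v = \<Gamma> v u" for u v
    by (rule G_cancel[OF p]) (use dG_sym[OF p] in \<open>simp add: \<Gamma>(2)\<close>)
  ultimately show "\<exists>\<Gamma>. bilinear \<Gamma> \<and> metric_parallel G p \<Gamma> \<and> (\<forall>u v. torsion \<Gamma> u v = 0)"
    using \<Gamma>(1) by (auto simp: torsion_def)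
next
  fix \<Gamma> \<Gamma>'
  assume 1: "bilinear \<Gamma> \<and> metric_parallel G p \<Gamma> \<and> (\<forall>u v. torsion \<Gamma> u v = 0)"
    and 2: "bilinear \<Gamma>' \<and> metric_parallel G p \<Gamma>' \<and> (\<forall>u v. torsion \<Gamma>' u v = 0)"
  show "\<Gamma> = \<Gamma>'"
  proof (intro ext, rule G_cancel[OF p])
    fix u v w
    show "G p (\<Gamma> u v) w = G p (\<Gamma>' u v) w"
      using koszul[OF p, of \<Gamma> u v w] koszul[OF p, of \<Gamma>' u v w] 1 2 by simp
  qed
qed

lemma levi_civita:
  assumes p: "p \<in> V"
  shows "bilinear (levi_civita G p)" "metric_parallel G p (levi_civita G p)"
    "levi_civita G p u v = levi_civita G p v u"
  using theI'[OF levi_civita_ex1[OF p]] by (auto simp: levi_civita_def torsion_def)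

lemma levi_civita_koszul:
  "p \<in> V \<Longrightarrow> G p (levi_civita G p u v) w = (dG p u v w + dG p v u w - dG p w u v) / 2"
  using theI'[OF levi_civita_ex1[of p]] by (intro koszul) (auto simp: levi_civita_def)

lemma pairing_expansion:
  "F z \<in> V \<Longrightarrow> G (F z) (Y z) (Z z) = (\<Sum>i\<in>Basis. \<Sum>j\<in>Basis. (Y z \<bullet> i) * ((Z z \<bullet> j) * G (F z) i j))"
  by (rule bilinear_basis_expansion[OF bilinear_G])

lemma smooth_on_pairing:
  fixes F Y Z :: "'a::euclidean_space \<Rightarrow> 'e"
  assumes "open U" "F ` U \<subseteq> V" "smooth_on U F" "smooth_on U Y" "smooth_on U Z"
  shows "smooth_on U (\<lambda>z. G (F z) (Y z) (Z z))"
proof (rule smooth_on_cong[OF assms(1)])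
  show "smooth_on U (\<lambda>z. \<Sum>i\<in>Basis. \<Sum>j\<in>Basis. (Y z \<bullet> i) * ((Z z \<bullet> j) * G (F z) i j))"
    using assms
    by (intro smooth_on_sum[OF assms(1)] smooth_on_mult[OF assms(1)]
        smooth_on_bounded_linear[OF assms(1) bounded_linear_inner_left]
        smooth_on_compose[OF assms(1) open_V _ _ smooth_G])
qed (use assms(2) in \<open>auto simp: pairing_expansion[of F]\<close>)

lemma fderiv_pairing:
  fixes F Y Z :: "'a::euclidean_space \<Rightarrow> 'e"
  assumes U: "open U" "z \<in> U" and FU: "F ` U \<subseteq> V"
    and F: "F differentiable at z" and Y: "Y differentiable at z" and Z: "Z differentiable at z"
  shows "fderiv (\<lambda>z. G (F z) (Y z) (Z z)) z v = dG (F z) (fderiv F z v) (Y z) (Z z)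
    + G (F z) (fderiv Y z v) (Z z) + G (F z) (Y z) (fderiv Z z v)"
proof -
  have p: "F z \<in> V" using U FU by auto
  have Gij: "((\<lambda>z. G (F z) i j) has_derivative (\<lambda>v. dG (F z) (fderiv F z v) i j)) (at z)" for i j
    using has_derivative_compose[OF F[unfolded frechet_derivative_works] differentiable_G[OF p, unfolded frechet_derivative_works]] .
  have Yi: "((\<lambda>z. Y z \<bullet> i) has_derivative (\<lambda>v. fderiv Y z v \<bullet> i)) (at z)" for i
    by (rule has_derivative_inner_left[OF Y[unfolded frechet_derivative_works]])
  have Zj: "((\<lambda>z. Z z \<bullet> j) has_derivative (\<lambda>v. fderiv Z z v \<bullet> j)) (at z)" for j
    by (rule has_derivative_inner_left[OF Z[unfolded frechet_derivative_works]])
  have "((\<lambda>z. \<Sum>i\<in>Basis. \<Sum>j\<in>Basis. (Y z \<bullet> i) * ((Z z \<bullet> j) * G (F z) i j)) has_derivative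
    (\<lambda>v. \<Sum>i\<in>Basis. \<Sum>j\<in>Basis. (Y z \<bullet> i) * ((Z z \<bullet> j) * dG (F z) (fderiv F z v) i j + (fderiv Z z v \<bullet> j) * G (F z) i j)
       + (fderiv Y z v \<bullet> i) * ((Z z \<bullet> j) * G (F z) i j))) (at z)"
    by (intro has_derivative_sum has_derivative_mult Gij Yi Zj)
  moreover have "fderiv (\<lambda>z. G (F z) (Y z) (Z z)) z =
      fderiv (\<lambda>z. \<Sum>i\<in>Basis. \<Sum>j\<in>Basis. (Y z \<bullet> i) * ((Z z \<bullet> j) * G (F z) i j)) z"
    by (rule fderiv_cong_open[OF U]) (use FU in \<open>auto simp: pairing_expansion[of F]\<close>)
  ultimately have "fderiv (\<lambda>z. G (F z) (Y z) (Z z)) z v =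
    (\<Sum>i\<in>Basis. \<Sum>j\<in>Basis. (Y z \<bullet> i) * ((Z z \<bullet> j) * dG (F z) (fderiv F z v) i j + (fderiv Z z v \<bullet> j) * G (F z) i j)
       + (fderiv Y z v \<bullet> i) * ((Z z \<bullet> j) * G (F z) i j))" by (simp add: fderivI)
  then show ?thesis
    unfolding bilinear_basis_expansion[OF dG_bilinear[OF p, of "fderiv F z v"], of "Y z" "Z z"]
      bilinear_basis_expansion[OF bilinear_G[OF p], of "fderiv Y z v" "Z z"]
      bilinear_basis_expansion[OF bilinear_G[OF p], of "Y z" "fderiv Z z v"]
    by (simp add: sum.distrib distrib_left)
qed

text \<open>The definition of a parallel metric tests constant fields; the chain rule carries this over to fields
  along a map.\<close>

lemma fderiv_pairing_cov:
  fixes F Y Z :: "complex \<Rightarrow> 'e"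
  assumes U: "open U" "z \<in> U" and FU: "F ` U \<subseteq> V"
    and F: "F differentiable at z" and Y: "Y differentiable at z" and Z: "Z differentiable at z"
    and \<Gamma>: "metric_parallel G (F z) (\<Gamma> (F z))"
  shows "fderiv (\<lambda>z. G (F z) (Y z) (Z z)) z v =
    G (F z) (cov_along \<Gamma> F Y z v) (Z z) + G (F z) (Y z) (cov_along \<Gamma> F Z z v)"
proof -
  have p: "F z \<in> V" using U FU by auto
  show ?thesis
    using \<Gamma> unfolding fderiv_pairing[OF U FU F Y Z] metric_parallel_def cov_along_def
    by (simp add: bilinear_ladd[OF bilinear_G[OF p]] bilinear_radd[OF bilinear_G[OF p]])
qed

end

section \<open>Hermitian metrics and the Chern connection\<close>

lemma J_add: "J (v + w) = J v + J w"
  by (vector distrib_left)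
lemma J_diff: "J (v - w) = J v - J w"
  by (vector right_diff_distrib)
lemma J_minus: "J (- v) = - J v"
  by (vector)
lemma J_scaleR: "J (c *\<^sub>R v) = c *\<^sub>R J v"
  by (simp add: vec_eq_iff)
lemma J_J: "J (J v) = - v"
  by (simp add: vec_eq_iff)
lemmas J_simps = J_add J_diff J_minus J_scaleR J_J

lemma bounded_linear_J: "bounded_linear J"
  by (rule linear_conv_bounded_linear[THEN iffD1], rule linearI) (simp_all add: J_add J_scaleR)

lemmas bilinear_simps = bilinear_ladd bilinear_radd bilinear_lsub bilinear_rsub
  bilinear_lneg bilinear_rneg bilinear_lmul bilinear_rmul

text \<open>The pointwise computation behind the formula for the normal curvature. Here \<open>a\<close>, \<open>b\<close> stand for
  \<open>F10\<close>, \<open>F01\<close>, the vectors \<open>av\<close>, \<open>aw\<close>, \<open>bv\<close>, \<open>bw\<close> for their Chern derivatives in a direction \<open>v\<close> and in the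
  direction \<open>w\<close> obtained from it by a right angle, and \<open>T\<close> for the torsion of the Chern connection.
  The fraction is the difference between the Levi-Civita and the Chern connection.

  With \<open>tA = g T(a,b) (J a)\<close>, differentiating the orthogonality of \<open>a\<close> and \<open>b\<close> and inserting the
  Cauchy-Riemann equations gives \<open>g T(a,b) (J b) = - tA\<close>. Then the Chern part of the left hand side
  contains the torsion through \<open>(A + B) (B - A) tA\<close>, and the difference of the connections contributes
  the same with the opposite sign.\<close>

lemma normal_connection_algebra:
  fixes g :: "complex ^ 2 \<Rightarrow> complex ^ 2 \<Rightarrow> real" and T :: "complex ^ 2 \<Rightarrow> complex ^ 2 \<Rightarrow> complex ^ 2"
  assumes g: "bilinear g" "\<And>u v. g u v = g v u" "\<And>u v. g (J u) (J v) = g u v"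
    and T: "bilinear T" "\<And>u v. T u v = - T v u" "\<And>u v. T u (J v) = J (T u v)"
    and ab: "av + J aw = - T a b" "bv - J bw = T a b"
    and orth: "g aw b + g a bw = 0" "g av (J b) + g a (J bv) = 0"
    and A: "A = g a a" and B: "B = g b b"
    and N1: "N1 = B *\<^sub>R a - A *\<^sub>R b" and N2: "N2 = - J (B *\<^sub>R a + A *\<^sub>R b)"
  shows "g (B *\<^sub>R av - A *\<^sub>R bv) N2 - (g (T (a + b) N1) N2 - g (T N1 N2) (a + b) + g (T N2 (a + b)) N1) / 2
    = B\<^sup>2 * g aw a + A\<^sup>2 * g bw b"
proof -
  define t where "t = T a b"
  note gl = bilinear_simps[OF g(1)]
  note Tl = bilinear_simps[OF T(1)]
  have gJ: "g (J u) v = - g u (J v)" for u v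
    using g(3)[of u "J v"] by (simp add: J_J gl)
  have TJ: "T (J u) v = J (T u v)" for u v
    using T(3)[of v u] T(2)[of "J u" v] T(2)[of u v] by (simp add: J_minus)
  have Tuu: "T u u = 0" for u proof -
    have "2 *\<^sub>R T u u = 0" using T(2)[of u u] unfolding scaleR_2 by (metis add.right_inverse)
    then show ?thesis by simp
  qed
  have tba: "T b a = - t" using T(2)[of b a] by (simp add: t_def)
  note av = ab(1)[folded t_def] and bv = ab(2)[folded t_def]
  have av: "av = - t - J aw" using av by (simp add: algebra_simps)
  have bv: "bv = t + J bw" using bv by (simp add: algebra_simps)
  define tA where "tA = g t (J a)"
  have "g av (J b) = - g t (J b) - g aw b" by (simp add: av gl gJ J_J)
  moreover have "g a (J bv) = - tA - g a bw"
    using gJ[of a t] g(2)[of t "J a"] by (simp add: bv tA_def gl J_simps)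
  ultimately have tB: "g t (J b) = - tA" using orth by simp
  have 1: "g (B *\<^sub>R av - A *\<^sub>R bv) N2 = (A + B) * (B - A) * tA + B\<^sup>2 * g aw a + A\<^sup>2 * g bw b"
  proof -
    have "g (B *\<^sub>R av - A *\<^sub>R bv) N2 = (A + B) * (B * tA + A * g t (J b))
        + (B\<^sup>2 * g aw a + A * B * (g aw b + g bw a) + A\<^sup>2 * g bw b)"
      by (simp add: N2 av bv gl gJ J_simps tA_def algebra_simps power2_eq_square)
    moreover have "g bw a = - g aw b" using orth(1) g(2)[of a bw] by simp
    ultimately show ?thesis by (simp add: tB algebra_simps)
  qed
  have T1: "T (a + b) N1 = - (A + B) *\<^sub>R t"
    by (simp add: N1 Tl Tuu tba flip: t_def) (simp add: algebra_simps)
  have T2: "T N1 N2 = - (2 * A * B) *\<^sub>R J t"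
    by (simp add: N1 N2 Tl T(3) J_simps Tuu tba flip: t_def) (simp add: vec_eq_iff scaleR_conv_of_real algebra_simps)
  have T3: "T N2 (a + b) = - (B - A) *\<^sub>R J t"
    by (simp add: N1 N2 Tl TJ J_simps Tuu tba flip: t_def) (simp add: algebra_simps)
  have "g (T (a + b) N1) N2 = (A + B) * ((B - A) * tA)"
    unfolding T1 by (simp add: N2 gl J_simps tB flip: tA_def) (simp add: algebra_simps)
  moreover have "g (T N1 N2) (a + b) = 0"
    unfolding T2 by (simp add: gl gJ J_simps tB flip: tA_def)
  moreover have "g (T N2 (a + b)) N1 = (A + B) * ((B - A) * tA)"
    unfolding T3 by (simp add: N1 gl gJ J_simps tB flip: tA_def) (simp add: algebra_simps)
  ultimately show ?thesis unfolding 1 by simp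
qed

locale hermitian_patch = metric_patch V G for V :: "(complex ^ 2) set" and G +
  assumes G_J_J: "\<And>p v w. p \<in> V \<Longrightarrow> G p (J v) (J w) = G p v w"
begin

lemma G_J_left: "p \<in> V \<Longrightarrow> G p (J v) w = - G p v (J w)"
  using G_J_J[of p v "J w"] by (simp add: J_J bilinear_rneg[OF bilinear_G])

lemma G_self_J: "p \<in> V \<Longrightarrow> G p v (J v) = 0"
  using G_J_left[of p v v] sym_G[of p "J v" v] by simp

lemma dG_J_J:
  assumes p: "p \<in> V" shows "dG p u (J v) (J w) = dG p u v w"
  using fderiv_cong_open[OF open_V p, of "\<lambda>q. G q (J v) (J w)" "\<lambda>q. G q v w"] G_J_J by simp

lemma dG_J_left: "p \<in> V \<Longrightarrow> dG p u (J v) w = - dG p u v (J w)"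
  using dG_J_J[where p = p and u = u and v = v and w = "J w"] by (simp add: J_J linear_neg[OF dG_linear3])

text \<open>The part \<open>R\<close> of \<open>\<Gamma>\<close> that is antilinear in the direction is symmetric because the \<open>(1,1)\<close>-part of
  the torsion vanishes. Hence it is also antilinear in its second argument, in which it is linear,
  and must be zero.\<close>

lemma torsion_part11_free_imp_complex_linear:
  assumes bil: "bilinear \<Gamma>" and J: "\<And>u v. \<Gamma> u (J v) = J (\<Gamma> u v)"
    and tor: "\<And>u v. part11 (torsion \<Gamma>) u v = 0"
  shows "\<Gamma> (J u) v = J (\<Gamma> u v)"
proof -
  define R where "R u v = \<Gamma> u v + J (\<Gamma> (J u) v)" for u v
  note l = bilinear_simps[OF bil]
  have R_sym: "R u v = R v u" for u v
    using tor[of u v] unfolding part11_def torsion_def R_def by (simp add: J) (simp add: algebra_simps)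
  have R1: "R (J u) v = - J (R u v)" for u v
    by (simp add: R_def J_simps l algebra_simps)
  have R2: "R u (J v) = J (R u v)" for u v
    by (simp add: R_def J J_simps)
  have "J (R u v) = - J (R u v)"
    using R2[of u v] R_sym[of u "J v"] R1[of v u] R_sym[of v u] by simp
  then have "2 *\<^sub>R J (R u v) = 0" unfolding scaleR_2 by (metis add.right_inverse)
  then have "J (R u v) = 0" by simp
  then have "J (J (R u v)) = 0" using J_scaleR[of 0] by simp
  then have "R u v = 0" unfolding J_J by simp
  then have "J (\<Gamma> u v + J (\<Gamma> (J u) v)) = 0" unfolding R_def using J_scaleR[of 0] by simp
  then show ?thesis by (simp add: J_simps)
qed

text \<open>The Chern connection of a Hermitian form \<open>h\<close> is \<open>h\<inverse> \<partial>h\<close>; in real terms the operator \<open>\<partial>\<close> becomes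
  half the sum of the derivative in direction \<open>u\<close> and that in direction \<open>J u\<close> paired with \<open>J\<close>.\<close>

lemma chern_formula:
  assumes p: "p \<in> V" and "bilinear \<Gamma>" "\<And>u v. \<Gamma> u (J v) = J (\<Gamma> u v)"
    "metric_parallel G p \<Gamma>" "\<And>u v. part11 (torsion \<Gamma>) u v = 0"
  shows "G p (\<Gamma> u v) w = (dG p u v w + dG p (J u) v (J w)) / 2"
proof -
  note l = bilinear_simps[OF bilinear_G[OF p]]
  have d: "dG p u v w = G p (\<Gamma> u v) w + G p v (\<Gamma> u w)" for u v w
    using assms(4) unfolding metric_parallel_def by blast
  have "\<Gamma> (J u) v = J (\<Gamma> u v)" for u v
    by (rule torsion_part11_free_imp_complex_linear[OF assms(2,3,5)])
  then show ?thesis unfolding d assms(3) by (simp add: G_J_J[OF p] J_J l)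
qed

lemma chern_ex1:
  assumes p: "p \<in> V"
  shows "\<exists>!\<Gamma>. bilinear \<Gamma> \<and> (\<forall>u v. \<Gamma> u (J v) = J (\<Gamma> u v)) \<and> metric_parallel G p \<Gamma> \<and>
      (\<forall>u v. part11 (torsion \<Gamma>) u v = 0)"
proof (rule ex_ex1I)
  let ?K = "\<lambda>u v w. (dG p u v w + dG p (J u) v (J w)) /\<^sub>R 2"
  have lJ: "linear J" using bounded_linear_J by (rule bounded_linear.linear)
  have K: "linear (?K u v)" "linear (\<lambda>v. ?K u v w)" "linear (\<lambda>u. ?K u v w)" for u v w
    using linear_compose[OF lJ dG_linear1[OF p, where v = v and w = "J w"]]
      linear_compose[OF lJ dG_linear3[OF p, where u = "J u" and v = v]]
    by (intro linear_compose_scale_right linear_compose_add dG_linear p; simp add: o_def)+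
  obtain \<Gamma> where \<Gamma>: "bilinear \<Gamma>" "\<And>u v w. G p (\<Gamma> u v) w = ?K u v w"
    by (rule bilinear_representer[OF bilinear_G[OF p] pos_G[OF p] K]) auto
  note l = bilinear_simps[OF bilinear_G[OF p]]
  note dl = linear_neg[OF dG_linear1[OF p]] linear_neg[OF dG_linear2[OF p]] linear_neg[OF dG_linear3[OF p]]
  have J2: "\<Gamma> u (J v) = J (\<Gamma> u v)" for u v
  proof (rule G_cancel[OF p])
    fix w
    have "2 * G p (\<Gamma> u (J v)) w = - dG p u v (J w) + dG p (J u) v w"
      using \<Gamma>(2)[of u "J v" w] by (simp add: dG_J_left[OF p] J_J dl)
    moreover have "2 * G p (J (\<Gamma> u v)) w = - (dG p u v (J w) - dG p (J u) v w)"
      using \<Gamma>(2)[of u v "J w"] by (simp add: G_J_left[OF p] J_J dl)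
    ultimately show "G p (\<Gamma> u (J v)) w = G p (J (\<Gamma> u v)) w" by argo
  qed
  have J1: "\<Gamma> (J u) v = J (\<Gamma> u v)" for u v
  proof (rule G_cancel[OF p])
    fix w
    have "2 * G p (\<Gamma> (J u) v) w = dG p (J u) v w - dG p u v (J w)"
      using \<Gamma>(2)[of "J u" v w] by (simp add: J_J dl)
    moreover have "2 * G p (J (\<Gamma> u v)) w = - (dG p u v (J w) - dG p (J u) v w)"
      using \<Gamma>(2)[of u v "J w"] by (simp add: G_J_left[OF p] J_J dl)
    ultimately show "G p (\<Gamma> (J u) v) w = G p (J (\<Gamma> u v)) w" by argo
  qed
  have "metric_parallel G p \<Gamma>"
    unfolding metric_parallel_def
  proof (intro allI)
    fix u v w
    have "dG p (J u) w (J v) = - dG p (J u) v (J w)"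
      using dG_J_left[OF p, where u = "J u" and v = v and w = w]
        dG_sym[OF p, where u = "J u" and v = w and w = "J v"] by simp
    then show "dG p u v w = G p (\<Gamma> u v) w + G p v (\<Gamma> u w)"
      unfolding sym_G[OF p, of v "\<Gamma> u w"] \<Gamma>(2) using dG_sym[OF p, where u = u and v = w and w = v]
      by (simp add: field_simps)
  qed
  moreover have "part11 (torsion \<Gamma>) u v = 0" for u v
    by (simp add: part11_def torsion_def J1 J2 J_J)
  ultimately show "\<exists>\<Gamma>. bilinear \<Gamma> \<and> (\<forall>u v. \<Gamma> u (J v) = J (\<Gamma> u v)) \<and> metric_parallel G p \<Gamma> \<and>
      (\<forall>u v. part11 (torsion \<Gamma>) u v = 0)"
    using \<Gamma>(1) J2 by blast
next
  fix \<Gamma> \<Gamma>'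
  assume 1: "bilinear \<Gamma> \<and> (\<forall>u v. \<Gamma> u (J v) = J (\<Gamma> u v)) \<and> metric_parallel G p \<Gamma> \<and>
      (\<forall>u v. part11 (torsion \<Gamma>) u v = 0)"
    and 2: "bilinear \<Gamma>' \<and> (\<forall>u v. \<Gamma>' u (J v) = J (\<Gamma>' u v)) \<and> metric_parallel G p \<Gamma>' \<and>
      (\<forall>u v. part11 (torsion \<Gamma>') u v = 0)"
  show "\<Gamma> = \<Gamma>'"
  proof (intro ext, rule G_cancel[OF p])
    fix u v w
    show "G p (\<Gamma> u v) w = G p (\<Gamma>' u v) w"
      using chern_formula[OF p, of \<Gamma> u v w] chern_formula[OF p, of \<Gamma>' u v w] 1 2 by simp
  qed
qed

abbreviation \<Gamma>C where "\<Gamma>C \<equiv> chern_connection G"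

lemma chern_connection:
  assumes p: "p \<in> V"
  shows "bilinear (\<Gamma>C p)" "\<Gamma>C p u (J v) = J (\<Gamma>C p u v)" "\<Gamma>C p (J u) v = J (\<Gamma>C p u v)"
    "metric_parallel G p (\<Gamma>C p)"
proof -
  have *: "bilinear (\<Gamma>C p) \<and> (\<forall>u v. \<Gamma>C p u (J v) = J (\<Gamma>C p u v)) \<and> metric_parallel G p (\<Gamma>C p) \<and>
      (\<forall>u v. part11 (torsion (\<Gamma>C p)) u v = 0)"
    using theI'[OF chern_ex1[OF p]] by (simp add: chern_connection_def)
  then show "bilinear (\<Gamma>C p)" "\<Gamma>C p u (J v) = J (\<Gamma>C p u v)" "metric_parallel G p (\<Gamma>C p)" by blast+
  show "\<Gamma>C p (J u) v = J (\<Gamma>C p u v)"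
    by (rule torsion_part11_free_imp_complex_linear) (use * in auto)
qed

text \<open>Two metric connections differ by the contorsion, an expression in the difference of their torsions.\<close>

lemma levi_civita_vs_chern:
  assumes p: "p \<in> V"
  shows "G p (levi_civita G p u v) w = G p (\<Gamma>C p u v) w -
    (G p (torsion (\<Gamma>C p) u v) w - G p (torsion (\<Gamma>C p) v w) u + G p (torsion (\<Gamma>C p) w u) v) / 2"
proof -
  note l = bilinear_simps[OF bilinear_G[OF p]]
  have d: "dG p u v w = G p (\<Gamma>C p u v) w + G p v (\<Gamma>C p u w)" for u v w
    using chern_connection(4)[OF p] unfolding metric_parallel_def by blast
  show ?thesis
    unfolding levi_civita_koszul[OF p] d torsion_def l
    using sym_G[OF p, of u "\<Gamma>C p v w"] sym_G[OF p, of u "\<Gamma>C p w v"] sym_G[OF p, of v "\<Gamma>C p w u"]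
      sym_G[OF p, of v "\<Gamma>C p u w"]
    by (simp add: field_simps)
qed

end

section \<open>Frames, connection forms and Gaussian curvature\<close>

definition laplacian :: "(complex \<Rightarrow> real) \<Rightarrow> complex \<Rightarrow> real" where
  "laplacian u z = fderiv (\<lambda>x. fderiv u x 1) z 1 + fderiv (\<lambda>x. fderiv u x \<i>) z \<i>"

lemma differentiable_cong_open:
  assumes "open S" "x \<in> S" "\<And>y. y \<in> S \<Longrightarrow> f y = g y" "f differentiable at x"
  shows "g differentiable at x"
  using has_derivative_transform_within_open[where f = f and g = g, OF _ assms(1,2)] assms(3,4)
  unfolding differentiable_def by blast

lemma linear_complex_expansion:
  fixes L :: "complex \<Rightarrow> 'a::real_vector"
  assumes "linear L" shows "L v = Re v *\<^sub>R L 1 + Im v *\<^sub>R L \<i>"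
proof -
  have "L v = L (Re v *\<^sub>R 1 + Im v *\<^sub>R \<i>)"
    by (rule arg_cong[where f = L]) (simp add: complex_eq_iff)
  then show ?thesis by (simp only: linear_add[OF assms] linear_scale[OF assms])
qed

lemma fderiv_expansion:
  "f differentiable at z \<Longrightarrow> fderiv f z v = Re v *\<^sub>R fderiv f z 1 + Im v *\<^sub>R fderiv f z \<i>"
  for f :: "complex \<Rightarrow> 'a::real_normed_vector"
  by (rule linear_complex_expansion[OF linear_fderiv])

lemma second_fderiv_expansion:
  fixes u :: "complex \<Rightarrow> real"
  assumes W: "open W" "z \<in> W" and u: "smooth_on W u"
  shows "fderiv (\<lambda>x. fderiv u x v) z w = Re v * (Re w * fderiv (\<lambda>x. fderiv u x 1) z 1 + Im w * fderiv (\<lambda>x. fderiv u x 1) z \<i>)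
    + Im v * (Re w * fderiv (\<lambda>x. fderiv u x \<i>) z 1 + Im w * fderiv (\<lambda>x. fderiv u x \<i>) z \<i>)"
proof -
  have d: "u differentiable at x" if "x \<in> W" for x by (rule smooth_on_differentiable[OF u W(1) that])
  have dd: "(\<lambda>x. fderiv u x v) differentiable at z" for v
    by (rule smooth_on_differentiable[OF smooth_on_fderiv[OF u] W])
  have "fderiv (\<lambda>x. fderiv u x v) z w = fderiv (\<lambda>x. Re v *\<^sub>R fderiv u x 1 + Im v *\<^sub>R fderiv u x \<i>) z w"
    by (rule fun_cong[OF fderiv_cong_open[OF W]]) (rule fderiv_expansion[OF d])
  also have "\<dots> = Re v * fderiv (\<lambda>x. fderiv u x 1) z w + Im v * fderiv (\<lambda>x. fderiv u x \<i>) z w"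
    using dd by (simp add: fderiv_add fderiv_mult)
  finally show ?thesis
    unfolding fderiv_expansion[OF dd, of _ w] by simp
qed

text \<open>Connection forms of conformally adapted frames are multiples of a differential rotated by a right
  angle; their exterior derivative is a Laplacian.\<close>

lemma ext_deriv_conjugate_differential:
  assumes W: "open W" "z \<in> W" and u: "smooth_on W u"
    and \<theta>: "\<And>y v. y \<in> W \<Longrightarrow> \<theta> y v = k * fderiv u y (\<i> * v)"
  shows "ext_deriv \<theta> z v w = - k * laplacian u z * (Re v * Im w - Im v * Re w)"
proof -
  have dd: "(\<lambda>x. fderiv u x v) differentiable at z" for v
    by (rule smooth_on_differentiable[OF smooth_on_fderiv[OF u] W])
  have "fderiv (\<lambda>y. \<theta> y v) z w = fderiv (\<lambda>y. k * fderiv u y (\<i> * v)) z w" for v w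
    by (rule fun_cong[OF fderiv_cong_open[OF W]]) (rule \<theta>)
  then have *: "fderiv (\<lambda>y. \<theta> y v) z w = k * fderiv (\<lambda>x. fderiv u x (\<i> * v)) z w" for v w
    by (simp add: fderiv_mult dd)
  show ?thesis
    unfolding ext_deriv_def * second_fderiv_expansion[OF W u, of "\<i> * _"] laplacian_def
    by (simp add: algebra_simps)
qed

lemma cov_along_smooth_combination:
  assumes W: "open W" "z \<in> W" and \<Gamma>: "bilinear (\<Gamma> (F z))"
    and n: "\<And>y. y \<in> W \<Longrightarrow> n y = c y *\<^sub>R e y + s y *\<^sub>R e' y"
    and d: "c differentiable at z" "s differentiable at z" "e differentiable at z" "e' differentiable at z"
  shows "cov_along \<Gamma> F n z v = c z *\<^sub>R cov_along \<Gamma> F e z v + s z *\<^sub>R cov_along \<Gamma> F e' z v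
    + fderiv c z v *\<^sub>R e z + fderiv s z v *\<^sub>R e' z"
proof -
  have "fderiv n z v = fderiv (\<lambda>y. c y *\<^sub>R e y + s y *\<^sub>R e' y) z v"
    by (rule fun_cong[OF fderiv_cong_open[OF W]]) (rule n)
  also have "\<dots> = c z *\<^sub>R fderiv e z v + fderiv c z v *\<^sub>R e z + (s z *\<^sub>R fderiv e' z v + fderiv s z v *\<^sub>R e' z)"
    using d by (simp add: fderiv_add fderiv_scaleR)
  finally show ?thesis
    using n[OF W(2)] by (simp add: cov_along_def bilinear_simps[OF \<Gamma>] algebra_simps)
qed

context metric_patch
begin

text \<open>Independence of the curvature from the frame. A rotation by an angle \<open>\<tau>\<close> adds \<open>d\<tau>\<close> to the
  connection form. Written with \<open>c = cos \<tau>\<close> and \<open>s = sin \<tau>\<close> this is \<open>c ds - s dc\<close>, so that no choice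
  of \<open>\<tau>\<close> is involved.\<close>

lemma ext_deriv_connection_form_rotate:
  fixes F :: "complex \<Rightarrow> 'e"
  assumes W: "open W" "z \<in> W" and FW: "F ` W \<subseteq> V" and F: "smooth_on W F"
    and sm: "smooth_on W e" "smooth_on W e'" "smooth_on W c" "smooth_on W s"
    and orth: "\<And>y. y \<in> W \<Longrightarrow> orthonormal_pair (G (F y)) (e y) (e' y)"
    and n: "\<And>y. y \<in> W \<Longrightarrow> m y = c y *\<^sub>R e y + s y *\<^sub>R e' y"
      "\<And>y. y \<in> W \<Longrightarrow> m' y = - s y *\<^sub>R e y + c y *\<^sub>R e' y"
    and cs: "\<And>y. y \<in> W \<Longrightarrow> (c y)\<^sup>2 + (s y)\<^sup>2 = 1"
    and \<Gamma>: "\<And>p. p \<in> V \<Longrightarrow> bilinear (\<Gamma> p)" "\<And>p. p \<in> V \<Longrightarrow> metric_parallel G p (\<Gamma> p)"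
    and \<theta>: "\<And>v. (\<lambda>y. connection_form G \<Gamma> F e e' y v) differentiable at z"
  shows "ext_deriv (connection_form G \<Gamma> F m m') z v w = ext_deriv (connection_form G \<Gamma> F e e') z v w"
proof -
  let ?\<theta> = "connection_form G \<Gamma> F e e'"
  have d: "f differentiable at y" if "smooth_on W f" "y \<in> W" for f :: "complex \<Rightarrow> 'x::real_normed_vector" and y
    by (rule smooth_on_differentiable[OF that(1) W(1) that(2)])
  have form: "connection_form G \<Gamma> F m m' y v = ?\<theta> y v + (c y * fderiv s y v - s y * fderiv c y v)"
    if y: "y \<in> W" for y v
  proof -
    have p: "F y \<in> V" using FW y by auto
    have o: "G (F x) (e x) (e x) = 1" "G (F x) (e' x) (e' x) = 1"
        "G (F x) (e x) (e' x) = 0" if "x \<in> W" for x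
      using orth[OF that] by (auto simp: orthonormal_pair_def)
    note pair = fderiv_pairing_cov[where \<Gamma> = \<Gamma> and v = v, OF W(1) y FW d[OF F y] _ _ \<Gamma>(2)[OF p]]
    have const: "fderiv f y v = 0" if "\<And>x. x \<in> W \<Longrightarrow> f x = k" for f :: "complex \<Rightarrow> real" and k
      using fderiv_cong_open[OF W(1) y, of f "\<lambda>_. k"] that by simp
    let ?D = "\<lambda>X. cov_along \<Gamma> F X y v"
    have 11: "G (F y) (?D e) (e y) = 0"
      using pair[OF d d, OF sm(1) y sm(1) y] const[OF o(1)] sym_G[OF p, of "e y"] by simp
    have 22: "G (F y) (?D e') (e' y) = 0"
      using pair[OF d d, OF sm(2) y sm(2) y] const[OF o(2)] sym_G[OF p, of "e' y"] by simp
    have 12: "G (F y) (?D e') (e y) = - G (F y) (?D e) (e' y)"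
      using pair[OF d d, OF sm(1) y sm(2) y] const[OF o(3)] sym_G[OF p, of "e y" "?D e'"] by simp
    have Dn: "?D m = c y *\<^sub>R ?D e + s y *\<^sub>R ?D e' + fderiv c y v *\<^sub>R e y + fderiv s y v *\<^sub>R e' y"
      by (rule cov_along_smooth_combination[where F = F and \<Gamma> = \<Gamma> and n = m and e = e and e' = e' and c = c and s = s,
            OF W(1) y \<Gamma>(1)[OF p] n(1)]) (auto intro: d sm y)
    have "connection_form G \<Gamma> F m m' y v = ((c y)\<^sup>2 + (s y)\<^sup>2) * ?\<theta> y v + (c y * fderiv s y v - s y * fderiv c y v)"
      unfolding connection_form_def Dn n(2)[OF y]
      using o[OF y] sym_G[OF p, of "e' y" "e y"]
      by (simp add: bilinear_simps[OF bilinear_G[OF p]] 11 22 12 algebra_simps power2_eq_square)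
    then show ?thesis by (simp add: cs[OF y])
  qed
  have dd: "(\<lambda>x. fderiv f x v) differentiable at z" if "smooth_on W f" for f :: "complex \<Rightarrow> real" and v
    by (rule d[OF smooth_on_fderiv[OF that] W(2)])
  have "fderiv (\<lambda>y. connection_form G \<Gamma> F m m' y v) z w = fderiv (\<lambda>y. ?\<theta> y v) z w
      + (c z * fderiv (\<lambda>y. fderiv s y v) z w + fderiv c z w * fderiv s z v
      - (s z * fderiv (\<lambda>y. fderiv c y v) z w + fderiv s z w * fderiv c z v))" for v w
  proof -
    have "fderiv (\<lambda>y. connection_form G \<Gamma> F m m' y v) z w
        = fderiv (\<lambda>y. ?\<theta> y v + (c y * fderiv s y v - s y * fderiv c y v)) z w"
      by (rule fun_cong[OF fderiv_cong_open[OF W]]) (rule form)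
    then show ?thesis
      by (simp add: fderiv_add fderiv_diff fderiv_mult \<theta> dd d[OF _ W(2)] sm)
  qed
  moreover have "fderiv (\<lambda>y. fderiv f y v) z w = fderiv (\<lambda>y. fderiv f y w) z v"
    if "smooth_on W f" for f :: "complex \<Rightarrow> real" and v w
    by (rule second_fderiv_commute[OF W(1) that W(2)])
  ultimately have *: "ext_deriv (connection_form G \<Gamma> F m m') z v w = ext_deriv ?\<theta> z v w
     + 2 * (fderiv c z v * fderiv s z w - fderiv c z w * fderiv s z v)"
    unfolding ext_deriv_def using sm by simp
  \<comment> \<open>The differentials of \<open>c\<close> and \<open>s\<close> are proportional because \<open>c\<^sup>2 + s\<^sup>2\<close> is constant.\<close>
  have dcs: "c z * fderiv c z v + s z * fderiv s z v = 0" for v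
  proof -
    have "fderiv (\<lambda>y. c y * c y + s y * s y) z v = fderiv (\<lambda>y. 1::real) z v"
      using fderiv_cong_open[OF W, of "\<lambda>y. c y * c y + s y * s y" "\<lambda>_. 1"] cs
      by (simp add: power2_eq_square)
    then show ?thesis by (simp add: fderiv_add fderiv_mult d[OF _ W(2)] sm)
  qed
  define X where "X = fderiv c z v * fderiv s z w - fderiv c z w * fderiv s z v"
  have "X = ((c z)\<^sup>2 + (s z)\<^sup>2) * X" using cs[OF W(2)] by simp
  also have "\<dots> = 0"
    using dcs[of v] dcs[of w] unfolding X_def by algebra
  finally show ?thesis using * by (simp add: X_def)
qed

end

lemma powr_minus_half_mult: "x > 0 \<Longrightarrow> x powr (- 1/2) * x powr (- 1/2) = 1 / (x::real)"
  by (simp add: powr_minus_divide flip: powr_add)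

locale conformal_metric =
  fixes U :: "complex set" and h :: "complex metric" and \<rho> :: "complex \<Rightarrow> real"
  assumes open_U: "open U" and smooth_\<rho>: "smooth_on U \<rho>"
    and pos_\<rho>: "\<And>z. z \<in> U \<Longrightarrow> \<rho> z > 0"
    and h_eq: "\<And>z v w. z \<in> U \<Longrightarrow> h z v w = \<rho> z * (v \<bullet> w)"
begin

lemma h_eq_fun: "z \<in> U \<Longrightarrow> h z = (\<lambda>v w. \<rho> z * (v \<bullet> w))"
  using h_eq by (intro ext)

sublocale metric_patch U h
proof
  show "open U" by (rule open_U)
  show "smooth_on U (\<lambda>p. h p v w)" for v w
    by (rule smooth_on_cong[OF open_U, of "\<lambda>p. \<rho> p * (v \<bullet> w)"])
      (use h_eq smooth_on_mult[OF open_U smooth_\<rho> smooth_on_const] in auto)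
  show "bilinear (h p)" if "p \<in> U" for p
    unfolding h_eq_fun[OF that] bilinear_def by (auto intro!: linearI simp: algebra_simps inner_simps)
  show "h p v w = h p w v" if "p \<in> U" for p v w using that by (simp add: h_eq inner_commute)
  show "h p v v > 0" if "p \<in> U" "v \<noteq> 0" for p v using that by (simp add: h_eq pos_\<rho>)
qed

lemma differentiable_\<rho>: "z \<in> U \<Longrightarrow> \<rho> differentiable at z"
  by (rule smooth_on_differentiable[OF smooth_\<rho> open_U])

lemma dh_eq:
  assumes z: "z \<in> U" shows "dG z u v w = fderiv \<rho> z u * (v \<bullet> w)"
proof -
  have "dG z u v w = fderiv (\<lambda>q. \<rho> q * (v \<bullet> w)) z u"
    using fderiv_cong_open[OF open_U z, of "\<lambda>q. h q v w" "\<lambda>q. \<rho> q * (v \<bullet> w)"] h_eq by simp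
  then show ?thesis by (simp add: fderiv_mult differentiable_\<rho>[OF z])
qed

lemma levi_civita_conformal:
  assumes z: "z \<in> U"
  shows "\<rho> z * (levi_civita h z u v \<bullet> w) =
    (fderiv \<rho> z u * (v \<bullet> w) + fderiv \<rho> z v * (u \<bullet> w) - fderiv \<rho> z w * (u \<bullet> v)) / 2"
  using levi_civita_koszul[OF z, of u v w] by (simp add: h_eq[OF z] dh_eq[OF z])

lemma levi_civita_trace: "z \<in> U \<Longrightarrow> levi_civita h z 1 1 + levi_civita h z \<i> \<i> = 0"
proof (rule G_cancel)
  fix w assume z: "z \<in> U"
  show "h z (levi_civita h z 1 1 + levi_civita h z \<i> \<i>) w = h z 0 w"
    unfolding h_eq[OF z] inner_add_left distrib_left levi_civita_conformal[OF z]
    using fderiv_expansion[OF differentiable_\<rho>[OF z], of w] by (simp add: inner_complex_def field_simps)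
qed

definition frame1 :: "complex \<Rightarrow> complex" where "frame1 z = (\<rho> z powr (- 1/2)) *\<^sub>R 1"
definition frame2 :: "complex \<Rightarrow> complex" where "frame2 z = (\<rho> z powr (- 1/2)) *\<^sub>R \<i>"

lemma smooth_frame: "smooth_on U frame1" "smooth_on U frame2"
  unfolding frame1_def frame2_def
  by (intro smooth_on_scaleR[OF open_U] smooth_on_powr[OF open_U smooth_\<rho> pos_\<rho>] smooth_on_const; simp)+

lemma orthonormal_frame:
  "z \<in> U \<Longrightarrow> orthonormal_pair (h z) (frame1 z) (frame2 z)"
  using powr_minus_half_mult[OF pos_\<rho>] pos_\<rho>[of z]
  by (simp add: orthonormal_pair_def h_eq frame1_def frame2_def inner_complex_def)

lemma connection_form_frame:
  assumes z: "z \<in> U"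
  shows "connection_form h (levi_civita h) (\<lambda>y. y) frame1 frame2 z v = (- 1/2) * fderiv (\<lambda>z. ln (\<rho> z)) z (\<i> * v)"
proof -
  let ?l = "\<lambda>z. \<rho> z powr (- 1/2)"
  have dl: "?l differentiable at z"
    by (rule smooth_on_differentiable[OF smooth_on_powr[OF open_U smooth_\<rho> pos_\<rho>] open_U z])
  have "fderiv frame1 z v = of_real (fderiv ?l z v)"
    unfolding frame1_def[abs_def] by (subst fderiv_scaleR[OF dl]) (simp_all add: scaleR_conv_of_real)
  then have "connection_form h (levi_civita h) (\<lambda>y. y) frame1 frame2 z v
      = (?l z * ?l z) * (\<rho> z * (levi_civita h z v 1 \<bullet> \<i>))"
    unfolding connection_form_def cov_along_def h_eq[OF z] frame1_def frame2_def
    by (simp add: bilinear_rmul[OF levi_civita(1)[OF z]] inner_simps inner_complex_def)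
  also have "\<dots> = (fderiv \<rho> z 1 * Im v - fderiv \<rho> z \<i> * Re v) / (2 * \<rho> z)"
    unfolding powr_minus_half_mult[OF pos_\<rho>[OF z]] levi_civita_conformal[OF z]
    by (simp add: inner_complex_def)
  finally have 1: "connection_form h (levi_civita h) (\<lambda>y. y) frame1 frame2 z v
      = (fderiv \<rho> z 1 * Im v - fderiv \<rho> z \<i> * Re v) / (2 * \<rho> z)" .
  have "fderiv (\<lambda>z. ln (\<rho> z)) z (\<i> * v) = fderiv \<rho> z (\<i> * v) / \<rho> z"
    using fderiv_real_compose[OF DERIV_ln[OF pos_\<rho>[OF z]] differentiable_\<rho>[OF z]]
    by (simp add: field_simps)
  then show ?thesis
    unfolding 1 fderiv_expansion[OF differentiable_\<rho>[OF z], of "\<i> * v"]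
    using pos_\<rho>[OF z] by (simp add: field_simps)
qed

lemma area_form_conformal: "z \<in> U \<Longrightarrow> area_form h z v w = \<rho> z * (Re v * Im w - Im v * Re w)"
  using pos_\<rho>[of z] by (simp add: area_form_def h_eq inner_complex_def)

lemma orthonormal_positive_basis_rotation:
  assumes z: "z \<in> U" and on: "orthonormal_pair (h z) E1 E2" and pos: "positive_basis2 E1 E2"
  shows "E2 = \<i> * E1"
proof -
  have o: "\<rho> z * (E1 \<bullet> E1) = 1" "\<rho> z * (E2 \<bullet> E2) = 1" "\<rho> z * (E1 \<bullet> E2) = 0"
    using on by (auto simp: orthonormal_pair_def h_eq[OF z])
  define n m x d where "n = Re E1 * Re E1 + Im E1 * Im E1" and "m = Re E2 * Re E2 + Im E2 * Im E2"
    and "x = Re E1 * Re E2 + Im E1 * Im E2" and "d = Re E1 * Im E2 - Im E1 * Re E2"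
  note defs = this
  have nm: "\<rho> z * n = 1" "\<rho> z * m = 1" "x = 0"
    using o pos_\<rho>[OF z] by (auto simp: defs inner_complex_def)
  have "\<rho> z * n = \<rho> z * m" by (simp only: nm)
  then have "n = m" using pos_\<rho>[OF z] by simp
  moreover have "d\<^sup>2 + x\<^sup>2 = n * m" by (simp add: defs power2_eq_square algebra_simps)
  ultimately have "d\<^sup>2 = n\<^sup>2" using nm(3) by (simp add: power2_eq_square)
  moreover have "d > 0" using pos by (simp add: defs positive_basis2_def)
  moreover have n: "n > 0" using nm(1) pos_\<rho>[OF z] zero_less_mult_pos[of "\<rho> z" n] by simp
  ultimately have dn: "d = n" by (simp add: power2_eq_iff)
  have "n * Re E2 = Re E1 * x - Im E1 * d" "n * Im E2 = Im E1 * x + Re E1 * d"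
    by (simp_all add: defs algebra_simps)
  then have "n * Re E2 = n * (- Im E1)" "n * Im E2 = n * Re E1"
    by (simp_all add: dn nm)
  then have "Re E2 = - Im E1" "Im E2 = Re E1" using n by (simp_all only: mult_cancel_left) auto
  then show ?thesis by (simp add: complex_eq_iff)
qed

text \<open>The curvature of a conformal metric. The coordinate frame, scaled to unit length, gives one value;
  a positive orthonormal frame differs from it by a rotation, so there is no other value.\<close>

theorem has_gauss_curvature_iff:
  assumes z: "z \<in> U"
  shows "has_gauss_curvature h z k \<longleftrightarrow> k = - laplacian (\<lambda>z. ln (\<rho> z)) z / (2 * \<rho> z)"
proof -
  let ?u = "\<lambda>z. ln (\<rho> z)" and ?\<omega> = "connection_form h (levi_civita h) (\<lambda>y. y)"
  have su: "smooth_on U ?u" by (rule smooth_on_ln[OF open_U smooth_\<rho> pos_\<rho>])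
  have ext: "ext_deriv (?\<omega> frame1 frame2) z v w = laplacian ?u z / 2 * (Re v * Im w - Im v * Re w)" for v w
    using ext_deriv_conjugate_differential[OF open_U z su, of "?\<omega> frame1 frame2" "- 1/2"]
      connection_form_frame by simp
  show ?thesis
  proof
    assume "has_gauss_curvature h z k"
    then obtain W E1 E2 where W: "open W" "z \<in> W" and E: "smooth_on W E1" "smooth_on W E2"
      and on: "\<And>y. y \<in> W \<Longrightarrow> orthonormal_pair (h y) (E1 y) (E2 y) \<and> positive_basis2 (E1 y) (E2 y)"
      and k: "\<And>v w. ext_deriv (?\<omega> E1 E2) z v w = - k * area_form h z v w"
      unfolding has_gauss_curvature_def by blast
    define W' where "W' = W \<inter> U"
    have W': "open W'" "z \<in> W'" "W' \<subseteq> U" "W' \<subseteq> W" using W z open_U by (auto simp: W'_def)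
    have sm: "smooth_on W' frame1" "smooth_on W' frame2" "smooth_on W' E1" "smooth_on W' E2"
      using smooth_frame E W' by (auto intro: smooth_on_subset)
    define c where "c y = h y (E1 y) (frame1 y)" for y
    define s where "s y = h y (E1 y) (frame2 y)" for y
    have c: "c y = \<rho> y * \<rho> y powr (- 1/2) * Re (E1 y)" "s y = \<rho> y * \<rho> y powr (- 1/2) * Im (E1 y)"
      if "y \<in> W'" for y
      using that W' by (auto simp: c_def s_def frame1_def frame2_def h_eq inner_complex_def)
    have sid: "smooth_on W' (\<lambda>y. y)"
    proof -
      have "C_k_on k W' (\<lambda>y. y)" for k
        by (cases k) (auto simp: C_k_on_const)
      then show ?thesis by (simp add: smooth_on_def)
    qed
    have sub: "(\<lambda>y. y) ` W' \<subseteq> U" using W' by auto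
    have ext': "ext_deriv (?\<omega> E1 E2) z 1 \<i> = ext_deriv (?\<omega> frame1 frame2) z 1 \<i>"
    proof (rule ext_deriv_connection_form_rotate[where F = "\<lambda>y. y" and c = c and s = s, OF W'(1,2) sub sid sm(1,2)])
      show "smooth_on W' c" "smooth_on W' s"
        unfolding c_def s_def
        by (rule smooth_on_pairing[where F = "\<lambda>y. y", OF W'(1) sub sid sm(3) sm(1)],
            rule smooth_on_pairing[where F = "\<lambda>y. y", OF W'(1) sub sid sm(3) sm(2)])
      show "orthonormal_pair (h y) (frame1 y) (frame2 y)" if "y \<in> W'" for y
        using that W' by (auto intro: orthonormal_frame)
      fix y assume y: "y \<in> W'"
      then have yU: "y \<in> U" using W' by auto
      define l where "l = \<rho> y powr (- 1/2)"
      have l: "\<rho> y * l * x * l = x" for x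
      proof -
        have "\<rho> y * l * x * l = (l * l) * \<rho> y * x" by (simp only: ac_simps)
        then show ?thesis
          unfolding l_def powr_minus_half_mult[OF pos_\<rho>[OF yU]] using pos_\<rho>[OF yU] by simp
      qed
      have cl: "c y = \<rho> y * l * Re (E1 y)" "s y = \<rho> y * l * Im (E1 y)"
          "frame1 y = l *\<^sub>R 1" "frame2 y = l *\<^sub>R \<i>"
        using c[OF y] by (simp_all add: l_def frame1_def frame2_def)
      have E2: "E2 y = \<i> * E1 y"
        using orthonormal_positive_basis_rotation[OF yU] on y W' by blast
      show "E1 y = c y *\<^sub>R frame1 y + s y *\<^sub>R frame2 y"
        unfolding cl by (rule complex_eqI) (simp_all add: l)
      show "E2 y = - s y *\<^sub>R frame1 y + c y *\<^sub>R frame2 y"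
        unfolding cl E2 by (rule complex_eqI) (simp_all add: l)
      have "h y (E1 y) (E1 y) = 1" using on y W' by (auto simp: orthonormal_pair_def)
      then have "\<rho> y * ((Re (E1 y))\<^sup>2 + (Im (E1 y))\<^sup>2) = 1"
        by (simp add: h_eq[OF yU] inner_complex_def power2_eq_square)
      moreover have "(c y)\<^sup>2 + (s y)\<^sup>2 = (\<rho> y * l * 1 * l) * (\<rho> y * ((Re (E1 y))\<^sup>2 + (Im (E1 y))\<^sup>2))"
        unfolding cl by algebra
      ultimately show "(c y)\<^sup>2 + (s y)\<^sup>2 = 1"
        using l[of 1] by simp
    next
      show "bilinear (levi_civita h p)" "metric_parallel h p (levi_civita h p)" if "p \<in> U" for p
        using levi_civita(1,2)[OF that] .
      show "(\<lambda>y. ?\<omega> frame1 frame2 y v) differentiable at z" for v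
      proof -
        have "(\<lambda>y. (- 1/2) * fderiv ?u y (\<i> * v)) differentiable at z"
          by (intro differentiable_mult differentiable_const
              smooth_on_differentiable[OF smooth_on_fderiv[OF su] open_U z])
        then show ?thesis
          by (rule differentiable_cong_open[OF open_U z, rotated]) (simp add: connection_form_frame)
      qed
    qed
    then show "k = - laplacian ?u z / (2 * \<rho> z)"
      using k[of 1 \<i>] ext[of 1 \<i>] pos_\<rho>[OF z] by (simp add: area_form_conformal[OF z] field_simps)
  next
    assume k: "k = - laplacian ?u z / (2 * \<rho> z)"
    show "has_gauss_curvature h z k"
      unfolding has_gauss_curvature_def
    proof (intro exI conjI ballI allI)
      show "open U" "z \<in> U" "smooth_on U frame1" "smooth_on U frame2"
        by (fact open_U z smooth_frame)+
      show "orthonormal_pair (h y) (frame1 y) (frame2 y)" "positive_basis2 (frame1 y) (frame2 y)"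
        if "y \<in> U" for y
        using orthonormal_frame[OF that] pos_\<rho>[OF that]
        by (auto simp: positive_basis2_def frame1_def frame2_def)
      show "ext_deriv (?\<omega> frame1 frame2) z v w = - k * area_form h z v w" for v w
        using pos_\<rho>[OF z] by (simp add: ext k area_form_conformal[OF z])
    qed
  qed
qed

end

section \<open>Conformal and Chern minimal patches\<close>

locale conformal_patch = hermitian_patch V G for V :: "(complex ^ 2) set" and G +
  fixes U :: "complex set" and F :: "complex \<Rightarrow> complex ^ 2"
  assumes open_U: "open U" and F_U: "F ` U \<subseteq> V" and smooth_F: "smooth_on U F"
    and conformal: "\<And>z. z \<in> U \<Longrightarrow> \<exists>r>0. \<forall>v w. pullback_metric G F z v w = r * (v \<bullet> w)"
begin

abbreviation Fx :: "complex \<Rightarrow> complex ^ 2" where "Fx z \<equiv> fderiv F z 1"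
abbreviation Fy :: "complex \<Rightarrow> complex ^ 2" where "Fy z \<equiv> fderiv F z \<i>"

text \<open>The conformal factor of the induced metric.\<close>

definition conf :: "complex \<Rightarrow> real" where "conf z = G (F z) (Fx z) (Fx z)"

text \<open>The vectors \<open>F10\<close> and \<open>F01\<close> are the \<open>z\<close>- and the conjugate \<open>z\<close>-derivative of \<open>F\<close>, computed with \<open>J\<close> on the
  target; \<open>e10\<close> and \<open>e01\<close> are the corresponding energy densities.\<close>

definition F10 :: "complex \<Rightarrow> complex ^ 2" where "F10 z = (1/2) *\<^sub>R (Fx z - J (Fy z))"
definition F01 :: "complex \<Rightarrow> complex ^ 2" where "F01 z = (1/2) *\<^sub>R (Fx z + J (Fy z))"
definition e10 :: "complex \<Rightarrow> real" where "e10 z = G (F z) (F10 z) (F10 z)"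
definition e01 :: "complex \<Rightarrow> real" where "e01 z = G (F z) (F01 z) (F01 z)"

lemma F_in_V: "z \<in> U \<Longrightarrow> F z \<in> V"
  using F_U by auto

lemma differentiable_F: "z \<in> U \<Longrightarrow> F differentiable at z"
  by (rule smooth_on_differentiable[OF smooth_F open_U])

lemma pullback_metric_eq: "z \<in> U \<Longrightarrow> pullback_metric G F z v w = conf z * (v \<bullet> w)"
  and conf_pos: "z \<in> U \<Longrightarrow> conf z > 0"
proof -
  assume z: "z \<in> U"
  then obtain r where r: "r > 0" "\<And>v w. pullback_metric G F z v w = r * (v \<bullet> w)"
    using conformal by blast
  have "conf z = r" using r(2)[of 1 1] by (simp add: pullback_metric_def conf_def inner_complex_def)
  then show "pullback_metric G F z v w = conf z * (v \<bullet> w)" "conf z > 0" using r by auto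
qed

lemma Fx_Fy: "z \<in> U \<Longrightarrow> G (F z) (Fx z) (Fx z) = conf z"
  "z \<in> U \<Longrightarrow> G (F z) (Fy z) (Fy z) = conf z"
  "z \<in> U \<Longrightarrow> G (F z) (Fx z) (Fy z) = 0"
  using pullback_metric_eq[of z 1 1] pullback_metric_eq[of z \<i> \<i>] pullback_metric_eq[of z 1 \<i>]
  by (simp_all add: pullback_metric_def inner_complex_def)

lemma Fx_eq: "Fx z = F10 z + F01 z"
proof -
  have "F10 z + F01 z = (1/2) *\<^sub>R (Fx z + Fx z)" by (simp add: F10_def F01_def algebra_simps)
  then show ?thesis by (simp flip: scaleR_2)
qed

lemma Fy_eq: "Fy z = J (F10 z - F01 z)"
proof -
  have "F10 z - F01 z = (1/2) *\<^sub>R (- (J (Fy z) + J (Fy z)))" by (simp add: F10_def F01_def algebra_simps)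
  then show ?thesis by (simp add: J_simps flip: scaleR_2)
qed

lemma fderiv_F: "z \<in> U \<Longrightarrow> fderiv F z v = Re v *\<^sub>R Fx z + Im v *\<^sub>R Fy z"
  by (rule fderiv_expansion[OF differentiable_F])

text \<open>Orthogonality for \<open>G\<close> and for \<open>G\<close> composed with \<open>J\<close> together are Hermitian orthogonality, which is
  what conformality of \<open>F\<close> means for its two components.\<close>

lemma F10_F01_orthogonal:
  assumes z: "z \<in> U"
  shows "G (F z) (F10 z) (F01 z) = 0" "G (F z) (F10 z) (J (F01 z)) = 0"
proof -
  note p = F_in_V[OF z]
  note l = bilinear_simps[OF bilinear_G[OF p]]
  show "G (F z) (F10 z) (F01 z) = 0"
    using Fx_Fy[OF z] sym_G[OF p, of "Fx z" "J (Fy z)"]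
    by (simp add: F10_def F01_def l G_J_J[OF p] field_simps)
  show "G (F z) (F10 z) (J (F01 z)) = 0"
    using Fx_Fy[OF z] sym_G[OF p, of "Fx z" "Fy z"] G_J_left[OF p, of "Fy z" "Fy z"]
      G_self_J[OF p, of "Fx z"] G_self_J[OF p, of "Fy z"]
    by (simp add: F10_def F01_def l J_simps G_J_J[OF p])
qed

lemma conf_eq: "z \<in> U \<Longrightarrow> conf z = e10 z + e01 z"
  using F10_F01_orthogonal[of z] sym_G[OF F_in_V, of z "F01 z" "F10 z"]
  by (simp add: conf_def Fx_eq e10_def e01_def bilinear_simps[OF bilinear_G[OF F_in_V]])

lemma e_nonneg: "z \<in> U \<Longrightarrow> e10 z \<ge> 0" "z \<in> U \<Longrightarrow> e01 z \<ge> 0"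
  using pos_G[OF F_in_V, of z "F10 z"] pos_G[OF F_in_V, of z "F01 z"]
    bilinear_lzero[OF bilinear_G[OF F_in_V], of z] unfolding e10_def e01_def
  by (cases "F10 z = 0"; cases "F01 z = 0"; force)+

lemma e_eq_0_iff: "z \<in> U \<Longrightarrow> e10 z = 0 \<longleftrightarrow> F10 z = 0" "z \<in> U \<Longrightarrow> e01 z = 0 \<longleftrightarrow> F01 z = 0"
  using pos_G[OF F_in_V, of z "F10 z"] pos_G[OF F_in_V, of z "F01 z"]
    bilinear_lzero[OF bilinear_G[OF F_in_V], of z] unfolding e10_def e01_def
  by (auto simp: less_le)

lemma smooth_Fx_Fy: "smooth_on U (\<lambda>z. fderiv F z v)"
  by (rule smooth_on_fderiv[OF smooth_F])

lemma smooth_J: "smooth_on U Y \<Longrightarrow> smooth_on U (\<lambda>z. J (Y z))"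
  by (rule smooth_on_bounded_linear[OF open_U bounded_linear_J])

lemma smooth_F10: "smooth_on U F10"
  unfolding F10_def
  by (intro smooth_on_scaleR[OF open_U] smooth_on_diff[OF open_U] smooth_on_const smooth_J smooth_Fx_Fy)

lemma smooth_F01: "smooth_on U F01"
  unfolding F01_def
  by (intro smooth_on_scaleR[OF open_U] smooth_on_add[OF open_U] smooth_on_const smooth_J smooth_Fx_Fy)

lemma smooth_e10: "smooth_on U e10" and smooth_e01: "smooth_on U e01" and smooth_conf: "smooth_on U conf"
  unfolding e10_def e01_def conf_def
  by (rule smooth_on_pairing[OF open_U F_U smooth_F] smooth_F10 smooth_F01 smooth_Fx_Fy)+

lemma differentiable_U: "smooth_on U f \<Longrightarrow> z \<in> U \<Longrightarrow> f differentiable at z"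
  by (rule smooth_on_differentiable[OF _ open_U])

sublocale induced: conformal_metric U "pullback_metric G F" conf
  by unfold_locales (auto simp: open_U smooth_conf conf_pos pullback_metric_eq)

abbreviation cov :: "(complex \<Rightarrow> complex ^ 2) \<Rightarrow> complex \<Rightarrow> complex \<Rightarrow> complex ^ 2" where
  "cov \<equiv> cov_along \<Gamma>C F"
abbreviation cov_lc :: "(complex \<Rightarrow> complex ^ 2) \<Rightarrow> complex \<Rightarrow> complex \<Rightarrow> complex ^ 2" where
  "cov_lc \<equiv> cov_along (levi_civita G) F"
abbreviation tor :: "complex \<Rightarrow> complex ^ 2 \<Rightarrow> complex ^ 2 \<Rightarrow> complex ^ 2" where
  "tor z \<equiv> torsion (\<Gamma>C (F z))"

lemma tor:
  assumes z: "z \<in> U"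
  shows "bilinear (tor z)" "tor z u v = - tor z v u" "tor z u (J v) = J (tor z u v)"
    "tor z (J u) v = J (tor z u v)"
proof -
  note l = bilinear_simps[OF chern_connection(1)[OF F_in_V[OF z]]]
  show "bilinear (tor z)"
    unfolding bilinear_def by (auto intro!: linearI simp: torsion_def l algebra_simps)
  show "tor z u v = - tor z v u" by (simp add: torsion_def)
  show "tor z u (J v) = J (tor z u v)" "tor z (J u) v = J (tor z u v)"
    using chern_connection(2,3)[OF F_in_V[OF z]] by (simp_all add: torsion_def J_diff)
qed

lemma cov_J:
  assumes z: "z \<in> U" and Y: "Y differentiable at z"
  shows "cov (\<lambda>z. J (Y z)) z v = J (cov Y z v)"
  unfolding cov_along_def fderiv_bounded_linear[OF bounded_linear_J Y]
  by (simp add: chern_connection(2)[OF F_in_V[OF z]] J_add)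

lemma cov_combination:
  assumes z: "z \<in> U" and Y: "smooth_on U Y" "smooth_on U Z" and c: "smooth_on U c" "smooth_on U s"
    and X: "\<And>y. X y = c y *\<^sub>R Y y + s y *\<^sub>R Z y"
  shows "cov X z v = c z *\<^sub>R cov Y z v + s z *\<^sub>R cov Z z v + fderiv c z v *\<^sub>R Y z + fderiv s z v *\<^sub>R Z z"
  by (rule cov_along_smooth_combination[where F = F and \<Gamma> = \<Gamma>C and n = X and e = Y and e' = Z and c = c and s = s,
        OF open_U z chern_connection(1)[OF F_in_V[OF z]] X]) (auto intro: differentiable_U Y c z)

lemma cov_F10:
  assumes z: "z \<in> U"
  shows "cov F10 z v = (1/2) *\<^sub>R (cov Fx z v - J (cov Fy z v))"
    "cov F01 z v = (1/2) *\<^sub>R (cov Fx z v + J (cov Fy z v))"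
proof -
  have "cov F10 z v = (1/2) *\<^sub>R cov Fx z v + (- 1/2) *\<^sub>R cov (\<lambda>z. J (Fy z)) z v"
    using cov_combination[where X = F10 and Y = Fx and Z = "\<lambda>z. J (Fy z)" and c = "\<lambda>_. 1/2" and s = "\<lambda>_. - 1/2" and v = v,
      OF z smooth_Fx_Fy smooth_J[OF smooth_Fx_Fy] smooth_on_const smooth_on_const]
    by (simp add: F10_def algebra_simps)
  then show "cov F10 z v = (1/2) *\<^sub>R (cov Fx z v - J (cov Fy z v))"
    by (simp add: cov_J[OF z differentiable_U[OF smooth_Fx_Fy z]] algebra_simps)
  have "cov F01 z v = (1/2) *\<^sub>R cov Fx z v + (1/2) *\<^sub>R cov (\<lambda>z. J (Fy z)) z v"
    using cov_combination[where X = F01 and Y = Fx and Z = "\<lambda>z. J (Fy z)" and c = "\<lambda>_. 1/2" and s = "\<lambda>_. 1/2" and v = v,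
      OF z smooth_Fx_Fy smooth_J[OF smooth_Fx_Fy] smooth_on_const smooth_on_const]
    by (simp add: F01_def algebra_simps)
  then show "cov F01 z v = (1/2) *\<^sub>R (cov Fx z v + J (cov Fy z v))"
    by (simp add: cov_J[OF z differentiable_U[OF smooth_Fx_Fy z]] algebra_simps)
qed

lemma fderiv_G:
  assumes z: "z \<in> U" and Y: "smooth_on U Y" and Z: "smooth_on U Z"
  shows "fderiv (\<lambda>z. G (F z) (Y z) (Z z)) z v = G (F z) (cov Y z v) (Z z) + G (F z) (Y z) (cov Z z v)"
    "fderiv (\<lambda>z. G (F z) (Y z) (Z z)) z v = G (F z) (cov_lc Y z v) (Z z) + G (F z) (Y z) (cov_lc Z z v)"
  by (rule fderiv_pairing_cov[OF open_U z F_U differentiable_F[OF z] differentiable_U[OF Y z] differentiable_U[OF Z z]]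
      chern_connection(4) levi_civita(2) F_in_V z)+

lemma fderiv_eq_0:
  fixes f :: "complex \<Rightarrow> real"
  assumes "z \<in> U" "\<And>y. y \<in> U \<Longrightarrow> f y = 0"
  shows "fderiv f z v = 0"
  using fderiv_cong_open[OF open_U assms(1), of f "\<lambda>_. 0"] assms(2) by simp

lemma fderiv_e10:
  assumes z: "z \<in> U"
  shows "fderiv e10 z v = 2 * G (F z) (cov F10 z v) (F10 z)"
    "fderiv e01 z v = 2 * G (F z) (cov F01 z v) (F01 z)"
  using fderiv_G(1)[OF z smooth_F10 smooth_F10, of v] fderiv_G(1)[OF z smooth_F01 smooth_F01, of v]
    sym_G[OF F_in_V[OF z], of "F10 z"] sym_G[OF F_in_V[OF z], of "F01 z"]
  by (simp_all flip: e10_def e01_def)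

lemma cov_orthogonal:
  assumes z: "z \<in> U"
  shows "G (F z) (cov F10 z v) (F01 z) + G (F z) (F10 z) (cov F01 z v) = 0"
    "G (F z) (cov F10 z v) (J (F01 z)) + G (F z) (F10 z) (J (cov F01 z v)) = 0"
  using fderiv_G(1)[OF z smooth_F10 smooth_F01, of v] fderiv_G(1)[OF z smooth_F10 smooth_J[OF smooth_F01], of v]
    fderiv_eq_0[where v = v, OF z F10_F01_orthogonal(1)] fderiv_eq_0[where v = v, OF z F10_F01_orthogonal(2)]
  by (simp_all add: cov_J[OF z differentiable_U[OF smooth_F01 z]])

lemma cov_Fx_Fy_torsion:
  assumes z: "z \<in> U" shows "cov Fy z 1 - cov Fx z \<i> = tor z (Fx z) (Fy z)"
  using second_fderiv_commute[OF open_U smooth_F z, of \<i> 1] by (simp add: cov_along_def torsion_def)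

lemma G_cov_lc:
  assumes z: "z \<in> U"
  shows "G (F z) (cov_lc Y z v) Z = G (F z) (cov Y z v) Z -
    (G (F z) (tor z (fderiv F z v) (Y z)) Z - G (F z) (tor z (Y z) Z) (fderiv F z v)
      + G (F z) (tor z Z (fderiv F z v)) (Y z)) / 2"
  unfolding cov_along_def bilinear_ladd[OF bilinear_G[OF F_in_V[OF z]]] levi_civita_vs_chern[OF F_in_V[OF z]]
  by simp

text \<open>Two orthogonal normal fields of equal length, polynomial in the data. Both vanish where one of the
  components vanishes, and both have length \<open>sqrt (e10 * e01 * conf)\<close>.\<close>

definition N1 :: "complex \<Rightarrow> complex ^ 2" where "N1 z = e01 z *\<^sub>R F10 z - e10 z *\<^sub>R F01 z"
definition N2 :: "complex \<Rightarrow> complex ^ 2" where "N2 z = - J (e01 z *\<^sub>R F10 z + e10 z *\<^sub>R F01 z)"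

lemma smooth_N: "smooth_on U N1" "smooth_on U N2"
  unfolding N1_def N2_def
  by (intro smooth_on_diff[OF open_U] smooth_on_minus[OF open_U] smooth_J smooth_on_add[OF open_U]
      smooth_on_scaleR[OF open_U] smooth_F10 smooth_F01 smooth_e10 smooth_e01)+

lemma N_products:
  assumes z: "z \<in> U"
  shows "G (F z) (N1 z) (N1 z) = e10 z * e01 z * conf z" "G (F z) (N2 z) (N2 z) = e10 z * e01 z * conf z"
    "G (F z) (N1 z) (N2 z) = 0"
    "G (F z) (N1 z) (fderiv F z v) = 0" "G (F z) (N2 z) (fderiv F z v) = 0"
proof -
  note p = F_in_V[OF z]
  note l = bilinear_simps[OF bilinear_G[OF p]]
  have o: "G (F z) (F10 z) (F01 z) = 0" "G (F z) (F01 z) (F10 z) = 0"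
      "G (F z) (F10 z) (J (F01 z)) = 0" "G (F z) (F01 z) (J (F10 z)) = 0"
    using F10_F01_orthogonal[OF z] sym_G[OF p, of "F10 z" "F01 z"] G_J_left[OF p, of "F10 z" "F01 z"]
      sym_G[OF p, of "F01 z" "J (F10 z)"] by simp_all
  note s = l J_simps o e10_def[symmetric] e01_def[symmetric] G_J_J[OF p] G_J_left[OF p] G_self_J[OF p]
  show "G (F z) (N1 z) (N1 z) = e10 z * e01 z * conf z" "G (F z) (N2 z) (N2 z) = e10 z * e01 z * conf z"
      "G (F z) (N1 z) (N2 z) = 0"
    by (simp_all add: conf_eq[OF z] N1_def N2_def s algebra_simps)
  have "G (F z) (N1 z) (Fx z) = 0" "G (F z) (N1 z) (Fy z) = 0" "G (F z) (N2 z) (Fx z) = 0" "G (F z) (N2 z) (Fy z) = 0"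
    by (simp_all add: Fx_eq Fy_eq N1_def N2_def s algebra_simps)
  then show "G (F z) (N1 z) (fderiv F z v) = 0" "G (F z) (N2 z) (fderiv F z v) = 0"
    unfolding fderiv_F[OF z, of v] by (simp_all add: l)
qed

end

locale chern_patch = conformal_patch +
  assumes minimal: "\<And>z e e'. z \<in> U \<Longrightarrow> orthonormal_pair (pullback_metric G F z) e e' \<Longrightarrow>
    nabla_df G (chern_connection G) F z e e + nabla_df G (chern_connection G) F z e' e' = 0"
begin

lemma nabla_df_scale:
  assumes z: "z \<in> U"
  shows "nabla_df G \<Gamma>C F z (c *\<^sub>R v) (c *\<^sub>R v) = (c * c) *\<^sub>R nabla_df G \<Gamma>C F z v v"
proof -
  note p = F_in_V[OF z]
  have 1: "fderiv F y (c *\<^sub>R v) = c *\<^sub>R fderiv F y v" if "y \<in> U" for y v c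
    by (rule linear_scale[OF linear_fderiv[OF differentiable_F[OF that]]])
  have "fderiv (\<lambda>y. fderiv F y (c *\<^sub>R v)) z w = fderiv (\<lambda>y. c *\<^sub>R fderiv F y v) z w" for w
    by (rule fun_cong[OF fderiv_cong_open[OF open_U z]]) (rule 1)
  also have "fderiv (\<lambda>y. c *\<^sub>R fderiv F y v) z w = c *\<^sub>R fderiv (\<lambda>y. fderiv F y v) z w" for w
    by (simp add: fderiv_scaleR differentiable_U[OF smooth_Fx_Fy z])
  finally have 2: "fderiv (\<lambda>y. fderiv F y (c *\<^sub>R v)) z w = c *\<^sub>R fderiv (\<lambda>y. fderiv F y v) z w" for w .
  have 3: "fderiv (\<lambda>y. fderiv F y v) z (c *\<^sub>R v) = c *\<^sub>R fderiv (\<lambda>y. fderiv F y v) z v"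
    by (rule linear_scale[OF linear_fderiv[OF differentiable_U[OF smooth_Fx_Fy z]]])
  show ?thesis
    unfolding nabla_df_def cov_along_def 2 3 1[OF z]
    by (simp add: bilinear_simps[OF induced.levi_civita(1)[OF z]] bilinear_simps[OF chern_connection(1)[OF p]]
        1[OF z] algebra_simps)
qed

text \<open>In a conformal chart the Christoffel terms of the induced metric drop out of the trace, by
  \<open>levi_civita_trace\<close>.\<close>

lemma tension_field_zero:
  assumes z: "z \<in> U" shows "cov Fx z 1 + cov Fy z \<i> = 0"
proof -
  let ?c = "conf z powr (- 1/2)"
  have "nabla_df G \<Gamma>C F z (?c *\<^sub>R 1) (?c *\<^sub>R 1) + nabla_df G \<Gamma>C F z (?c *\<^sub>R \<i>) (?c *\<^sub>R \<i>) = 0"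
    using minimal[OF z induced.orthonormal_frame[OF z]]
    unfolding induced.frame1_def induced.frame2_def .
  then have "(?c * ?c) *\<^sub>R (nabla_df G \<Gamma>C F z 1 1 + nabla_df G \<Gamma>C F z \<i> \<i>) = 0"
    unfolding nabla_df_scale[OF z] scaleR_right_distrib .
  then have "nabla_df G \<Gamma>C F z 1 1 + nabla_df G \<Gamma>C F z \<i> \<i> = 0"
    using conf_pos[OF z] by simp
  moreover have "fderiv F z (levi_civita (pullback_metric G F) z 1 1) + fderiv F z (levi_civita (pullback_metric G F) z \<i> \<i>) = 0"
    unfolding linear_add[OF linear_fderiv[OF differentiable_F[OF z]], symmetric] induced.levi_civita_trace[OF z]
    by (rule linear_0[OF linear_fderiv[OF differentiable_F[OF z]]])
  ultimately show ?thesis by (simp add: nabla_df_def algebra_simps)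
qed

text \<open>Chern minimality as a first order system. The trace condition and the torsion of the mixed second
  derivatives are the real and the imaginary part of an equation for \<open>F10\<close>, and of one for \<open>F01\<close>.\<close>

lemma cauchy_riemann:
  assumes z: "z \<in> U"
  shows "cov F10 z 1 + J (cov F10 z \<i>) = - tor z (F10 z) (F01 z)"
    "cov F01 z 1 - J (cov F01 z \<i>) = tor z (F10 z) (F01 z)"
proof -
  have uu: "tor z u u = 0" for u
  proof -
    have "2 *\<^sub>R tor z u u = 0" using tor(2)[OF z, of u u] unfolding scaleR_2 by (metis add.right_inverse)
    then show ?thesis by simp
  qed
  have yy: "cov Fy z \<i> = - cov Fx z 1" using tension_field_zero[OF z] by (simp add: eq_neg_iff_add_eq_0 add.commute)
  have "tor z (Fx z) (Fy z) = J (tor z (F10 z + F01 z) (F10 z - F01 z))"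
    by (simp only: Fx_eq Fy_eq tor(3)[OF z])
  also have "tor z (F10 z + F01 z) (F10 z - F01 z) = - tor z (F10 z) (F01 z) - tor z (F10 z) (F01 z)"
    using tor(2)[OF z, of "F01 z" "F10 z"] uu by (simp add: bilinear_simps[OF tor(1)[OF z]])
  also have "\<dots> = (- 1 + - 1) *\<^sub>R tor z (F10 z) (F01 z)"
    by (simp only: scaleR_left_distrib scaleR_minus_left scaleR_one diff_conv_add_uminus)
  also have "J \<dots> = - 2 *\<^sub>R J (tor z (F10 z) (F01 z))" by (simp add: J_scaleR)
  finally have "cov Fy z 1 - cov Fx z \<i> = - 2 *\<^sub>R J (tor z (F10 z) (F01 z))"
    using cov_Fx_Fy_torsion[OF z] by simp
  then have xy: "cov Fy z 1 = cov Fx z \<i> - 2 *\<^sub>R J (tor z (F10 z) (F01 z))" by (simp add: algebra_simps)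
  show "cov F10 z 1 + J (cov F10 z \<i>) = - tor z (F10 z) (F01 z)"
    "cov F01 z 1 - J (cov F01 z \<i>) = tor z (F10 z) (F01 z)"
    unfolding cov_F10[OF z] yy xy by (simp_all add: J_simps algebra_simps)
qed

lemma connection_form_N_1:
  assumes z: "z \<in> U"
  shows "G (F z) (cov_lc N1 z 1) (N2 z) =
    (e01 z)\<^sup>2 * G (F z) (cov F10 z \<i>) (F10 z) + (e10 z)\<^sup>2 * G (F z) (cov F01 z \<i>) (F01 z)"
proof -
  note p = F_in_V[OF z]
  note l = bilinear_simps[OF bilinear_G[OF p]]
  have "cov N1 z 1 = e01 z *\<^sub>R cov F10 z 1 + (- e10 z) *\<^sub>R cov F01 z 1
      + fderiv e01 z 1 *\<^sub>R F10 z + fderiv (\<lambda>z. - e10 z) z 1 *\<^sub>R F01 z"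
    by (rule cov_combination[OF z smooth_F10 smooth_F01 smooth_e01 smooth_on_minus[OF open_U smooth_e10]])
      (simp add: N1_def)
  moreover have "G (F z) (F10 z) (N2 z) = 0" "G (F z) (F01 z) (N2 z) = 0"
    using F10_F01_orthogonal[OF z] sym_G[OF p, of "F01 z" "J (F10 z)"] G_J_left[OF p, of "F10 z" "F01 z"]
    by (simp_all add: N2_def l J_simps G_self_J[OF p])
  ultimately have "G (F z) (cov N1 z 1) (N2 z) = G (F z) (e01 z *\<^sub>R cov F10 z 1 - e10 z *\<^sub>R cov F01 z 1) (N2 z)"
    by (simp add: l)
  then show ?thesis
    unfolding G_cov_lc[OF z, of N1]
    using normal_connection_algebra[OF bilinear_G[OF p] sym_G[OF p] G_J_J[OF p] tor(1-3)[OF z]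
        cauchy_riemann[OF z] cov_orthogonal[OF z] e10_def e01_def N1_def N2_def]
    by (simp add: Fx_eq)
qed

text \<open>The previous computation in the chart rotated by a right angle. This replaces \<open>F10\<close> by \<open>J F10\<close> and
  \<open>F01\<close> by \<open>- J F01\<close>, and the pair \<open>(N1, N2)\<close> by \<open>(- N2, N1)\<close>.\<close>

lemma connection_form_N_i:
  assumes z: "z \<in> U"
  shows "G (F z) (cov_lc N1 z \<i>) (N2 z) =
    - ((e01 z)\<^sup>2 * G (F z) (cov F10 z 1) (F10 z) + (e10 z)\<^sup>2 * G (F z) (cov F01 z 1) (F01 z))"
proof -
  note p = F_in_V[OF z]
  note l = bilinear_simps[OF bilinear_G[OF p]]
  define a b where "a = J (F10 z)" and "b = - J (F01 z)"
  have cr: "cov F10 z 1 = - tor z (F10 z) (F01 z) - J (cov F10 z \<i>)"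
    "cov F01 z 1 = tor z (F10 z) (F01 z) + J (cov F01 z \<i>)"
    using cauchy_riemann[OF z] by (simp_all add: algebra_simps)
  have alg: "G (F z) (e01 z *\<^sub>R J (cov F10 z \<i>) - e10 z *\<^sub>R (- J (cov F01 z \<i>))) (N1 z)
    - (G (F z) (tor z (a + b) (- N2 z)) (N1 z) - G (F z) (tor z (- N2 z) (N1 z)) (a + b)
        + G (F z) (tor z (N1 z) (a + b)) (- N2 z)) / 2
    = (e01 z)\<^sup>2 * G (F z) (- J (cov F10 z 1)) a + (e10 z)\<^sup>2 * G (F z) (J (cov F01 z 1)) b"
  proof (rule normal_connection_algebra[OF bilinear_G[OF p] sym_G[OF p] G_J_J[OF p] tor(1-3)[OF z]])
    have t: "tor z a b = tor z (F10 z) (F01 z)"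
      by (simp add: a_def b_def bilinear_simps[OF tor(1)[OF z]] tor(3,4)[OF z] J_J)
    show "J (cov F10 z \<i>) + J (- J (cov F10 z 1)) = - tor z a b"
      "- J (cov F01 z \<i>) - J (J (cov F01 z 1)) = tor z a b"
      unfolding t cr by (simp_all add: J_simps)
    show "G (F z) (- J (cov F10 z 1)) b + G (F z) a (J (cov F01 z 1)) = 0"
      using cov_orthogonal(1)[OF z, of 1] by (simp add: a_def b_def l G_J_J[OF p])
    show "G (F z) (J (cov F10 z \<i>)) (J b) + G (F z) a (J (- J (cov F01 z \<i>))) = 0"
      using cov_orthogonal(2)[OF z, of \<i>]
      by (simp add: a_def b_def l J_simps G_J_left[OF p])
    show "e10 z = G (F z) a a" "e01 z = G (F z) b b"
      by (simp_all add: a_def b_def e10_def e01_def l G_J_J[OF p])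
    show "- N2 z = e01 z *\<^sub>R a - e10 z *\<^sub>R b" "N1 z = - J (e01 z *\<^sub>R a + e10 z *\<^sub>R b)"
      by (simp_all add: N1_def N2_def a_def b_def J_simps)
  qed
  let ?Y = "\<lambda>z. e01 z *\<^sub>R F10 z + e10 z *\<^sub>R F01 z"
  have sY: "smooth_on U ?Y"
    by (intro smooth_on_add[OF open_U] smooth_on_scaleR[OF open_U] smooth_F10 smooth_F01 smooth_e10 smooth_e01)
  have cY: "cov ?Y z \<i> = e01 z *\<^sub>R cov F10 z \<i> + e10 z *\<^sub>R cov F01 z \<i>
      + fderiv e01 z \<i> *\<^sub>R F10 z + fderiv e10 z \<i> *\<^sub>R F01 z"
    by (rule cov_combination[OF z smooth_F10 smooth_F01 smooth_e01 smooth_e10]) simp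
  have "cov N2 z \<i> = cov (\<lambda>z. J (- ?Y z)) z \<i>" by (simp add: N2_def[abs_def] J_minus)
  also have "\<dots> = J (cov (\<lambda>z. - ?Y z) z \<i>)"
    by (rule cov_J[OF z differentiable_U[OF smooth_on_minus[OF open_U sY] z]])
  also have "cov (\<lambda>z. - ?Y z) z \<i> = - cov ?Y z \<i>"
    using bilinear_rneg[OF chern_connection(1)[OF p], of "Fy z" "?Y z"]
    unfolding cov_along_def fderiv_minus[OF differentiable_U[OF sY z]] by simp
  finally have cN2: "cov N2 z \<i> = - J (cov ?Y z \<i>)" by (simp add: J_minus)
  have "G (F z) (J (F10 z)) (N1 z) = 0" "G (F z) (J (F01 z)) (N1 z) = 0"
    using F10_F01_orthogonal[OF z] sym_G[OF p, of "F01 z" "J (F10 z)"] G_J_left[OF p, of "F10 z" "F01 z"]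
    by (simp_all add: N1_def l J_simps G_self_J[OF p] G_J_left[OF p])
  then have cN: "G (F z) (cov N2 z \<i>) (N1 z) = - G (F z) (e01 z *\<^sub>R J (cov F10 z \<i>) - e10 z *\<^sub>R (- J (cov F01 z \<i>))) (N1 z)"
    unfolding cN2 cY by (simp add: l J_simps)
  have ab: "a + b = Fy z" "G (F z) (- J x) a = - G (F z) x (F10 z)"
      "G (F z) (J x) b = - G (F z) x (F01 z)" for x
    by (simp_all add: a_def b_def Fy_eq J_diff l G_J_J[OF p])
  have tn: "G (F z) (tor z (Fy z) (- N2 z)) (N1 z) = - G (F z) (tor z (Fy z) (N2 z)) (N1 z)"
      "G (F z) (tor z (- N2 z) (N1 z)) (Fy z) = - G (F z) (tor z (N2 z) (N1 z)) (Fy z)"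
      "G (F z) (tor z (N1 z) (Fy z)) (- N2 z) = - G (F z) (tor z (N1 z) (Fy z)) (N2 z)"
    by (simp_all add: l bilinear_simps[OF tor(1)[OF z]])
  have "G (F z) (cov_lc N2 z \<i>) (N1 z) =
    (e01 z)\<^sup>2 * G (F z) (cov F10 z 1) (F10 z) + (e10 z)\<^sup>2 * G (F z) (cov F01 z 1) (F01 z)"
    using alg cN unfolding G_cov_lc[OF z, of N2] ab tn by argo
  moreover have "G (F z) (cov_lc N1 z \<i>) (N2 z) + G (F z) (N1 z) (cov_lc N2 z \<i>) = 0"
    using fderiv_G(2)[OF z smooth_N, of \<i>] fderiv_eq_0[where f = "\<lambda>z. G (F z) (N1 z) (N2 z)" and v = \<i>, OF z N_products(3)] by simp
  ultimately show ?thesis using sym_G[OF p, of "N1 z" "cov_lc N2 z \<i>"] by simp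
qed

lemma connection_form_N:
  assumes z: "z \<in> U"
  shows "connection_form G (levi_civita G) F N1 N2 z v =
    ((e01 z)\<^sup>2 * fderiv e10 z (\<i> * v) + (e10 z)\<^sup>2 * fderiv e01 z (\<i> * v)) / 2"
proof -
  note p = F_in_V[OF z]
  note l = bilinear_simps[OF bilinear_G[OF p]]
  have "cov_lc N1 z v = Re v *\<^sub>R cov_lc N1 z 1 + Im v *\<^sub>R cov_lc N1 z \<i>"
    unfolding cov_along_def fderiv_F[OF z, of v] fderiv_expansion[OF differentiable_U[OF smooth_N(1) z], of v]
    by (simp add: bilinear_simps[OF levi_civita(1)[OF p]] algebra_simps)
  then have cf: "connection_form G (levi_civita G) F N1 N2 z v =
      Re v * G (F z) (cov_lc N1 z 1) (N2 z) + Im v * G (F z) (cov_lc N1 z \<i>) (N2 z)"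
    by (simp add: connection_form_def l)
  have d: "fderiv e10 z (\<i> * v) = Re v * fderiv e10 z \<i> - Im v * fderiv e10 z 1"
      "fderiv e01 z (\<i> * v) = Re v * fderiv e01 z \<i> - Im v * fderiv e01 z 1"
    using fderiv_expansion[OF differentiable_U[OF smooth_e10 z], of "\<i> * v"]
      fderiv_expansion[OF differentiable_U[OF smooth_e01 z], of "\<i> * v"] by simp_all
  show ?thesis
    unfolding cf d connection_form_N_1[OF z] connection_form_N_i[OF z] fderiv_e10[OF z, of 1] fderiv_e10[OF z, of \<i>]
    by (simp add: algebra_simps)
qed

end

section \<open>Orientation of the normal bundle\<close>

lemma vector_4:
  "(vector [x,y,z,w] ::('a::zero)^4)$1 = x"
  "(vector [x,y,z,w] ::('a::zero)^4)$2 = y"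
  "(vector [x,y,z,w] ::('a::zero)^4)$3 = z"
  "(vector [x,y,z,w] ::('a::zero)^4)$4 = w"
  unfolding vector_def by simp_all

text \<open>The matrix enters through a function \<open>m\<close> of its indices to keep the formula short.\<close>

lemma det_4:
  fixes A :: "'a::comm_ring_1 ^ 4 ^ 4"
  assumes m: "\<And>i j. m i j = A $ i $ j"
  shows "det A =
    m 1 1 * (m 2 2 * (m 3 3 * m 4 4 - m 3 4 * m 4 3) - m 2 3 * (m 3 2 * m 4 4 - m 3 4 * m 4 2)
      + m 2 4 * (m 3 2 * m 4 3 - m 3 3 * m 4 2))
    - m 1 2 * (m 2 1 * (m 3 3 * m 4 4 - m 3 4 * m 4 3) - m 2 3 * (m 3 1 * m 4 4 - m 3 4 * m 4 1)
      + m 2 4 * (m 3 1 * m 4 3 - m 3 3 * m 4 1))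
    + m 1 3 * (m 2 1 * (m 3 2 * m 4 4 - m 3 4 * m 4 2) - m 2 2 * (m 3 1 * m 4 4 - m 3 4 * m 4 1)
      + m 2 4 * (m 3 1 * m 4 2 - m 3 2 * m 4 1))
    - m 1 4 * (m 2 1 * (m 3 2 * m 4 3 - m 3 3 * m 4 2) - m 2 2 * (m 3 1 * m 4 3 - m 3 3 * m 4 1)
      + m 2 3 * (m 3 1 * m 4 2 - m 3 2 * m 4 1))"
proof -
  have f: "finite {2::4, 3, 4}" "1 \<notin> {2::4, 3, 4}" "finite {3::4, 4}" "2 \<notin> {3::4, 4}" "finite {4::4}" "3 \<notin> {4::4}"
    by auto
  have sums: "sum h {1::4, 2, 3, 4} = h 1 + (h 2 + (h 3 + h 4))" "sum h {2::4, 3, 4} = h 2 + (h 3 + h 4)"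
      "sum h {3::4, 4} = h 3 + h 4" "prod h (UNIV :: 4 set) = h 1 * (h 2 * (h 3 * h 4))" for h :: "_ \<Rightarrow> 'a"
    unfolding UNIV_4 sum.insert[OF f(1,2)] sum.insert[OF f(3,4)] sum.insert[OF f(5,6)]
      prod.insert[OF f(1,2)] prod.insert[OF f(3,4)] prod.insert[OF f(5,6)]
    by simp_all
  \<comment> \<open>The sums over permutations are expanded before any transposition is evaluated.\<close>
  have sgn: "sign (Transposition.transpose a b \<circ> q) = (if a = b then 1 else - 1) * sign q" if "permutation q"
    for a b :: 4 and q
    using that by (simp add: sign_compose permutation_swap_id sign_swap_id)
  have per: "permutation (Transposition.transpose a b \<circ> q)" if "permutation q" for a b :: 4 and q
    using that by (simp add: permutation_compose permutation_swap_id)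
  have sing: "sum h {p :: 4 \<Rightarrow> 4. p permutes {4}} = h id" for h :: "_ \<Rightarrow> 'a"
    by (simp only: permutes_sing) simp
  have neq: "(1::4) \<noteq> 2" "(1::4) \<noteq> 3" "(1::4) \<noteq> 4" "(2::4) \<noteq> 3" "(2::4) \<noteq> 4" "(3::4) \<noteq> 4"
    by simp_all
  note neq' = neq neq[symmetric]
  show ?thesis
    unfolding det_def sums(4) m[symmetric]
    unfolding UNIV_4 sum_over_permutations_insert[OF f(1,2)]
      sum_over_permutations_insert[OF f(3,4)] sum_over_permutations_insert[OF f(5,6)] sing
    unfolding sums(1-3)
    by (simp only: sgn per permutation_id sign_id o_apply id_apply)
      (simp only: Transposition.transpose_def neq' if_True if_False refl simp_thms, simp add: algebra_simps)
qed
definition det_real :: "complex ^ 2 \<Rightarrow> complex ^ 2 \<Rightarrow> complex ^ 2 \<Rightarrow> complex ^ 2 \<Rightarrow> real" where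
  "det_real u v w x = det (vector [real_coords u, real_coords v, real_coords w, real_coords x] :: real ^ 4 ^ 4)"

definition cdet :: "complex ^ 2 \<Rightarrow> complex ^ 2 \<Rightarrow> complex" where
  "cdet a b = a$1 * b$2 - a$2 * b$1"

lemma det_real_rotate:
  "det_real u v (c *\<^sub>R w + s *\<^sub>R x) (c' *\<^sub>R w + s' *\<^sub>R x) = (c * s' - s * c') * det_real u v w x"
  unfolding det_real_def det_4[OF refl] vector_4 real_coords_def
  by (simp add: algebra_simps)

text \<open>The sign of the frame of tangent and normal vectors in the orientation of \<open>complex ^ 2\<close>: with these
  choices of \<open>N1\<close> and \<open>N2\<close> it is positive.\<close>

lemma det_real_tangent_normal:
  "det_real (a + b) (J (a - b)) (B *\<^sub>R a - A *\<^sub>R b) (- J (B *\<^sub>R a + A *\<^sub>R b)) = (A + B)\<^sup>2 * (cmod (cdet a b))\<^sup>2"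
  unfolding det_real_def det_4[OF refl] vector_4 real_coords_def cdet_def cmod_power2
  by (simp add: power2_eq_square) (simp add: algebra_simps)

lemma complex_span:
  assumes "cdet a b \<noteq> 0"
  obtains l m where "Y = l *s a + m *s b"
proof
  show "Y = ((Y$1 * b$2 - Y$2 * b$1) / cdet a b) *s a + ((a$1 * Y$2 - a$2 * Y$1) / cdet a b) *s b"
    using assms by (simp add: vec_eq_iff forall_2 field_simps) (simp add: cdet_def algebra_simps)
qed

lemma complex_scale_real: "l *s a = Re l *\<^sub>R a + Im l *\<^sub>R J a"
  by (simp add: vec_eq_iff complex_eq_iff)

lemma cdet_eq_0_imp_multiple:
  assumes "cdet a b = 0" "a \<noteq> 0"
  obtains l where "b = l *s a"
proof (cases "a$1 = 0")
  case True
  then have "a$2 \<noteq> 0" using assms(2) by (simp add: vec_eq_iff forall_2)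
  then have "b = (b$2 / a$2) *s a" using assms(1) True by (simp add: vec_eq_iff forall_2 cdet_def)
  then show ?thesis by (rule that)
next
  case False
  then have "b = (b$1 / a$1) *s a" using assms(1) by (simp add: vec_eq_iff forall_2 cdet_def field_simps)
  then show ?thesis by (rule that)
qed

context hermitian_patch
begin

lemma G_complex_scale:
  "p \<in> V \<Longrightarrow> G p (l *s a) w = Re l * G p a w - Im l * G p a (J w)"
  unfolding complex_scale_real[of l a] by (simp add: bilinear_simps[OF bilinear_G] G_J_left)

lemma cdet_orthogonal_nonzero:
  assumes p: "p \<in> V" and "a \<noteq> 0" "b \<noteq> 0" "G p a b = 0" "G p a (J b) = 0"
  shows "cdet a b \<noteq> 0"
proof
  assume "cdet a b = 0"
  then obtain l where b: "b = l *s a" using cdet_eq_0_imp_multiple[OF _ assms(2)] by blast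
  have "G p b b = 0"
    using G_complex_scale[OF p, of l a b] assms(4,5) by (simp flip: b)
  then show False using pos_G[OF p assms(3)] by simp
qed

lemma orthogonal_complement_trivial:
  assumes p: "p \<in> V" and "cdet a b \<noteq> 0"
    and "G p Y a = 0" "G p Y (J a) = 0" "G p Y b = 0" "G p Y (J b) = 0"
  shows "Y = 0"
proof (rule ccontr)
  assume "Y \<noteq> 0"
  obtain l m where Y: "Y = l *s a + m *s b" using complex_span[OF assms(2)] .
  have "G p Y Y = 0"
    using assms(3-) unfolding Y[THEN arg_cong[where f = "G p Y"]] complex_scale_real[of l a] complex_scale_real[of m b]
    by (simp add: bilinear_simps[OF bilinear_G[OF p]])
  then show False using pos_G[OF p \<open>Y \<noteq> 0\<close>] by simp
qed

end

section \<open>The normal curvature at real points\<close>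

context conformal_patch
begin

text \<open>The real points of the patch.\<close>

definition R :: "complex set" where "R = {z\<in>U. 0 < e10 z \<and> 0 < e01 z}"
definition nscale :: "complex \<Rightarrow> real" where "nscale z = (e10 z * e01 z * conf z) powr (- 1/2)"
definition n1 :: "complex \<Rightarrow> complex ^ 2" where "n1 z = nscale z *\<^sub>R N1 z"
definition n2 :: "complex \<Rightarrow> complex ^ 2" where "n2 z = nscale z *\<^sub>R N2 z"

text \<open>The logarithm of \<open>q\<close> is twice the potential of the normal connection form.\<close>

definition q :: "complex \<Rightarrow> real" where "q z = e10 z * e01 z * conf z powr - 1"

lemma R_U: "z \<in> R \<Longrightarrow> z \<in> U" "R \<subseteq> U"
  by (auto simp: R_def)

lemma open_R: "open R"
proof -
  have "R = (U \<inter> e10 -` {0<..}) \<inter> (U \<inter> e01 -` {0<..})" by (auto simp: R_def)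
  moreover have "open (U \<inter> e10 -` {0<..})" "open (U \<inter> e01 -` {0<..})"
    by (intro continuous_open_preimage smooth_on_continuous_on open_U smooth_e10 smooth_e01 open_greaterThan)+
  ultimately show ?thesis using open_Int by metis
qed

lemma R_pos:
  assumes z: "z \<in> R"
  shows "e10 z > 0" "e01 z > 0" "conf z > 0" "e10 z * e01 z * conf z > 0" "q z > 0"
proof -
  show 1: "e10 z > 0" "e01 z > 0" using z by (simp_all add: R_def)
  show 2: "conf z > 0" using z by (simp add: R_def conf_pos)
  show "e10 z * e01 z * conf z > 0" "q z > 0"
    unfolding q_def using 1 2 by simp_all
qed

lemma smooth_on_R: "smooth_on U f \<Longrightarrow> smooth_on R f"
  by (rule smooth_on_subset[OF _ R_U(2)])

lemma smooth_nscale: "smooth_on R nscale"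
  unfolding nscale_def
  by (rule smooth_on_powr[OF open_R _ R_pos(4)])
    (intro smooth_on_mult[OF open_R] smooth_on_R smooth_e10 smooth_e01 smooth_conf)

lemma smooth_n: "smooth_on R n1" "smooth_on R n2"
  unfolding n1_def n2_def
  by (rule smooth_on_scaleR[OF open_R smooth_nscale smooth_on_R[OF smooth_N(1)]])
    (rule smooth_on_scaleR[OF open_R smooth_nscale smooth_on_R[OF smooth_N(2)]])

lemma smooth_q: "smooth_on R q"
  unfolding q_def
  by (intro smooth_on_mult[OF open_R] smooth_on_powr[OF open_R] smooth_on_R smooth_e10 smooth_e01 smooth_conf R_pos(3))

lemma nscale_square: "z \<in> R \<Longrightarrow> nscale z * nscale z * (e10 z * e01 z * conf z) = 1"
  using R_pos[of z] powr_minus_half_mult[of "e10 z * e01 z * conf z"] by (simp add: nscale_def)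

lemma nscale_pos: "z \<in> R \<Longrightarrow> nscale z > 0"
  using R_pos[of z] by (simp add: nscale_def)

lemma orthonormal_n: "z \<in> R \<Longrightarrow> orthonormal_pair (G (F z)) (n1 z) (n2 z)"
  using N_products(1-3)[OF R_U(1), of z] nscale_square[of z]
  by (simp add: orthonormal_pair_def n1_def n2_def bilinear_simps[OF bilinear_G[OF F_in_V[OF R_U(1)]]] mult.assoc)

lemma normal_n:
  "z \<in> R \<Longrightarrow> G (F z) (n1 z) (fderiv F z v) = 0" "z \<in> R \<Longrightarrow> G (F z) (n2 z) (fderiv F z v) = 0"
  using N_products(4,5)[OF R_U(1), of z]
  by (simp_all add: n1_def n2_def bilinear_simps[OF bilinear_G[OF F_in_V[OF R_U(1)]]])

lemma cdet_F10_F01: "z \<in> R \<Longrightarrow> cdet (F10 z) (F01 z) \<noteq> 0"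
  using R_pos(1,2)[of z] e_eq_0_iff[OF R_U(1), of z]
  by (intro cdet_orthogonal_nonzero[OF F_in_V[OF R_U(1)]]) (auto simp: F10_F01_orthogonal[OF R_U(1)])

lemma det_real_frame_pos:
  assumes z: "z \<in> R"
  shows "det_real (Fx z) (Fy z) (n1 z) (n2 z) > 0"
proof -
  have "det_real (Fx z) (Fy z) (n1 z) (n2 z) = (nscale z * nscale z) * det_real (Fx z) (Fy z) (N1 z) (N2 z)"
    using det_real_rotate[of "Fx z" "Fy z" "nscale z" "N1 z" 0 "N2 z" 0 "nscale z"] by (simp add: n1_def n2_def)
  also have "det_real (Fx z) (Fy z) (N1 z) (N2 z) = (e10 z + e01 z)\<^sup>2 * (cmod (cdet (F10 z) (F01 z)))\<^sup>2"
    unfolding Fx_eq Fy_eq N1_def N2_def by (rule det_real_tangent_normal)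
  finally show ?thesis
    using nscale_pos[OF z] R_pos[OF z] cdet_F10_F01[OF z] by simp
qed

lemma normal_vector_eq_0:
  assumes z: "z \<in> R" and Y: "\<And>v. G (F z) Y (fderiv F z v) = 0" "G (F z) Y (n1 z) = 0" "G (F z) Y (n2 z) = 0"
  shows "Y = 0"
proof -
  note p = F_in_V[OF R_U(1)[OF z]]
  note l = bilinear_simps[OF bilinear_G[OF p]]
  have x: "G (F z) Y (F10 z) + G (F z) Y (F01 z) = 0" using Y(1)[of 1] by (simp add: Fx_eq l)
  have y: "G (F z) Y (J (F10 z)) - G (F z) Y (J (F01 z)) = 0" using Y(1)[of \<i>] by (simp add: Fy_eq J_simps l)
  have n: "e01 z * G (F z) Y (F10 z) - e10 z * G (F z) Y (F01 z) = 0"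
    "e01 z * G (F z) Y (J (F10 z)) + e10 z * G (F z) Y (J (F01 z)) = 0"
    using Y(2,3) nscale_pos[OF z] by (simp_all add: n1_def n2_def N1_def N2_def J_simps l)
  have "(e01 z + e10 z) * G (F z) Y (F10 z) = 0" "(e01 z + e10 z) * G (F z) Y (J (F10 z)) = 0"
    using x y n by algebra+
  then have "G (F z) Y (F10 z) = 0" "G (F z) Y (J (F10 z)) = 0"
    using R_pos(1,2)[OF z] by auto
  then show ?thesis
    using x y by (intro orthogonal_complement_trivial[OF p cdet_F10_F01[OF z]]) auto
qed

lemma normal_expansion:
  assumes z: "z \<in> R" and X: "\<And>v. G (F z) X (fderiv F z v) = 0"
  shows "X = G (F z) X (n1 z) *\<^sub>R n1 z + G (F z) X (n2 z) *\<^sub>R n2 z"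
proof -
  note p = F_in_V[OF R_U(1)[OF z]]
  note l = bilinear_simps[OF bilinear_G[OF p]]
  have "X - (G (F z) X (n1 z) *\<^sub>R n1 z + G (F z) X (n2 z) *\<^sub>R n2 z) = 0"
    using orthonormal_n[OF z] sym_G[OF p, of "n2 z" "n1 z"]
    by (intro normal_vector_eq_0[OF z]) (auto simp: l X normal_n[OF z] orthonormal_pair_def)
  then show ?thesis by simp
qed

text \<open>In the oriented normal plane any admissible basis arises from the standard one by a rotation; the
  orientation excludes reflections.\<close>

lemma normal_basis_rotation:
  assumes z: "z \<in> R" and nb: "normal_basis G F z m m'"
  defines "c \<equiv> G (F z) m (n1 z)" and "s \<equiv> G (F z) m (n2 z)"
  shows "m = c *\<^sub>R n1 z + s *\<^sub>R n2 z" "m' = - s *\<^sub>R n1 z + c *\<^sub>R n2 z" "c\<^sup>2 + s\<^sup>2 = 1"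
proof -
  note p = F_in_V[OF R_U(1)[OF z]]
  note l = bilinear_simps[OF bilinear_G[OF p]]
  define c' where "c' = G (F z) m' (n1 z)"
  define s' where "s' = G (F z) m' (n2 z)"
  have on: "orthonormal_pair (G (F z)) m m'" and pos: "positive_basis4 (Fx z) (Fy z) m m'"
    using nb by (auto simp: normal_basis_def)
  show m: "m = c *\<^sub>R n1 z + s *\<^sub>R n2 z"
    unfolding c_def s_def by (rule normal_expansion[OF z]) (use nb in \<open>simp add: normal_basis_def\<close>)
  have m': "m' = c' *\<^sub>R n1 z + s' *\<^sub>R n2 z"
    unfolding c'_def s'_def by (rule normal_expansion[OF z]) (use nb in \<open>simp add: normal_basis_def\<close>)
  have o: "G (F z) (n1 z) (n1 z) = 1" "G (F z) (n2 z) (n2 z) = 1" "G (F z) (n1 z) (n2 z) = 0" "G (F z) (n2 z) (n1 z) = 0"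
    using orthonormal_n[OF z] sym_G[OF p, of "n2 z" "n1 z"] by (auto simp: orthonormal_pair_def)
  have prod: "G (F z) (x *\<^sub>R n1 z + y *\<^sub>R n2 z) (x' *\<^sub>R n1 z + y' *\<^sub>R n2 z) = x * x' + y * y'" for x y x' y'
    by (simp add: l o)
  have "G (F z) m m = 1" "G (F z) m' m' = 1" "G (F z) m m' = 0"
    using on by (auto simp: orthonormal_pair_def)
  then have e: "c * c + s * s = 1" "c' * c' + s' * s' = 1" "c * c' + s * s' = 0"
    using m m' prod[of c s c s] prod[of c' s' c' s'] prod[of c s c' s'] by simp_all
  show "c\<^sup>2 + s\<^sup>2 = 1" using e(1) by (simp add: power2_eq_square)
  have "det_real (Fx z) (Fy z) m m' > 0" using pos by (simp add: positive_basis4_def det_real_def)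
  then have "(c * s' - s * c') * det_real (Fx z) (Fy z) (n1 z) (n2 z) > 0"
    using det_real_rotate[of "Fx z" "Fy z" c "n1 z" s "n2 z" c' s'] m m' by simp
  then have "c * s' - s * c' > 0"
    using det_real_frame_pos[OF z] by (simp add: zero_less_mult_iff)
  \<comment> \<open>By the Lagrange identity.\<close>
  moreover have "(c * s' - s * c')\<^sup>2 = 1"
  proof -
    have "(c * s' - s * c')\<^sup>2 + (c * c' + s * s')\<^sup>2 = (c * c + s * s) * (c' * c' + s' * s')"
      by (simp add: power2_eq_square algebra_simps)
    then show ?thesis by (simp add: e)
  qed
  ultimately have d: "c * s' - s * c' = 1" by (simp add: power2_eq_1_iff)
  have "(c * c + s * s) * s' = c * (c * s' - s * c') + s * (c * c' + s * s')"
    "(c * c + s * s) * c' = c * (c * c' + s * s') - s * (c * s' - s * c')"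
    by (simp_all add: algebra_simps)
  then have "s' = c" "c' = - s" unfolding e d by simp_all
  then show "m' = - s *\<^sub>R n1 z + c *\<^sub>R n2 z" using m' by simp
qed

end

context chern_patch
begin

lemma connection_form_n:
  assumes z: "z \<in> R"
  shows "connection_form G (levi_civita G) F n1 n2 z v = (1/2) * fderiv (\<lambda>z. ln (q z)) z (\<i> * v)"
proof -
  note zU = R_U(1)[OF z]
  note p = F_in_V[OF zU]
  note l = bilinear_simps[OF bilinear_G[OF p]]
  have d: "f differentiable at z" if "smooth_on U f" for f :: "complex \<Rightarrow> 'x::real_normed_vector"
    by (rule differentiable_U[OF that zU])
  have "cov_lc n1 z v = nscale z *\<^sub>R cov_lc N1 z v + 0 *\<^sub>R cov_lc N1 z v
      + fderiv nscale z v *\<^sub>R N1 z + fderiv (\<lambda>_. 0::real) z v *\<^sub>R N1 z"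
    by (rule cov_along_smooth_combination[where F = F and \<Gamma> = "levi_civita G" and n = n1 and e = N1 and e' = N1
          and c = nscale and s = "\<lambda>_. 0", OF open_R z levi_civita(1)[OF p]])
      (auto simp: n1_def intro: d smooth_N smooth_on_differentiable[OF smooth_nscale open_R z])
  then have "connection_form G (levi_civita G) F n1 n2 z v
      = (nscale z * nscale z) * connection_form G (levi_civita G) F N1 N2 z v"
    by (simp add: connection_form_def n2_def l N_products(3)[OF zU])
  also have "nscale z * nscale z = 1 / (e10 z * e01 z * conf z)"
    using nscale_square[OF z] R_pos[OF z] by (simp add: field_simps)
  finally have 1: "connection_form G (levi_civita G) F n1 n2 z v = 1 / (e10 z * e01 z * conf z) *
      (((e01 z)\<^sup>2 * fderiv e10 z (\<i> * v) + (e10 z)\<^sup>2 * fderiv e01 z (\<i> * v)) / 2)"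
    by (simp only: connection_form_N[OF zU])
  have "ln (q y) = ln (e10 y) + ln (e01 y) - ln (conf y)" if "y \<in> R" for y
    using R_pos[OF that] by (simp add: q_def powr_minus ln_mult ln_inverse)
  then have "fderiv (\<lambda>z. ln (q z)) z w = fderiv (\<lambda>y. ln (e10 y) + ln (e01 y) - ln (conf y)) z w" for w
    by (intro fun_cong[OF fderiv_cong_open[OF open_R z]]) auto
  moreover have sl: "smooth_on R (\<lambda>z. ln (e10 z))"
    by (rule smooth_on_ln[OF open_R smooth_on_R[OF smooth_e10] R_pos(1)])
  have sl2: "smooth_on R (\<lambda>z. ln (e01 z))"
    by (rule smooth_on_ln[OF open_R smooth_on_R[OF smooth_e01] R_pos(2)])
  have sl3: "smooth_on R (\<lambda>z. ln (conf z))"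
    by (rule smooth_on_ln[OF open_R smooth_on_R[OF smooth_conf] R_pos(3)])
  have dl: "(\<lambda>z. ln (e10 z)) differentiable at z" "(\<lambda>z. ln (e01 z)) differentiable at z" "(\<lambda>z. ln (conf z)) differentiable at z"
    using sl sl2 sl3 smooth_on_differentiable[OF _ open_R z] by blast+
  have "fderiv (\<lambda>y. ln (e10 y) + ln (e01 y) - ln (conf y)) z w
      = fderiv e10 z w / e10 z + fderiv e01 z w / e01 z - fderiv conf z w / conf z" for w
    using fderiv_real_compose[OF DERIV_ln[OF R_pos(1)[OF z]] d[OF smooth_e10], of w]
      fderiv_real_compose[OF DERIV_ln[OF R_pos(2)[OF z]] d[OF smooth_e01], of w]
      fderiv_real_compose[OF DERIV_ln[OF R_pos(3)[OF z]] d[OF smooth_conf], of w]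
    by (simp add: fderiv_add fderiv_diff dl differentiable_add divide_inverse mult.commute)
  moreover have "fderiv conf z w = fderiv e10 z w + fderiv e01 z w" for w
    using fderiv_cong_open[OF open_U zU, of conf "\<lambda>y. e10 y + e01 y"] conf_eq
    by (simp add: fderiv_add d smooth_e10 smooth_e01)
  ultimately have 2: "fderiv (\<lambda>z. ln (q z)) z w =
      fderiv e10 z w / e10 z + fderiv e01 z w / e01 z - (fderiv e10 z w + fderiv e01 z w) / (e10 z + e01 z)" for w
    by (simp add: conf_eq[OF zU])
  define A B a b where "A = e10 z" and "B = e01 z" and "a = fderiv e10 z (\<i> * v)" and "b = fderiv e01 z (\<i> * v)"
  have AB: "A > 0" "B > 0" "A + B > 0" using R_pos[OF z] by (auto simp: A_def B_def)
  have "1 / (A * B * (A + B)) * ((B\<^sup>2 * a + A\<^sup>2 * b) / 2) = (1/2) * (a / A + b / B - (a + b) / (A + B))"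
    using AB by (simp add: divide_simps power2_eq_square) (simp add: algebra_simps)
  then show ?thesis
    unfolding 1 2 conf_eq[OF zU] by (simp only: A_def B_def a_def b_def)
qed

text \<open>The analogue of \<open>has_gauss_curvature_iff\<close> for the normal bundle, with the opposite sign of the
  connection form.\<close>

theorem has_normal_curvature_iff:
  assumes z: "z \<in> R"
  shows "has_normal_curvature G F z k \<longleftrightarrow> k = laplacian (\<lambda>z. ln (q z)) z / (2 * conf z)"
proof -
  let ?u = "\<lambda>z. ln (q z)" and ?\<omega> = "connection_form G (levi_civita G) F"
  have su: "smooth_on R ?u" by (rule smooth_on_ln[OF open_R smooth_q R_pos(5)])
  have ext: "ext_deriv (?\<omega> n1 n2) z v w = - (1/2) * laplacian ?u z * (Re v * Im w - Im v * Re w)" for v w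
    by (rule ext_deriv_conjugate_differential[OF open_R z su connection_form_n])
  note area = induced.area_form_conformal[OF R_U(1)[OF z]]
  show ?thesis
  proof
    assume "has_normal_curvature G F z k"
    then obtain W m m' where W: "open W" "z \<in> W" and m: "smooth_on W m" "smooth_on W m'"
      and nb: "\<And>y. y \<in> W \<Longrightarrow> normal_basis G F y (m y) (m' y)"
      and k: "\<And>v w. ext_deriv (?\<omega> m m') z v w = - k * area_form (pullback_metric G F) z v w"
      unfolding has_normal_curvature_def by blast
    define W' where "W' = W \<inter> R"
    have W': "open W'" "z \<in> W'" "W' \<subseteq> R" "W' \<subseteq> W" "W' \<subseteq> U"
      using W z open_R R_U(2) by (auto simp: W'_def)
    have sm: "smooth_on W' n1" "smooth_on W' n2" "smooth_on W' m" "smooth_on W' m'" "smooth_on W' F"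
      using smooth_n m smooth_F W' by (auto intro: smooth_on_subset)
    have FW: "F ` W' \<subseteq> V" using F_U W' by blast
    define c where "c y = G (F y) (m y) (n1 y)" for y
    define s where "s y = G (F y) (m y) (n2 y)" for y
    have rot: "m y = c y *\<^sub>R n1 y + s y *\<^sub>R n2 y" "m' y = - s y *\<^sub>R n1 y + c y *\<^sub>R n2 y" "(c y)\<^sup>2 + (s y)\<^sup>2 = 1"
      if "y \<in> W'" for y
      using normal_basis_rotation[OF _ nb, of y] that W'(3,4) unfolding c_def s_def by blast+
    have "ext_deriv (?\<omega> m m') z 1 \<i> = ext_deriv (?\<omega> n1 n2) z 1 \<i>"
    proof (rule ext_deriv_connection_form_rotate[where F = F and \<Gamma> = "levi_civita G" and c = c and s = s,
          OF W'(1,2) FW sm(5,1,2)])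
      show "smooth_on W' c" "smooth_on W' s"
        unfolding c_def s_def
        by (rule smooth_on_pairing[OF W'(1) FW sm(5,3,1)], rule smooth_on_pairing[OF W'(1) FW sm(5,3,2)])
      show "orthonormal_pair (G (F y)) (n1 y) (n2 y)" if "y \<in> W'" for y
        using that W' by (intro orthonormal_n) auto
      show "bilinear (levi_civita G p)" "metric_parallel G p (levi_civita G p)" if "p \<in> V" for p
        using levi_civita(1,2)[OF that] .
      show "(\<lambda>y. ?\<omega> n1 n2 y v) differentiable at z" for v
      proof -
        have "(\<lambda>y. (1/2) * fderiv ?u y (\<i> * v)) differentiable at z"
          by (intro differentiable_mult differentiable_const
              smooth_on_differentiable[OF smooth_on_fderiv[OF su] open_R z])
        then show ?thesis
          by (rule differentiable_cong_open[OF open_R z, rotated]) (simp add: connection_form_n)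
      qed
    qed (fact rot)+
    then show "k = laplacian ?u z / (2 * conf z)"
      using k[of 1 \<i>] ext[of 1 \<i>] R_pos(3)[OF z] by (simp add: area field_simps)
  next
    assume k: "k = laplacian ?u z / (2 * conf z)"
    show "has_normal_curvature G F z k"
      unfolding has_normal_curvature_def
    proof (intro exI conjI ballI allI)
      show "open R" "z \<in> R" "smooth_on R n1" "smooth_on R n2"
        by (fact open_R z smooth_n)+
      show "normal_basis G F y (n1 y) (n2 y)" if "y \<in> R" for y
        using orthonormal_n[OF that] normal_n[OF that] det_real_frame_pos[OF that]
        by (simp add: normal_basis_def positive_basis4_def det_real_def)
      show "ext_deriv (?\<omega> n1 n2) z v w = - k * area_form (pullback_metric G F) z v w" for v w
        using R_pos(3)[OF z] by (simp add: ext k area)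
    qed
  qed
qed

end

section \<open>The Kaehler angle\<close>

context hermitian_patch
begin

lemma exists_orthogonal:
  assumes p: "p \<in> V" and b: "b \<noteq> 0"
  obtains u where "u \<noteq> 0" "G p u b = 0" "G p u (J b) = 0"
proof -
  note l = bilinear_simps[OF bilinear_G[OF p]]
  \<comment> \<open>Any vector independent of \<open>b\<close> over the complex numbers, here with determinant the squared length,
    is made orthogonal to \<open>b\<close> by the Gram-Schmidt step.\<close>
  define X :: "complex ^ 2" where "X = vector [- cnj (b$2), cnj (b$1)]"
  have bb: "G p b b > 0" by (rule pos_G[OF p b])
  define u where "u = X - (G p X b / G p b b) *\<^sub>R b - (G p X (J b) / G p b b) *\<^sub>R J b"
  have "cdet b u = cdet b X" by (simp add: cdet_def u_def algebra_simps)
  also have "cdet b X = of_real ((cmod (b$1))\<^sup>2 + (cmod (b$2))\<^sup>2)"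
    by (simp add: cdet_def X_def complex_mult_cnj cmod_power2)
  also have "\<dots> \<noteq> 0"
  proof -
    have "b$1 \<noteq> 0 \<or> b$2 \<noteq> 0" using b by (auto simp: vec_eq_iff forall_2)
    then show ?thesis unfolding of_real_eq_0_iff by (auto simp: add_nonneg_eq_0_iff)
  qed
  finally have "u \<noteq> 0" by (auto simp: cdet_def)
  moreover have "G p (J b) b = 0" using G_self_J[OF p, of b] sym_G[OF p, of b "J b"] by simp
  then have "G p u b = 0" "G p u (J b) = 0"
    using bb G_self_J[OF p, of b] by (simp_all add: u_def l G_J_J[OF p])
  ultimately show ?thesis using that by blast
qed

lemma unitary_expansion:
  assumes p: "p \<in> V" and u: "G p u u = 1" "G p u' u' = 1" "G p u u' = 0" "G p u (J u') = 0"
  shows "G p v w = G p v u * G p w u + G p v (J u) * G p w (J u) + (G p v u' * G p w u' + G p v (J u') * G p w (J u'))"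
proof -
  note l = bilinear_simps[OF bilinear_G[OF p]]
  have z: "G p u (J u) = 0" "G p (J u) u = 0" "G p u' (J u') = 0" "G p (J u') u' = 0"
    "G p u' u = 0" "G p (J u) u' = 0" "G p u' (J u) = 0" "G p (J u') u = 0"
    using G_self_J[OF p, of u] G_self_J[OF p, of u'] sym_G[OF p, of "J u" u] sym_G[OF p, of "J u'" u'] u
      sym_G[OF p, of u' u] G_J_left[OF p, of u u'] sym_G[OF p, of "J u" u'] sym_G[OF p, of "J u'" u] by auto
  have nz: "u \<noteq> 0" "u' \<noteq> 0" using u bilinear_lzero[OF bilinear_G[OF p]] by auto
  have "v - (G p v u *\<^sub>R u + G p v (J u) *\<^sub>R J u + (G p v u' *\<^sub>R u' + G p v (J u') *\<^sub>R J u')) = 0"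
    by (rule orthogonal_complement_trivial[OF p cdet_orthogonal_nonzero[OF p nz u(3,4)]])
      (simp_all add: l u z G_J_J[OF p])
  then have "v = G p v u *\<^sub>R u + G p v (J u) *\<^sub>R J u + (G p v u' *\<^sub>R u' + G p v (J u') *\<^sub>R J u')" by simp
  then have "G p v w = G p (G p v u *\<^sub>R u + G p v (J u) *\<^sub>R J u + (G p v u' *\<^sub>R u' + G p v (J u') *\<^sub>R J u')) w"
    by simp
  then show ?thesis
    using sym_G[OF p, of w] by (simp add: l)
qed

text \<open>The Hermitian product with \<open>u\<close>. The factor \<open>1 / sqrt 2\<close> compensates the convention of \<open>sym_prod\<close>,
  by which the coframe dual to a unit vector has squared modulus one half on it.\<close>

definition unit_form :: "complex ^ 2 \<Rightarrow> complex ^ 2 \<Rightarrow> complex ^ 2 \<Rightarrow> complex" where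
  "unit_form p u v = Complex (G p v u) (G p v (J u)) / of_real (sqrt 2)"

lemma complex_linear_unit_form: "p \<in> V \<Longrightarrow> complex_linear J ((*) \<i>) (unit_form p u)"
proof -
  assume p: "p \<in> V"
  note l = bilinear_simps[OF bilinear_G[OF p]]
  have "linear (unit_form p u)"
    by (rule linearI) (simp_all add: unit_form_def l complex_eq_iff field_simps)
  moreover have "unit_form p u (J v) = \<i> * unit_form p u v" for v
    by (simp add: unit_form_def G_J_left[OF p] J_J l complex_eq_iff)
  ultimately show ?thesis by (simp add: complex_linear_def)
qed

lemma sym_prod_unit_form:
  "sym_prod (unit_form p u) v w = of_real (G p v u * G p w u + G p v (J u) * G p w (J u))"
proof -
  have "sqrt 2 * sqrt 2 = (2::real)" by simp
  then show ?thesis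
    by (simp add: sym_prod_def unit_form_def complex_eq_iff field_simps)
qed

end

context conformal_patch
begin

lemma fderiv_F_complex: "z \<in> U \<Longrightarrow> fderiv F z v = v *s F10 z + cnj v *s F01 z"
  unfolding fderiv_F[of z v] complex_scale_real[of v] complex_scale_real[of "cnj v"] Fx_eq Fy_eq
  by (simp add: J_simps algebra_simps)

text \<open>A form \<open>\<omega>1\<close> whose pull-back is of type \<open>(1,0)\<close> vanishes on \<open>F01\<close>, and dually for \<open>\<omega>2\<close>. So the two
  energy densities are \<open>conf\<close> times the squared moduli of \<open>s\<close> and \<open>t\<close>.\<close>

lemma has_kahler_angle_imp:
  assumes z: "z \<in> U" and ka: "has_kahler_angle G F z \<alpha>"
  shows "\<alpha> = arccos ((e10 z - e01 z) / conf z)"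
proof -
  obtain \<phi> \<omega>1 \<omega>2 s t where al: "0 \<le> \<alpha>" "\<alpha> \<le> pi"
    and lin: "complex_linear ((*) \<i>) ((*) \<i>) \<phi>" "complex_linear J ((*) \<i>) \<omega>1" "complex_linear J ((*) \<i>) \<omega>2"
    and h: "\<And>v w. of_real (pullback_metric G F z v w) = sym_prod \<phi> v w"
    and g: "\<And>v w. of_real (G (F z) v w) = sym_prod \<omega>1 v w + sym_prod \<omega>2 v w"
    and pb: "\<And>v. \<omega>1 (fderiv F z v) = s * \<phi> v" "\<And>v. \<omega>2 (fderiv F z v) = t * cnj (\<phi> v)"
    and st: "cmod s = cos (\<alpha> / 2)" "cmod t = sin (\<alpha> / 2)"
    using ka unfolding has_kahler_angle_def by blast
  have phi_i: "\<phi> \<i> = \<i> * \<phi> 1"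
    using lin(1) unfolding complex_linear_def by (metis mult.right_neutral)
  have om: "linear \<omega>1" "linear \<omega>2" "\<And>v. \<omega>1 (J v) = \<i> * \<omega>1 v" "\<And>v. \<omega>2 (J v) = \<i> * \<omega>2 v"
    using lin(2,3) by (auto simp: complex_linear_def)
  have plus: "\<omega>1 (F10 z) + \<omega>1 (F01 z) = s * \<phi> 1" "\<omega>2 (F10 z) + \<omega>2 (F01 z) = t * cnj (\<phi> 1)"
    using pb(1)[of 1] pb(2)[of 1] by (simp_all add: Fx_eq linear_add[OF om(1)] linear_add[OF om(2)])
  have minus: "\<omega>1 (F10 z) - \<omega>1 (F01 z) = s * \<phi> 1" "\<omega>2 (F10 z) - \<omega>2 (F01 z) = - (t * cnj (\<phi> 1))"
  proof -
    have "\<i> * (\<omega>1 (F10 z) - \<omega>1 (F01 z)) = \<i> * (s * \<phi> 1)"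
      using pb(1)[of \<i>] unfolding Fy_eq om(3) linear_diff[OF om(1)] phi_i by (simp only: mult.left_commute)
    then show "\<omega>1 (F10 z) - \<omega>1 (F01 z) = s * \<phi> 1" by (simp only: mult_left_cancel[OF complex_i_not_zero])
    have "\<i> * (\<omega>2 (F10 z) - \<omega>2 (F01 z)) = \<i> * (- (t * cnj (\<phi> 1)))"
      using pb(2)[of \<i>] unfolding Fy_eq om(4) linear_diff[OF om(2)] phi_i by simp
    then show "\<omega>2 (F10 z) - \<omega>2 (F01 z) = - (t * cnj (\<phi> 1))" by (simp only: mult_left_cancel[OF complex_i_not_zero])
  qed
  have half: "x = (p + q) / 2" "y = (p - q) / 2" if "x + y = p" "x - y = q" for x y p q :: complex
    unfolding that[symmetric] by simp_all
  have vals: "\<omega>1 (F10 z) = s * \<phi> 1" "\<omega>1 (F01 z) = 0" "\<omega>2 (F01 z) = t * cnj (\<phi> 1)" "\<omega>2 (F10 z) = 0"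
    unfolding half[OF plus(1) minus(1)] half[OF plus(2) minus(2)] by simp_all
  have sp: "sym_prod f v v = of_real (2 * (cmod (f v))\<^sup>2)" for f :: "'x \<Rightarrow> complex" and v
    unfolding of_real_mult complex_norm_square by (simp add: sym_prod_def)
  have "of_real (conf z) = complex_of_real (2 * (cmod (\<phi> 1))\<^sup>2)"
    using h[of 1 1] pullback_metric_eq[OF z, of 1 1] by (simp add: sp inner_complex_def)
  then have c: "conf z = 2 * (cmod (\<phi> 1))\<^sup>2" by (simp only: of_real_eq_iff)
  have "of_real (e10 z) = complex_of_real (2 * (cmod (s * \<phi> 1))\<^sup>2)" "of_real (e01 z) = complex_of_real (2 * (cmod (t * cnj (\<phi> 1)))\<^sup>2)"
    unfolding e10_def e01_def g sp vals by simp_all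
  then have e: "e10 z = (cmod s)\<^sup>2 * conf z" "e01 z = (cmod t)\<^sup>2 * conf z"
    unfolding of_real_eq_iff c by (simp_all add: norm_mult power_mult_distrib)
  have "(e10 z - e01 z) / conf z = (cos (\<alpha> / 2))\<^sup>2 - (sin (\<alpha> / 2))\<^sup>2"
    unfolding e st using conf_pos[OF z] by (simp add: field_simps)
  also have "\<dots> = cos \<alpha>" using cos_double[of "\<alpha> / 2"] by simp
  finally show ?thesis using al by (simp add: arccos_cos)
qed

lemma has_kahler_angle_arccos:
  assumes z: "z \<in> U"
  shows "has_kahler_angle G F z (arccos ((e10 z - e01 z) / conf z))"
proof -
  note p = F_in_V[OF z]
  note l = bilinear_simps[OF bilinear_G[OF p]]
  define x where "x = (e10 z - e01 z) / conf z"
  have x: "(1 + x) / 2 = e10 z / conf z" "(1 - x) / 2 = e01 z / conf z"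
    using conf_pos[OF z] conf_eq[OF z] by (simp_all add: x_def field_simps)
  have x1: "- 1 \<le> x" "x \<le> 1"
    using e_nonneg[OF z] conf_pos[OF z] conf_eq[OF z] by (simp_all add: x_def field_simps)
  have ar: "0 \<le> arccos x" "arccos x \<le> pi" using arccos_lbound arccos_ubound x1 by auto
  \<comment> \<open>A Hermitian orthogonal basis through the two components, also when one of them vanishes.\<close>
  obtain a b where ab: "a \<noteq> 0" "b \<noteq> 0" "G (F z) a b = 0" "G (F z) a (J b) = 0"
      "F10 z = 0 \<or> F10 z = a" "F01 z = 0 \<or> F01 z = b"
  proof (cases "F10 z = 0")
    case True
    then have b: "F01 z \<noteq> 0"
      using conf_pos[OF z] conf_eq[OF z] e_eq_0_iff[OF z] by auto
    obtain a where "a \<noteq> 0" "G (F z) a (F01 z) = 0" "G (F z) a (J (F01 z)) = 0"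
      using exists_orthogonal[OF p b] .
    then show ?thesis using that[of a "F01 z"] b True by blast
  next
    case a: False
    show ?thesis
    proof (cases "F01 z = 0")
      case True
      obtain b where b: "b \<noteq> 0" "G (F z) b (F10 z) = 0" "G (F z) b (J (F10 z)) = 0"
        using exists_orthogonal[OF p a] .
      have "G (F z) (F10 z) b = 0" "G (F z) (F10 z) (J b) = 0"
        using b G_J_left[OF p, of "F10 z" b] sym_G[OF p, of b] by auto
      then show ?thesis using that[of "F10 z" b] a b True by blast
    next
      case False
      then show ?thesis using that[of "F10 z" "F01 z"] a F10_F01_orthogonal[OF z] by blast
    qed
  qed
  define u u' where "u = (1 / sqrt (G (F z) a a)) *\<^sub>R a" and "u' = (1 / sqrt (G (F z) b b)) *\<^sub>R b"
  note ud = this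
  have pos: "G (F z) a a > 0" "G (F z) b b > 0" using pos_G[OF p] ab by auto
  then have on: "G (F z) u u = 1" "G (F z) u' u' = 1" "G (F z) u u' = 0" "G (F z) u (J u') = 0"
    by (simp_all add: ud l J_scaleR ab real_sqrt_mult_self flip: mult.assoc)
  have au: "F10 z = sqrt (e10 z) *\<^sub>R u" "F01 z = sqrt (e01 z) *\<^sub>R u'"
    using ab(5,6) pos by (auto simp: e10_def e01_def ud bilinear_lzero[OF bilinear_G[OF p]])
  have z0: "G (F z) u (J u) = 0" "G (F z) u' (J u') = 0" "G (F z) u' u = 0" "G (F z) u' (J u) = 0"
    using G_self_J[OF p] on sym_G[OF p, of u' u] G_J_left[OF p, of u u'] sym_G[OF p, of u' "J u"] by auto
  have s2: "sqrt 2 * sqrt 2 = (2::real)" by simp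
  define k where "k = sqrt (conf z / 2)"
  have kk: "k * k = conf z / 2" using conf_pos[OF z] by (simp add: k_def)
  define \<phi> where "\<phi> v = of_real k * v" for v :: complex
  let ?\<omega> = "unit_form (F z)"
  have lw: "complex_linear J ((*) \<i>) (?\<omega> w)" for w by (rule complex_linear_unit_form[OF p])
  have scale: "?\<omega> w (c *s v) = c * ?\<omega> w v" for w c v
  proof -
    have "?\<omega> w (Re c *\<^sub>R v + Im c *\<^sub>R J v) = Re c *\<^sub>R ?\<omega> w v + Im c *\<^sub>R (\<i> * ?\<omega> w v)"
      using lw[of w] by (simp add: complex_linear_def linear_add linear_scale)
    then show ?thesis unfolding complex_scale_real[of c v] by (simp add: complex_eq_iff)
  qed
  have dF: "?\<omega> w (fderiv F z v) = v * (of_real (sqrt (e10 z)) * ?\<omega> w u) + cnj v * (of_real (sqrt (e01 z)) * ?\<omega> w u')" for w v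
  proof -
    have lin: "linear (?\<omega> w)" using lw[of w] by (simp add: complex_linear_def)
    show ?thesis
      unfolding fderiv_F_complex[OF z] au linear_add[OF lin] scale linear_scale[OF lin]
      by (simp only: scaleR_conv_of_real)
  qed
  have uw: "?\<omega> u u = 1 / of_real (sqrt 2)" "?\<omega> u u' = 0" "?\<omega> u' u = 0" "?\<omega> u' u' = 1 / of_real (sqrt 2)"
    by (simp_all add: unit_form_def on z0 complex_eq_iff)
  have sq: "sqrt e / sqrt 2 = sqrt (e / conf z) * k" if "e \<ge> 0" for e
    using conf_pos[OF z] by (simp add: real_sqrt_divide k_def)
  show ?thesis
    unfolding has_kahler_angle_def x_def[symmetric]
  proof (intro conjI exI allI)
    show "complex_linear ((*) \<i>) ((*) \<i>) \<phi>"
      unfolding complex_linear_def by (auto intro!: linearI simp: \<phi>_def algebra_simps)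
    show "complex_linear J ((*) \<i>) (?\<omega> u)" "complex_linear J ((*) \<i>) (?\<omega> u')" by (rule lw)+
    show "of_real (pullback_metric G F z v w) = sym_prod \<phi> v w" for v w
    proof -
      have "sym_prod \<phi> v w = of_real (k * k) * (v * cnj w + cnj v * w)"
        by (simp add: sym_prod_def \<phi>_def algebra_simps)
      also have "v * cnj w + cnj v * w = of_real (2 * (v \<bullet> w))"
        by (simp add: complex_eq_iff inner_complex_def)
      finally show ?thesis by (simp add: pullback_metric_eq[OF z] kk)
    qed
    show "of_real (G (F z) v w) = sym_prod (?\<omega> u) v w + sym_prod (?\<omega> u') v w" for v w
      unfolding sym_prod_unit_form of_real_add[symmetric] unitary_expansion[OF p on, of v w] ..
    show "?\<omega> u (fderiv F z v) = of_real (sqrt (e10 z / conf z)) * \<phi> v" for v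
    proof -
      have "complex_of_real (sqrt (e10 z) / sqrt 2) = of_real (sqrt (e10 z / conf z) * k)"
        by (simp only: sq[OF e_nonneg(1)[OF z]])
      then show ?thesis unfolding dF uw \<phi>_def by simp
    qed
    show "?\<omega> u' (fderiv F z v) = of_real (sqrt (e01 z / conf z)) * cnj (\<phi> v)" for v
    proof -
      have "complex_of_real (sqrt (e01 z) / sqrt 2) = of_real (sqrt (e01 z / conf z) * k)"
        by (simp only: sq[OF e_nonneg(2)[OF z]])
      then show ?thesis unfolding dF uw \<phi>_def by simp
    qed
    have "cos (2 * (arccos x / 2)) = x" using x1 by simp
    then have half: "(cos (arccos x / 2))\<^sup>2 = (1 + x) / 2" "(sin (arccos x / 2))\<^sup>2 = (1 - x) / 2"
      using cos_double_cos[of "arccos x / 2"] cos_double_sin[of "arccos x / 2"] by (simp_all add: field_simps)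
    have nn: "cos (arccos x / 2) \<ge> 0" "sin (arccos x / 2) \<ge> 0"
      using ar by (auto intro!: cos_ge_zero sin_ge_zero)
    have "sqrt ((1 + x) / 2) = cos (arccos x / 2)" "sqrt ((1 - x) / 2) = sin (arccos x / 2)"
      by (rule real_sqrt_unique[OF half(1) nn(1)], rule real_sqrt_unique[OF half(2) nn(2)])
    then show "cmod (of_real (sqrt (e10 z / conf z))) = cos (arccos x / 2)"
      "cmod (of_real (sqrt (e01 z / conf z))) = sin (arccos x / 2)"
      using nn by (simp_all add: x)
  qed (use ar in auto)
qed

theorem has_kahler_angle_iff:
  "z \<in> U \<Longrightarrow> has_kahler_angle G F z \<alpha> \<longleftrightarrow> \<alpha> = arccos ((e10 z - e01 z) / conf z)"
  using has_kahler_angle_imp has_kahler_angle_arccos by blast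

end

section \<open>Laplacians under holomorphic maps, and the maximum principle\<close>

lemma laplacian_cong_open:
  assumes S: "open S" "z \<in> S" and eq: "\<And>x. x \<in> S \<Longrightarrow> u x = v x"
  shows "laplacian u z = laplacian v z"
proof -
  have 1: "fderiv u x w = fderiv v x w" if "x \<in> S" for x w
    by (rule fun_cong[OF fderiv_cong_open[OF S(1) that eq]])
  have "fderiv (\<lambda>x. fderiv u x w) z w' = fderiv (\<lambda>x. fderiv v x w) z w'" for w w'
    by (rule fun_cong[OF fderiv_cong_open[OF S 1]])
  then show ?thesis by (simp add: laplacian_def)
qed

lemma laplacian_add:
  assumes S: "open S" "z \<in> S" and u: "smooth_on S u" and v: "smooth_on S v"
  shows "laplacian (\<lambda>x. u x + v x) z = laplacian u z + laplacian v z"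
proof -
  have 1: "fderiv (\<lambda>x. u x + v x) x w = fderiv u x w + fderiv v x w" if "x \<in> S" for x w
    by (rule fderiv_add[OF smooth_on_differentiable[OF u S(1) that] smooth_on_differentiable[OF v S(1) that]])
  have "fderiv (\<lambda>x. fderiv (\<lambda>x. u x + v x) x w) z w' = fderiv (\<lambda>x. fderiv u x w + fderiv v x w) z w'" for w w'
    by (rule fun_cong[OF fderiv_cong_open[OF S 1]])
  also have "fderiv (\<lambda>x. fderiv u x w + fderiv v x w) z w' = fderiv (\<lambda>x. fderiv u x w) z w' + fderiv (\<lambda>x. fderiv v x w) z w'" for w w'
    by (rule fderiv_add[OF smooth_on_differentiable[OF smooth_on_fderiv[OF u] S] smooth_on_differentiable[OF smooth_on_fderiv[OF v] S]])
  finally have "fderiv (\<lambda>x. fderiv (\<lambda>x. u x + v x) x w) z w'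
      = fderiv (\<lambda>x. fderiv u x w) z w' + fderiv (\<lambda>x. fderiv v x w) z w'" for w w' .
  then show ?thesis by (simp add: laplacian_def)
qed

lemma holomorphic_has_derivative:
  assumes "\<phi> holomorphic_on W" "open W" "x \<in> W"
  shows "(\<phi> has_derivative (\<lambda>v. deriv \<phi> x * v)) (at x)"
  using holomorphic_derivI[OF assms] unfolding has_field_derivative_def .

lemma fderiv_holomorphic:
  "\<phi> holomorphic_on W \<Longrightarrow> open W \<Longrightarrow> x \<in> W \<Longrightarrow> fderiv \<phi> x v = deriv \<phi> x * v"
  using fderivI[OF holomorphic_has_derivative] by simp

lemma differentiable_holomorphic:
  "\<phi> holomorphic_on W \<Longrightarrow> open W \<Longrightarrow> x \<in> W \<Longrightarrow> \<phi> differentiable at x"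
  using holomorphic_has_derivative unfolding differentiable_def by blast

text \<open>The chain rule for second derivatives: the terms with the second derivative of \<open>\<phi>\<close> cancel because
  \<open>1 + \<i>\<^sup>2 = 0\<close>, and the others are the Hessian of \<open>u\<close> transformed by a conformal matrix, which scales its
  trace.\<close>

lemma laplacian_holomorphic_compose:
  assumes W: "open W" "z \<in> W" and T: "open T" and hol: "\<phi> holomorphic_on W" and WT: "\<phi> ` W \<subseteq> T"
    and u: "smooth_on T u"
  shows "laplacian (\<lambda>x. u (\<phi> x)) z = (cmod (deriv \<phi> z))\<^sup>2 * laplacian u (\<phi> z)"
proof -
  let ?u1 = "\<lambda>x. fderiv u x 1" and ?ui = "\<lambda>x. fderiv u x \<i>"
  let ?p = "deriv \<phi>"
  have hol': "?p holomorphic_on W" by (rule holomorphic_deriv[OF hol W(1)])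
  have T': "\<phi> x \<in> T" if "x \<in> W" for x using WT that by auto
  have du: "u differentiable at y" "(\<lambda>x. fderiv u x w) differentiable at y" if "y \<in> T" for y w
    using smooth_on_differentiable[OF u T that] smooth_on_differentiable[OF smooth_on_fderiv[OF u] T that] .
  have d\<phi>: "\<phi> differentiable at z" by (rule differentiable_holomorphic[OF hol W])
  have first: "fderiv (\<lambda>x. u (\<phi> x)) x v = Re (?p x * v) * ?u1 (\<phi> x) + Im (?p x * v) * ?ui (\<phi> x)"
    if x: "x \<in> W" for x v
  proof -
    have "fderiv (\<lambda>x. u (\<phi> x)) x v = fderiv u (\<phi> x) (?p x * v)"
      by (simp add: fderiv_compose[OF differentiable_holomorphic[OF hol W(1) x] du(1)[OF T'[OF x]]]
          fderiv_holomorphic[OF hol W(1) x])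
    then show ?thesis using fderiv_expansion[OF du(1)[OF T'[OF x]], of "?p x * v"] by simp
  qed
  have comp: "fderiv (\<lambda>x. fderiv u (\<phi> x) w) z v = fderiv (\<lambda>x. fderiv u x w) (\<phi> z) (?p z * v)"
    "(\<lambda>x. fderiv u (\<phi> x) w) differentiable at z" for w v
    using fderiv_compose[OF d\<phi> du(2)[OF T'[OF W(2)]], of w v] fderiv_holomorphic[OF hol W]
      differentiable_chain_at[OF d\<phi> du(2)[OF T'[OF W(2)]], of w]
    by (simp_all add: o_def)
  have p: "((\<lambda>x. ?p x * v) has_derivative (\<lambda>h. deriv ?p z * h * v)) (at z)" for v
    by (rule has_derivative_mult_left[OF holomorphic_has_derivative[OF hol' W]])
  have reim: "fderiv (\<lambda>x. Re (?p x * v)) z w = Re (deriv ?p z * w * v)" "(\<lambda>x. Re (?p x * v)) differentiable at z"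
    "fderiv (\<lambda>x. Im (?p x * v)) z w = Im (deriv ?p z * w * v)" "(\<lambda>x. Im (?p x * v)) differentiable at z" for v w
    using has_derivative_Re[OF p[of v]] has_derivative_Im[OF p[of v]] fderivI[OF has_derivative_Re[OF p[of v]]]
      fderivI[OF has_derivative_Im[OF p[of v]]]
    by (auto simp: differentiable_def)
  have second: "fderiv (\<lambda>x. fderiv (\<lambda>x. u (\<phi> x)) x v) z w =
      Re (?p z * v) * fderiv ?u1 (\<phi> z) (?p z * w) + Re (deriv ?p z * w * v) * ?u1 (\<phi> z)
    + (Im (?p z * v) * fderiv ?ui (\<phi> z) (?p z * w) + Im (deriv ?p z * w * v) * ?ui (\<phi> z))" for v w
  proof -
    have "fderiv (\<lambda>x. fderiv (\<lambda>x. u (\<phi> x)) x v) z w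
        = fderiv (\<lambda>x. Re (?p x * v) * ?u1 (\<phi> x) + Im (?p x * v) * ?ui (\<phi> x)) z w"
      by (rule fun_cong[OF fderiv_cong_open[OF W first]])
    also have "\<dots> = fderiv (\<lambda>x. Re (?p x * v) * ?u1 (\<phi> x)) z w + fderiv (\<lambda>x. Im (?p x * v) * ?ui (\<phi> x)) z w"
      by (rule fderiv_add) (rule differentiable_mult reim comp)+
    finally show ?thesis
      unfolding fderiv_mult[OF reim(2) comp(2)] fderiv_mult[OF reim(4) comp(2)] reim comp(1) .
  qed
  define a b where "a = Re (?p z)" and "b = Im (?p z)"
  have ex: "fderiv (\<lambda>x. fderiv u x w) (\<phi> z) v = Re v * fderiv (\<lambda>x. fderiv u x w) (\<phi> z) 1 + Im v * fderiv (\<lambda>x. fderiv u x w) (\<phi> z) \<i>" for v w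
    using fderiv_expansion[OF du(2)[OF T'[OF W(2)]], of w v] by simp
  have n: "(cmod (?p z))\<^sup>2 = a * a + b * b" unfolding cmod_power2 a_def b_def by (simp add: power2_eq_square)
  have e1: "fderiv (\<lambda>x. fderiv u x w) (\<phi> z) (?p z * 1) = a * fderiv (\<lambda>x. fderiv u x w) (\<phi> z) 1 + b * fderiv (\<lambda>x. fderiv u x w) (\<phi> z) \<i>" for w
    using ex[of w "?p z * 1"] by (simp add: a_def b_def)
  have e2: "fderiv (\<lambda>x. fderiv u x w) (\<phi> z) (?p z * \<i>) = a * fderiv (\<lambda>x. fderiv u x w) (\<phi> z) \<i> - b * fderiv (\<lambda>x. fderiv u x w) (\<phi> z) 1" for w
    using ex[of w "?p z * \<i>"] by (simp add: a_def b_def)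
  show ?thesis
    unfolding laplacian_def second e1 e2 n
    by (simp add: a_def[symmetric] b_def[symmetric] algebra_simps)
qed

lemma smooth_on_Re: "smooth_on S (\<lambda>w. c * Re w)"
proof -
  have d: "((\<lambda>w. c * Re w) has_derivative (\<lambda>v. c * Re v)) (at x)" for x
    by (auto intro!: derivative_eq_intros)
  have "C_k_on k S (\<lambda>w. c * Re w)" for k
  proof (cases k)
    case 0
    then show ?thesis by (auto intro!: continuous_intros)
  next
    case (Suc k)
    have "(\<lambda>w. c * Re w) differentiable_on S"
      unfolding differentiable_on_def differentiable_def using d has_derivative_at_withinI by blast
    then show ?thesis using Suc by (simp add: fderivI[OF d] C_k_on_const)
  qed
  then show ?thesis by (simp add: smooth_on_def)
qed

lemma laplacian_Re_holomorphic:
  assumes W: "open W" "z \<in> W" and hol: "\<phi> holomorphic_on W"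
  shows "laplacian (\<lambda>x. c * Re (\<phi> x)) z = 0"
proof -
  have d: "((\<lambda>w. c * Re w) has_derivative (\<lambda>v. c * Re v)) (at x)" for x
    by (auto intro!: derivative_eq_intros)
  have "laplacian (\<lambda>w. c * Re w) y = 0" for y
    unfolding laplacian_def fderivI[OF d] by simp
  then show ?thesis
    using laplacian_holomorphic_compose[OF W open_UNIV hol _ smooth_on_Re[of UNIV c]] by simp
qed

lemma laplacian_const: "laplacian (\<lambda>x. c) z = 0"
  by (simp add: laplacian_def)

lemma smooth_on_holomorphic:
  assumes W: "open W" and hol: "\<phi> holomorphic_on W"
  shows "smooth_on W \<phi>"
proof -
  have "C_k_on k W \<phi>" for k
    using hol
  proof (induction k arbitrary: \<phi>)
    case 0
    then show ?case by (simp add: holomorphic_on_imp_continuous_on)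
  next
    case (Suc k)
    have "C_k_on k W (\<lambda>x. fderiv \<phi> x v)" for v
    proof (rule C_k_on_cong[OF W])
      show "C_k_on k W (\<lambda>x. deriv \<phi> x * v)"
        by (rule Suc.IH) (intro holomorphic_intros holomorphic_deriv[OF Suc.prems W])
    qed (simp add: fderiv_holomorphic[OF Suc.prems W])
    moreover have "\<phi> differentiable_on W"
      using differentiable_holomorphic[OF Suc.prems W] by (simp add: differentiable_on_eq_differentiable_at[OF W])
    ultimately show ?case by simp
  qed
  then show ?thesis by (simp add: smooth_on_def)
qed

text \<open>The logarithm of a density transforms by adding the logarithm of the squared modulus of the derivative
  of \<open>\<phi>\<close>, which is harmonic: locally it is the real part of a branch of a holomorphic logarithm.\<close>

lemma laplacian_ln_holomorphic_change:
  assumes W: "open W" "z \<in> W" and T: "open T" and hol: "\<phi> holomorphic_on W" and WT: "\<phi> ` W \<subseteq> T"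
    and p: "smooth_on T p" "\<And>y. y \<in> T \<Longrightarrow> p y > 0" and nz: "deriv \<phi> z \<noteq> 0"
    and p': "\<And>x. x \<in> W \<Longrightarrow> p' x = (cmod (deriv \<phi> x))\<^sup>2 * p (\<phi> x)"
  shows "laplacian (\<lambda>x. ln (p' x)) z = (cmod (deriv \<phi> z))\<^sup>2 * laplacian (\<lambda>y. ln (p y)) (\<phi> z)"
proof -
  let ?\<psi> = "deriv \<phi>"
  have hol': "?\<psi> holomorphic_on W" by (rule holomorphic_deriv[OF hol W(1)])
  \<comment> \<open>There the quotient stays in the right half plane, where the principal logarithm is holomorphic.\<close>
  define W' where "W' = W \<inter> (\<lambda>x. Re (?\<psi> x / ?\<psi> z)) -` {0<..}"
  have W': "open W'" "z \<in> W'" "W' \<subseteq> W"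
  proof -
    have "continuous_on W (\<lambda>x. Re (?\<psi> x / ?\<psi> z))"
      using holomorphic_on_imp_continuous_on[OF hol'] nz by (intro continuous_intros) auto
    then show "open W'" unfolding W'_def by (rule continuous_open_preimage[OF _ W(1) open_greaterThan])
  qed (use W nz in \<open>auto simp: W'_def\<close>)
  define L where "L x = Ln (?\<psi> x / ?\<psi> z)" for x
  have "L holomorphic_on W'"
    unfolding L_def
  proof (rule holomorphic_on_Ln')
    show "(\<lambda>x. ?\<psi> x / ?\<psi> z) holomorphic_on W'"
      using nz by (intro holomorphic_intros holomorphic_on_subset[OF hol' W'(3)])
    show "?\<psi> x / ?\<psi> z \<notin> \<real>\<^sub>\<le>\<^sub>0" if "x \<in> W'" for x
      using that by (auto simp: W'_def complex_nonpos_Reals_iff)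
  qed
  note holL = this
  define c where "c = 2 * ln (cmod (?\<psi> z))"
  have eq: "ln (p' x) = (2 * Re (L x) + c) + ln (p (\<phi> x))" if x: "x \<in> W'" for x
  proof -
    have nzx: "?\<psi> x \<noteq> 0" using x by (auto simp: W'_def)
    have "Re (L x) = ln (cmod (?\<psi> x)) - ln (cmod (?\<psi> z))"
      using nz nzx by (simp add: L_def norm_divide ln_div)
    moreover have "p (\<phi> x) > 0" using p(2) WT x W'(3) by blast
    ultimately show ?thesis
      using nzx x W'(3) by (simp add: p' c_def ln_mult ln_realpow subset_eq)
  qed
  have sL: "smooth_on W' (\<lambda>x. 2 * Re (L x))"
    by (rule smooth_on_compose[OF W'(1) open_UNIV _ smooth_on_holomorphic[OF W'(1) holL] smooth_on_Re]) simp
  have sp: "smooth_on T (\<lambda>y. ln (p y))" by (rule smooth_on_ln[OF T p])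
  have spp: "smooth_on W' (\<lambda>x. ln (p (\<phi> x)))"
    by (rule smooth_on_subset[OF smooth_on_compose[OF W(1) T WT smooth_on_holomorphic[OF W(1) hol] sp] W'(3)])
  have "laplacian (\<lambda>x. ln (p' x)) z = laplacian (\<lambda>x. (2 * Re (L x) + c) + ln (p (\<phi> x))) z"
    by (rule laplacian_cong_open[OF W'(1,2) eq])
  also have "\<dots> = laplacian (\<lambda>x. 2 * Re (L x) + c) z + laplacian (\<lambda>x. ln (p (\<phi> x))) z"
    by (rule laplacian_add[OF W'(1,2) smooth_on_add[OF W'(1) sL smooth_on_const] spp])
  also have "laplacian (\<lambda>x. 2 * Re (L x) + c) z = laplacian (\<lambda>x. 2 * Re (L x)) z + laplacian (\<lambda>x. c) z"
    by (rule laplacian_add[OF W'(1,2) sL smooth_on_const])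
  also have "\<dots> = 0" by (simp add: laplacian_const laplacian_Re_holomorphic[OF W'(1,2) holL])
  also have "laplacian (\<lambda>x. ln (p (\<phi> x))) z = (cmod (?\<psi> z))\<^sup>2 * laplacian (\<lambda>y. ln (p y)) (\<phi> z)"
    by (rule laplacian_holomorphic_compose[OF W T hol WT sp])
  finally show ?thesis by simp
qed

text \<open>A harmonic \<open>u\<close> on a disc is the real part of a holomorphic \<open>f\<close>, up to a constant: its gradient is
  conjugate to a holomorphic function, and \<open>f\<close> is a primitive of that. The maximum modulus principle
  for \<open>exp f\<close> then applies.\<close>

lemma harmonic_maximum_principle:
  fixes u :: "complex \<Rightarrow> real"
  assumes u: "smooth_on (ball z r) u" and harm: "\<And>x. x \<in> ball z r \<Longrightarrow> laplacian u x = 0"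
    and max: "\<And>x. x \<in> ball z r \<Longrightarrow> u x \<le> u z" and x: "x \<in> ball z r"
  shows "u x = u z"
proof -
  let ?B = "ball z r"
  define g where "g x = Complex (fderiv u x 1) (- fderiv u x \<i>)" for x
  have zB: "z \<in> ?B" using x by (metis ball_trivial ball_empty centre_in_ball empty_iff linorder_not_le)
  have du: "u differentiable at y" "(\<lambda>x. fderiv u x w) differentiable at y" if "y \<in> ?B" for y w
    using smooth_on_differentiable[OF u open_ball that] smooth_on_differentiable[OF smooth_on_fderiv[OF u] open_ball that] .
  have g: "(g has_field_derivative Complex (fderiv (\<lambda>x. fderiv u x 1) y 1) (- fderiv (\<lambda>x. fderiv u x \<i>) y 1)) (at y)"
    if y: "y \<in> ?B" for y
  proof -
    let ?D = "\<lambda>w. fderiv (\<lambda>x. fderiv u x w) y"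
    have "((\<lambda>x. complex_of_real (fderiv u x 1) - \<i> * complex_of_real (fderiv u x \<i>)) has_derivative
        (\<lambda>h. complex_of_real (?D 1 h) - \<i> * complex_of_real (?D \<i> h))) (at y)"
      by (intro has_derivative_diff has_derivative_mult_right has_derivative_of_real
          du(2)[OF y, unfolded frechet_derivative_works])
    moreover have "(\<lambda>x. complex_of_real (fderiv u x 1) - \<i> * complex_of_real (fderiv u x \<i>)) = g"
      by (simp add: g_def complex_eq_iff fun_eq_iff)
    moreover have "complex_of_real (?D 1 h) - \<i> * complex_of_real (?D \<i> h) = Complex (?D 1 1) (- ?D \<i> 1) * h" for h
    proof -
      have "?D 1 \<i> = ?D \<i> 1" by (rule second_fderiv_commute[OF open_ball u y])
      moreover have "?D \<i> \<i> = - ?D 1 1" using harm[OF y] by (simp add: laplacian_def)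
      ultimately show ?thesis
        using fderiv_expansion[OF du(2)[OF y], of 1 h] fderiv_expansion[OF du(2)[OF y], of \<i> h]
        by (simp add: complex_eq_iff mult.commute)
    qed
    ultimately show ?thesis by (simp add: has_field_derivative_def)
  qed
  then have "g holomorphic_on ?B"
    unfolding holomorphic_on_open[OF open_ball] by blast
  then obtain f where f: "\<And>x. x \<in> ?B \<Longrightarrow> (f has_field_derivative g x) (at x within ?B)"
    using holomorphic_convex_primitive'[OF convex_ball open_ball] by blast
  then have f: "(f has_field_derivative g x) (at x)" if "x \<in> ?B" for x
    using that at_within_open[OF that open_ball] by metis
  have "\<exists>k. \<forall>x\<in>?B. u x - Re (f x) = k"
  proof (rule has_derivative_zero_constant[OF convex_ball])
    fix y assume y: "y \<in> ?B"
    have "((\<lambda>x. u x - Re (f x)) has_derivative (\<lambda>h. fderiv u y h - Re (g y * h))) (at y)"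
      by (intro has_derivative_diff has_derivative_Re du(1)[OF y, unfolded frechet_derivative_works]
          f[OF y, unfolded has_field_derivative_def])
    moreover have "fderiv u y h - Re (g y * h) = 0" for h
      using fderiv_expansion[OF du(1)[OF y], of h] by (simp add: g_def mult.commute)
    ultimately show "((\<lambda>x. u x - Re (f x)) has_derivative (\<lambda>h. 0)) (at y within ?B)"
      using has_derivative_at_withinI by force
  qed
  then obtain k where k: "\<And>x. x \<in> ?B \<Longrightarrow> Re (f x) = u x - k" by (force simp: algebra_simps)
  have "f holomorphic_on ?B"
    unfolding holomorphic_on_open[OF open_ball] using f by blast
  then have "(\<lambda>x. exp (f x)) holomorphic_on ?B" by (intro holomorphic_intros)
  then have "(\<lambda>x. exp (f x)) constant_on ?B"
  proof (rule maximum_modulus_principle[OF _ open_ball connected_ball open_ball subset_refl zB])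
    show "cmod (exp (f y)) \<le> cmod (exp (f z))" if "y \<in> ?B" for y
      using max[OF that] by (simp add: k[OF that] k[OF zB])
  qed
  then have "exp (f x) = exp (f z)" using x zB by (auto simp: constant_on_def)
  then have "cmod (exp (f x)) = cmod (exp (f z))" by simp
  then show ?thesis by (simp add: k[OF x] k[OF zB])
qed

section \<open>From charts to the surface\<close>

lemma chart_inv:
  assumes "is_chart c" "x \<in> fst c"
  shows "inv_into (fst c) (snd c) (snd c x) = x"
  using assms homeomorphism_apply1 unfolding is_chart_def by blast

lemma chart_image_open:
  assumes c: "is_chart c" and O: "open O'"
  shows "open (snd c ` (fst c \<inter> O'))"
proof -
  have h: "homeomorphism (fst c) (snd c ` fst c) (snd c) (inv_into (fst c) (snd c))"
    and o: "open (fst c)" "open (snd c ` fst c)" using c by (auto simp: is_chart_def)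
  have "openin (top_of_set (fst c)) (fst c \<inter> O')" using O by (rule openin_open_Int)
  then have "openin (top_of_set (snd c ` fst c)) (snd c ` (fst c \<inter> O'))"
    by (rule homeomorphism_imp_open_map[OF h])
  then show ?thesis using o(2) openin_open_eq by blast
qed

lemma chart_preimage_open:
  assumes c: "is_chart c" and B: "open B"
  shows "open (fst c \<inter> snd c -` B)"
proof (rule continuous_open_preimage[OF _ _ B])
  show "open (fst c)" using c by (simp add: is_chart_def)
  show "continuous_on (fst c) (snd c)" using c homeomorphism_cont1 unfolding is_chart_def by blast
qed

lemma rep_domE:
  assumes "y \<in> rep_dom c d h" "is_chart c"
  obtains x where "x \<in> fst c" "h x \<in> fst d" "y = snd c x" "local_rep c d h y = snd d (h x)"
  using assms chart_inv[OF assms(2)] unfolding rep_dom_def local_rep_def by auto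

lemma local_rep_apply: "is_chart c \<Longrightarrow> x \<in> fst c \<Longrightarrow> local_rep c d h (snd c x) = snd d (h x)"
  by (simp add: local_rep_def chart_inv)

lemma in_rep_dom: "x \<in> fst c \<Longrightarrow> h x \<in> fst d \<Longrightarrow> snd c x \<in> rep_dom c d h"
  by (auto simp: rep_dom_def)

text \<open>The splitting of the differential is natural: a change of chart of the source multiplies \<open>F10\<close> by the
  derivative \<open>\<zeta>\<close> and \<open>F01\<close> by its conjugate, and one of the target acts by a complex linear isometry.\<close>

lemma energies_transform:
  assumes P: "conformal_patch V G U F" and P': "conformal_patch V' G' U' F'"
    and z: "z \<in> U" and z': "z' \<in> U'"
    and dF: "\<And>v. fderiv F' z' v = t (fderiv F z (\<zeta> * v))"
    and t: "complex_linear J J t" and G: "\<And>v w. G' (F' z') (t v) (t w) = G (F z) v w"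
  shows "conformal_patch.e10 G' F' z' = (cmod \<zeta>)\<^sup>2 * conformal_patch.e10 G F z"
    "conformal_patch.e01 G' F' z' = (cmod \<zeta>)\<^sup>2 * conformal_patch.e01 G F z"
    "conformal_patch.conf G' F' z' = (cmod \<zeta>)\<^sup>2 * conformal_patch.conf G F z"
proof -
  interpret P: conformal_patch V G U F by (rule P)
  interpret P': conformal_patch V' G' U' F' by (rule P')
  note p = P.F_in_V[OF z]
  have tl: "linear t" "\<And>v. t (J v) = J (t v)" using t by (auto simp: complex_linear_def)
  have Fx: "P'.Fx z' = t (\<zeta> *s P.F10 z + cnj \<zeta> *s P.F01 z)"
    using dF[of 1] P.fderiv_F_complex[OF z, of \<zeta>] by simp
  have Fy: "P'.Fy z' = t (J (\<zeta> *s P.F10 z - cnj \<zeta> *s P.F01 z))"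
  proof -
    have "(\<zeta> * \<i>) *s P.F10 z + cnj (\<zeta> * \<i>) *s P.F01 z = J (\<zeta> *s P.F10 z - cnj \<zeta> *s P.F01 z)"
      by (simp add: vec_eq_iff algebra_simps)
    then show ?thesis using dF[of \<i>] P.fderiv_F_complex[OF z, of "\<zeta> * \<i>"] by simp
  qed
  have "P'.F10 z' = t ((1/2) *\<^sub>R (\<zeta> *s P.F10 z + cnj \<zeta> *s P.F01 z - J (J (\<zeta> *s P.F10 z - cnj \<zeta> *s P.F01 z))))"
    unfolding P'.F10_def Fx Fy by (simp only: tl(2) linear_diff[OF tl(1)] linear_scale[OF tl(1)])
  also have "(1/2) *\<^sub>R (\<zeta> *s P.F10 z + cnj \<zeta> *s P.F01 z - J (J (\<zeta> *s P.F10 z - cnj \<zeta> *s P.F01 z))) = \<zeta> *s P.F10 z"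
    by (simp add: vec_eq_iff complex_eq_iff)
  finally have F10: "P'.F10 z' = t (\<zeta> *s P.F10 z)" .
  have "P'.F01 z' = t ((1/2) *\<^sub>R (\<zeta> *s P.F10 z + cnj \<zeta> *s P.F01 z + J (J (\<zeta> *s P.F10 z - cnj \<zeta> *s P.F01 z))))"
    unfolding P'.F01_def Fx Fy by (simp only: tl(2) linear_add[OF tl(1)] linear_scale[OF tl(1)])
  also have "(1/2) *\<^sub>R (\<zeta> *s P.F10 z + cnj \<zeta> *s P.F01 z + J (J (\<zeta> *s P.F10 z - cnj \<zeta> *s P.F01 z))) = cnj \<zeta> *s P.F01 z"
    by (simp add: vec_eq_iff complex_eq_iff)
  finally have F01: "P'.F01 z' = t (cnj \<zeta> *s P.F01 z)" .
  have sc: "G (F z) (l *s v) (l *s v) = (cmod l)\<^sup>2 * G (F z) v v" for l v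
    unfolding complex_scale_real[of l v] cmod_power2
    using P.G_self_J[OF p, of v] P.sym_G[OF p, of "J v" v]
    by (simp add: bilinear_simps[OF P.bilinear_G[OF p]] P.G_J_J[OF p] power2_eq_square algebra_simps)
  show 1: "P'.e10 z' = (cmod \<zeta>)\<^sup>2 * P.e10 z" "P'.e01 z' = (cmod \<zeta>)\<^sup>2 * P.e01 z"
    unfolding P'.e10_def P'.e01_def F10 F01 G sc P.e10_def P.e01_def by simp_all
  show "P'.conf z' = (cmod \<zeta>)\<^sup>2 * P.conf z"
    unfolding P'.conf_eq[OF z'] P.conf_eq[OF z] 1 by (simp add: algebra_simps)
qed

locale chern_minimal_immersion =
  fixes S :: "('s::{t2_space,second_countable_topology}, complex) chart set"
    and A :: "('m::{t2_space,second_countable_topology}, complex ^ 2) chart set"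
    and g :: "'m hmetric" and f :: "'s \<Rightarrow> 'm"
  assumes herm: "hermitian_surface A g" and riem: "riemann_surface S"
    and imm: "conformal_immersion S A g f" and cmin: "chern_minimal S A g f"
begin

lemma charts: "c \<in> S \<Longrightarrow> is_chart c" "d \<in> A \<Longrightarrow> is_chart d"
  using herm riem by (auto simp: hermitian_surface_def complex_surface_def riemann_surface_def atlas_def)

lemma continuous_f: "continuous_on UNIV f"
  using imm by (simp add: conformal_immersion_def)

lemma open_f_preimage: "open B \<Longrightarrow> open (f -` B)"
  using continuous_f by (simp add: continuous_on_open_vimage[OF open_UNIV])

lemma charts_at:
  obtains c d where "c \<in> S" "d \<in> A" "x \<in> fst c" "f x \<in> fst d"
proof -
  have "x \<in> (\<Union>c\<in>S. fst c)" "f x \<in> (\<Union>d\<in>A. fst d)"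
    using herm riem by (auto simp: hermitian_surface_def complex_surface_def riemann_surface_def atlas_def)
  then show ?thesis using that by blast
qed

lemma patch:
  assumes c: "c \<in> S" and d: "d \<in> A"
  shows "chern_patch (snd d ` fst d) (g d) (rep_dom c d f) (local_rep c d f)"
proof -
  have hm: "smooth_on (snd d ` fst d) (\<lambda>p. g d p v w)"
      "p \<in> snd d ` fst d \<Longrightarrow> bilinear (g d p)" "p \<in> snd d ` fst d \<Longrightarrow> g d p v w = g d p w v"
      "p \<in> snd d ` fst d \<Longrightarrow> v \<noteq> 0 \<Longrightarrow> g d p v v > 0" "p \<in> snd d ` fst d \<Longrightarrow> g d p (J v) (J w) = g d p v w"
    for p v w
    using herm d unfolding hermitian_surface_def hermitian_metric_def by blast+
  have o: "open (fst d)" "open (snd d ` fst d)" using charts(2)[OF d] by (auto simp: is_chart_def)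
  show ?thesis
  proof
    show "open (snd d ` fst d)" by (rule o)
    show "open (rep_dom c d f)"
      unfolding rep_dom_def by (rule chart_image_open[OF charts(1)[OF c] open_f_preimage[OF o(1)]])
    show "local_rep c d f ` rep_dom c d f \<subseteq> snd d ` fst d"
      using charts(1)[OF c] by (auto elim!: rep_domE)
    show "smooth_on (rep_dom c d f) (local_rep c d f)"
      using imm c d by (auto simp: conformal_immersion_def)
    show "\<exists>r>0. \<forall>v w. pullback_metric (g d) (local_rep c d f) z v w = r * (v \<bullet> w)" if "z \<in> rep_dom c d f" for z
      using imm c d that unfolding conformal_immersion_def by blast
    show "nabla_df (g d) (chern_connection (g d)) (local_rep c d f) z e e +
        nabla_df (g d) (chern_connection (g d)) (local_rep c d f) z e' e' = 0"
      if "z \<in> rep_dom c d f" "orthonormal_pair (pullback_metric (g d) (local_rep c d f) z) e e'" for z e e'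
      using cmin c d that unfolding chern_minimal_def by blast
  qed (fact hm)+
qed

abbreviation e10 where "e10 c d \<equiv> conformal_patch.e10 (g d) (local_rep c d f)"
abbreviation e01 where "e01 c d \<equiv> conformal_patch.e01 (g d) (local_rep c d f)"
abbreviation conf where "conf c d \<equiv> conformal_patch.conf (g d) (local_rep c d f)"
abbreviation q where "q c d \<equiv> conformal_patch.q (g d) (local_rep c d f)"
abbreviation real_set where "real_set c d \<equiv> conformal_patch.R (g d) (rep_dom c d f) (local_rep c d f)"

lemma change_of_charts:
  assumes c: "c \<in> S" "d \<in> A" and c': "c' \<in> S" "d' \<in> A"
    and x: "x \<in> fst c" "f x \<in> fst d" "x \<in> fst c'" "f x \<in> fst d'"
  obtains W \<phi> where "open W" "snd c' x \<in> W" "W \<subseteq> rep_dom c' d' f" "\<phi> holomorphic_on W"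
    "\<phi> (snd c' x) = snd c x" "\<phi> ` W \<subseteq> rep_dom c d f"
    "\<And>y. y \<in> W \<Longrightarrow> e10 c' d' y = (cmod (deriv \<phi> y))\<^sup>2 * e10 c d (\<phi> y)"
    "\<And>y. y \<in> W \<Longrightarrow> e01 c' d' y = (cmod (deriv \<phi> y))\<^sup>2 * e01 c d (\<phi> y)"
    "\<And>y. y \<in> W \<Longrightarrow> conf c' d' y = (cmod (deriv \<phi> y))\<^sup>2 * conf c d (\<phi> y)"
proof -
  note ch = charts(1)[OF c(1)] charts(2)[OF c(2)] charts(1)[OF c'(1)] charts(2)[OF c'(2)]
  interpret P: chern_patch "snd d ` fst d" "g d" "rep_dom c d f" "local_rep c d f" by (rule patch[OF c])
  interpret P': chern_patch "snd d' ` fst d'" "g d'" "rep_dom c' d' f" "local_rep c' d' f" by (rule patch[OF c'])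
  define W where "W = snd c' ` (fst c' \<inter> (fst c \<inter> f -` (fst d \<inter> fst d')))"
  define \<phi> where "\<phi> = local_rep c' c id"
  define \<tau> where "\<tau> = local_rep d d' id"
  have o: "open (fst c)" "open (fst d)" "open (fst d')" using ch by (auto simp: is_chart_def)
  have oW: "open W"
    unfolding W_def using o by (intro chart_image_open[OF ch(3)] open_Int open_f_preimage)
  have WE: "\<exists>x. x \<in> fst c \<and> x \<in> fst c' \<and> f x \<in> fst d \<and> f x \<in> fst d' \<and> y = snd c' x \<and> \<phi> y = snd c x"
    if "y \<in> W" for y
    using that local_rep_apply[OF ch(3), of _ c id] unfolding W_def \<phi>_def by auto
  have Wsub: "W \<subseteq> rep_dom c' c id" "W \<subseteq> rep_dom c' d' f" "\<phi> ` W \<subseteq> rep_dom c d f"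
    using WE by (fastforce simp: rep_dom_def)+
  have hol: "\<phi> holomorphic_on W"
    using riem c c' holomorphic_on_subset[OF _ Wsub(1)] unfolding riemann_surface_def \<phi>_def by blast
  have F': "local_rep c' d' f y = \<tau> (local_rep c d f (\<phi> y))" "local_rep c d f (\<phi> y) \<in> rep_dom d d' id"
    if "y \<in> W" for y
    using WE[OF that] local_rep_apply[OF ch(1), of _ d f] local_rep_apply[OF ch(3), of _ d' f] local_rep_apply[OF ch(2), of _ d' id]
    by (auto simp: \<tau>_def rep_dom_def)
  have tr: "conformal_patch.e10 (g d') (local_rep c' d' f) y = (cmod (deriv \<phi> y))\<^sup>2 * P.e10 (\<phi> y)"
      "conformal_patch.e01 (g d') (local_rep c' d' f) y = (cmod (deriv \<phi> y))\<^sup>2 * P.e01 (\<phi> y)"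
      "conformal_patch.conf (g d') (local_rep c' d' f) y = (cmod (deriv \<phi> y))\<^sup>2 * P.conf (\<phi> y)"
    if y: "y \<in> W" for y
  proof -
    let ?p = "local_rep c d f (\<phi> y)"
    have yU: "\<phi> y \<in> rep_dom c d f" "y \<in> rep_dom c' d' f" using Wsub y by auto
    have \<tau>: "\<tau> differentiable at ?p" "complex_linear J J (fderiv \<tau> ?p)"
      using herm c c' F'(2)[OF y] unfolding hermitian_surface_def complex_surface_def \<tau>_def by blast+
    have g: "g d' (local_rep c' d' f y) (fderiv \<tau> ?p v) (fderiv \<tau> ?p w) = g d ?p v w" for v w
      using herm c c' F'(2)[OF y] unfolding F'(1)[OF y] hermitian_surface_def hermitian_metric_def \<tau>_def by metis
    have "fderiv (local_rep c' d' f) y v = fderiv (\<lambda>y. \<tau> (local_rep c d f (\<phi> y))) y v" for v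
      by (rule fun_cong[OF fderiv_cong_open[OF oW y F'(1)]])
    moreover have d\<phi>: "\<phi> differentiable at y" by (rule differentiable_holomorphic[OF hol oW y])
    have dF: "(\<lambda>y. local_rep c d f (\<phi> y)) differentiable at y"
      using differentiable_chain_at[OF d\<phi> P.differentiable_F[OF yU(1)]] by (simp add: o_def)
    have "fderiv (\<lambda>y. \<tau> (local_rep c d f (\<phi> y))) y v = fderiv \<tau> ?p (fderiv (local_rep c d f) (\<phi> y) (deriv \<phi> y * v))" for v
      using fderiv_compose[OF dF \<tau>(1), of v] fderiv_compose[OF d\<phi> P.differentiable_F[OF yU(1)], of v]
        fderiv_holomorphic[OF hol oW y, of v] by simp
    ultimately have dF': "fderiv (local_rep c' d' f) y v = fderiv \<tau> ?p (fderiv (local_rep c d f) (\<phi> y) (deriv \<phi> y * v))" for v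
      by simp
    show "conformal_patch.e10 (g d') (local_rep c' d' f) y = (cmod (deriv \<phi> y))\<^sup>2 * P.e10 (\<phi> y)"
      "conformal_patch.e01 (g d') (local_rep c' d' f) y = (cmod (deriv \<phi> y))\<^sup>2 * P.e01 (\<phi> y)"
      "conformal_patch.conf (g d') (local_rep c' d' f) y = (cmod (deriv \<phi> y))\<^sup>2 * P.conf (\<phi> y)"
      using energies_transform[OF P.conformal_patch_axioms P'.conformal_patch_axioms yU dF' \<tau>(2) g] .
  qed
  show ?thesis
  proof (rule that[OF oW _ Wsub(2) hol _ Wsub(3) tr])
    show "snd c' x \<in> W" using x by (auto simp: W_def)
    show "\<phi> (snd c' x) = snd c x" using x local_rep_apply[OF ch(3), of x c id] by (simp add: \<phi>_def)
  qed
qed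

text \<open>The expressions for the curvatures and for the Kaehler angle do not depend on the charts, since
  \<open>conf\<close> and \<open>q\<close> transform as densities and their Laplacians accordingly.\<close>

lemma change_of_charts_invariants:
  assumes c: "c \<in> S" "d \<in> A" and c': "c' \<in> S" "d' \<in> A"
    and x: "x \<in> fst c" "f x \<in> fst d" "x \<in> fst c'" "f x \<in> fst d'"
  defines "z \<equiv> snd c x" and "z' \<equiv> snd c' x"
  shows "laplacian (\<lambda>z. ln (conf c' d' z)) z' / conf c' d' z' = laplacian (\<lambda>z. ln (conf c d z)) z / conf c d z"
    "(e10 c' d' z' - e01 c' d' z') / conf c' d' z' = (e10 c d z - e01 c d z) / conf c d z"
    "z \<in> real_set c d \<Longrightarrow> z' \<in> real_set c' d'"
    "z \<in> real_set c d \<Longrightarrow>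
      laplacian (\<lambda>z. ln (q c' d' z)) z' / conf c' d' z' = laplacian (\<lambda>z. ln (q c d z)) z / conf c d z"
proof -
  interpret P: chern_patch "snd d ` fst d" "g d" "rep_dom c d f" "local_rep c d f" by (rule patch[OF c])
  interpret P': chern_patch "snd d' ` fst d'" "g d'" "rep_dom c' d' f" "local_rep c' d' f" by (rule patch[OF c'])
  obtain W \<phi> where W: "open W" "z' \<in> W" "W \<subseteq> rep_dom c' d' f" "\<phi> holomorphic_on W"
    "\<phi> z' = z" "\<phi> ` W \<subseteq> rep_dom c d f"
    and e: "\<And>y. y \<in> W \<Longrightarrow> P'.e10 y = (cmod (deriv \<phi> y))\<^sup>2 * P.e10 (\<phi> y)"
      "\<And>y. y \<in> W \<Longrightarrow> P'.e01 y = (cmod (deriv \<phi> y))\<^sup>2 * P.e01 (\<phi> y)"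
      "\<And>y. y \<in> W \<Longrightarrow> P'.conf y = (cmod (deriv \<phi> y))\<^sup>2 * P.conf (\<phi> y)"
    using change_of_charts[OF c c' x] unfolding z_def z'_def by blast
  have nz: "deriv \<phi> y \<noteq> 0" if "y \<in> W" for y
    using e(3)[OF that] P'.conf_pos[of y] W(3) that by auto
  note nz' = nz[OF W(2)]
  have z'U: "z' \<in> rep_dom c' d' f" using W by auto
  have cz: "P'.conf z' = (cmod (deriv \<phi> z'))\<^sup>2 * P.conf z" using e(3)[OF W(2)] W(5) by simp
  have "laplacian (\<lambda>z. ln (P'.conf z)) z' = (cmod (deriv \<phi> z'))\<^sup>2 * laplacian (\<lambda>z. ln (P.conf z)) (\<phi> z')"
    by (rule laplacian_ln_holomorphic_change[OF W(1,2) P.open_U W(4,6) P.smooth_conf P.conf_pos nz' e(3)])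
  then show "laplacian (\<lambda>z. ln (P'.conf z)) z' / P'.conf z' = laplacian (\<lambda>z. ln (P.conf z)) z / P.conf z"
    unfolding cz W(5) using nz' by simp
  show "(P'.e10 z' - P'.e01 z') / P'.conf z' = (P.e10 z - P.e01 z) / P.conf z"
    unfolding cz e(1)[OF W(2)] e(2)[OF W(2)] W(5) using nz' by (simp flip: right_diff_distrib)
  have R: "y \<in> P'.R \<longleftrightarrow> \<phi> y \<in> P.R" if "y \<in> W" for y
    using that W(3,6) nz[OF that] by (auto simp: P.R_def P'.R_def e zero_less_mult_iff)
  then show "z \<in> P.R \<Longrightarrow> z' \<in> P'.R" using W(2,5) by simp
  assume zR: "z \<in> P.R"
  define W' where "W' = W \<inter> P'.R"
  have W': "open W'" "z' \<in> W'" "W' \<subseteq> W" "\<phi> ` W' \<subseteq> P.R"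
    using W zR R P'.open_R by (auto simp: W'_def)
  have qe: "P'.q y = (cmod (deriv \<phi> y))\<^sup>2 * P.q (\<phi> y)" if "y \<in> W'" for y
  proof -
    have yW: "y \<in> W" using that W' by auto
    then have pos: "P.conf (\<phi> y) > 0" using P.conf_pos W(6) by blast
    show ?thesis
      unfolding P'.q_def P.q_def e(1)[OF yW] e(2)[OF yW] e(3)[OF yW] using nz[OF yW] pos
      by (simp add: powr_minus field_simps)
  qed
  have "laplacian (\<lambda>z. ln (P'.q z)) z' = (cmod (deriv \<phi> z'))\<^sup>2 * laplacian (\<lambda>z. ln (P.q z)) (\<phi> z')"
    by (rule laplacian_ln_holomorphic_change[OF W'(1,2) P.open_R holomorphic_on_subset[OF W(4) W'(3)] W'(4)
          P.smooth_q P.R_pos(5) nz' qe])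
  then show "laplacian (\<lambda>z. ln (P'.q z)) z' / P'.conf z' = laplacian (\<lambda>z. ln (P.q z)) z / P.conf z"
    unfolding cz W(5) using nz' by simp
qed

text \<open>All three quantities of the theorem are descriptions over all pairs of charts, so that besides a
  value in one pair of charts their evaluation needs agreement between the pairs.\<close>

lemma the_chart_value:
  assumes "c \<in> S" "d \<in> A" "x \<in> fst c" "f x \<in> fst d"
    and "\<And>c' d' k. c' \<in> S \<Longrightarrow> d' \<in> A \<Longrightarrow> x \<in> fst c' \<Longrightarrow> f x \<in> fst d' \<Longrightarrow> H c' d' k \<longleftrightarrow> k = v"
  shows "(THE k. \<exists>c\<in>S. \<exists>d\<in>A. x \<in> fst c \<and> f x \<in> fst d \<and> H c d k) = v"
  by (rule the_equality) (use assms in blast)+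

lemma gauss_curvature_eq:
  assumes c: "c \<in> S" "d \<in> A" and x: "x \<in> fst c" "f x \<in> fst d"
  shows "gauss_curvature S A g f x = - (laplacian (\<lambda>z. ln (conf c d z)) (snd c x) / conf c d (snd c x)) / 2"
  unfolding gauss_curvature_def
proof (rule the_chart_value[OF c x])
  fix c' d' k assume c': "c' \<in> S" "d' \<in> A" "x \<in> fst c'" "f x \<in> fst d'"
  interpret P': chern_patch "snd d' ` fst d'" "g d'" "rep_dom c' d' f" "local_rep c' d' f"
    by (rule patch[OF c'(1,2)])
  show "has_gauss_curvature (pullback_metric (g d') (local_rep c' d' f)) (snd c' x) k \<longleftrightarrow>
      k = - (laplacian (\<lambda>z. ln (conf c d z)) (snd c x) / conf c d (snd c x)) / 2"
    unfolding P'.induced.has_gauss_curvature_iff[OF in_rep_dom[where h = f, OF c'(3,4)]]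
      change_of_charts_invariants(1)[OF c c'(1,2) x c'(3,4), symmetric]
    by (simp add: mult.commute)
qed

lemma normal_curvature_eq:
  assumes c: "c \<in> S" "d \<in> A" and x: "x \<in> fst c" "f x \<in> fst d" and R: "snd c x \<in> real_set c d"
  shows "normal_curvature S A g f x = (laplacian (\<lambda>z. ln (q c d z)) (snd c x) / conf c d (snd c x)) / 2"
  unfolding normal_curvature_def
proof (rule the_chart_value[OF c x])
  fix c' d' k assume c': "c' \<in> S" "d' \<in> A" "x \<in> fst c'" "f x \<in> fst d'"
  interpret P': chern_patch "snd d' ` fst d'" "g d'" "rep_dom c' d' f" "local_rep c' d' f"
    by (rule patch[OF c'(1,2)])
  show "has_normal_curvature (g d') (local_rep c' d' f) (snd c' x) k \<longleftrightarrow>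
      k = (laplacian (\<lambda>z. ln (q c d z)) (snd c x) / conf c d (snd c x)) / 2"
    unfolding P'.has_normal_curvature_iff[OF change_of_charts_invariants(3)[OF c c'(1,2) x c'(3,4) R]]
      change_of_charts_invariants(4)[OF c c'(1,2) x c'(3,4) R, symmetric]
    by (simp add: mult.commute)
qed

lemma kahler_angle_eq:
  assumes c: "c \<in> S" "d \<in> A" and x: "x \<in> fst c" "f x \<in> fst d"
  shows "kahler_angle S A g f x = arccos ((e10 c d (snd c x) - e01 c d (snd c x)) / conf c d (snd c x))"
  unfolding kahler_angle_def
proof (rule the_chart_value[OF c x])
  fix c' d' k assume c': "c' \<in> S" "d' \<in> A" "x \<in> fst c'" "f x \<in> fst d'"
  interpret P': chern_patch "snd d' ` fst d'" "g d'" "rep_dom c' d' f" "local_rep c' d' f"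
    by (rule patch[OF c'(1,2)])
  show "has_kahler_angle (g d') (local_rep c' d' f) (snd c' x) k \<longleftrightarrow>
      k = arccos ((e10 c d (snd c x) - e01 c d (snd c x)) / conf c d (snd c x))"
    unfolding P'.has_kahler_angle_iff[OF in_rep_dom[where h = f, OF c'(3,4)]]
      change_of_charts_invariants(2)[OF c c'(1,2) x c'(3,4)] ..
qed

section \<open>The Kaehler angle function on the surface\<close>

definition kcos :: "'s \<Rightarrow> real" where "kcos x = cos (kahler_angle S A g f x)"

lemma kcos_chart:
  assumes c: "c \<in> S" "d \<in> A" and x: "x \<in> fst c" "f x \<in> fst d"
  shows "kcos x = (e10 c d (snd c x) - e01 c d (snd c x)) / conf c d (snd c x)"
    "kahler_angle S A g f x = arccos (kcos x)" "(kcos x)\<^sup>2 \<le> 1"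
    "1 - (kcos x)\<^sup>2 = 4 * (e10 c d (snd c x) * e01 c d (snd c x)) / (conf c d (snd c x))\<^sup>2"
    "snd c x \<in> real_set c d \<longleftrightarrow> (kcos x)\<^sup>2 < 1"
proof -
  interpret P: chern_patch "snd d ` fst d" "g d" "rep_dom c d f" "local_rep c d f" by (rule patch[OF c])
  let ?z = "snd c x"
  have z: "?z \<in> rep_dom c d f" by (rule in_rep_dom[where h = f, OF x])
  have pos: "P.e10 ?z \<ge> 0" "P.e01 ?z \<ge> 0" "P.conf ?z > 0" "P.conf ?z = P.e10 ?z + P.e01 ?z"
    using P.e_nonneg[OF z] P.conf_pos[OF z] P.conf_eq[OF z] by auto
  have "- 1 \<le> (P.e10 ?z - P.e01 ?z) / P.conf ?z" "(P.e10 ?z - P.e01 ?z) / P.conf ?z \<le> 1"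
    using pos by (auto simp: field_simps)
  then show k: "kcos x = (P.e10 ?z - P.e01 ?z) / P.conf ?z"
    unfolding kcos_def kahler_angle_eq[OF c x] by (rule cos_arccos)
  show "kahler_angle S A g f x = arccos (kcos x)"
    unfolding k by (rule kahler_angle_eq[OF c x])
  show m: "1 - (kcos x)\<^sup>2 = 4 * (P.e10 ?z * P.e01 ?z) / (P.conf ?z)\<^sup>2"
  proof -
    have "(P.conf ?z)\<^sup>2 - (P.e10 ?z - P.e01 ?z)\<^sup>2 = 4 * (P.e10 ?z * P.e01 ?z)"
      unfolding pos(4) by (simp add: power2_eq_square algebra_simps)
    moreover have "1 - (kcos x)\<^sup>2 = ((P.conf ?z)\<^sup>2 - (P.e10 ?z - P.e01 ?z)\<^sup>2) / (P.conf ?z)\<^sup>2"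
      unfolding k power_divide using pos(3) by (simp add: diff_divide_distrib)
    ultimately show ?thesis by simp
  qed
  have "4 * (P.e10 ?z * P.e01 ?z) / (P.conf ?z)\<^sup>2 \<ge> 0" using pos by simp
  then show "(kcos x)\<^sup>2 \<le> 1" using m by simp
  have "(kcos x)\<^sup>2 < 1 \<longleftrightarrow> 4 * (P.e10 ?z * P.e01 ?z) / (P.conf ?z)\<^sup>2 > 0" using m by linarith
  also have "\<dots> \<longleftrightarrow> 0 < P.e10 ?z * P.e01 ?z" using pos(3) by (auto simp: zero_less_divide_iff mult.commute)
  also have "\<dots> \<longleftrightarrow> ?z \<in> P.R" using pos z by (auto simp: P.R_def zero_less_mult_iff)
  finally show "?z \<in> P.R \<longleftrightarrow> (kcos x)\<^sup>2 < 1" by simp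
qed

lemma real_point_iff: "real_point S A g f x \<longleftrightarrow> (kcos x)\<^sup>2 < 1"
proof -
  obtain c d where c: "c \<in> S" "d \<in> A" and x: "x \<in> fst c" "f x \<in> fst d" using charts_at .
  note k = kcos_chart(2,3)[OF c x]
  have b: "- 1 \<le> kcos x" "kcos x \<le> 1" using k(2) abs_square_le_1[of "kcos x"] by (auto simp: abs_le_iff)
  have "0 < arccos (kcos x) \<longleftrightarrow> kcos x \<noteq> 1"
    using arccos_lbound[OF b] cos_arccos[OF b] by (metis arccos_1 cos_zero less_le)
  moreover have "arccos (kcos x) < pi \<longleftrightarrow> kcos x \<noteq> - 1"
    using arccos_ubound[OF b] cos_arccos[OF b] by (metis arccos_minus_1 cos_pi less_le)
  moreover have "(kcos x)\<^sup>2 < 1 \<longleftrightarrow> kcos x \<noteq> 1 \<and> kcos x \<noteq> - 1"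
    using k(2) by (auto simp: less_le power2_eq_1_iff)
  ultimately show ?thesis unfolding real_point_def k(1) by blast
qed

lemma continuous_kcos: "continuous_on UNIV kcos"
proof -
  let ?I = "{(c, d). c \<in> S \<and> d \<in> A}" and ?O = "\<lambda>(c, d). fst c \<inter> f -` fst d"
  have "continuous_on (\<Union>i\<in>?I. ?O i) kcos"
  proof (rule continuous_on_open_UN)
    fix i assume "i \<in> ?I"
    then obtain c d where i: "i = (c, d)" and c: "c \<in> S" "d \<in> A" by auto
    interpret P: chern_patch "snd d ` fst d" "g d" "rep_dom c d f" "local_rep c d f" by (rule patch[OF c])
    have o: "open (fst c)" "open (fst d)" using charts c by (auto simp: is_chart_def)
    then show "open (?O i)" using open_f_preimage by (auto simp: i)
    have cc: "continuous_on (fst c) (snd c)"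
      using charts(1)[OF c(1)] homeomorphism_cont1 unfolding is_chart_def by blast
    have "continuous_on (rep_dom c d f) (\<lambda>z. (P.e10 z - P.e01 z) / P.conf z)"
      using P.conf_pos by (intro continuous_on_divide continuous_on_diff smooth_on_continuous_on
          P.smooth_e10 P.smooth_e01 P.smooth_conf) (metis less_irrefl)
    then have "continuous_on (fst c \<inter> f -` fst d) (\<lambda>x. (P.e10 (snd c x) - P.e01 (snd c x)) / P.conf (snd c x))"
      by (rule continuous_on_compose2[OF _ continuous_on_subset[OF cc]]) (auto simp: rep_dom_def)
    then have "continuous_on (fst c \<inter> f -` fst d) kcos"
      by (rule continuous_on_eq) (auto simp: kcos_chart(1)[OF c])
    then show "continuous_on (?O i) kcos" by (simp add: i)
  qed
  moreover have "(\<Union>i\<in>?I. ?O i) = UNIV"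
    using charts_at by (auto simp: set_eq_iff)
  ultimately show ?thesis by simp
qed

lemma curvature_sum_chart:
  assumes c: "c \<in> S" "d \<in> A" and x: "x \<in> fst c" "f x \<in> fst d" and R: "snd c x \<in> real_set c d"
  shows "gauss_curvature S A g f x + normal_curvature S A g f x =
    (laplacian (\<lambda>z. ln (q c d z)) (snd c x) - laplacian (\<lambda>z. ln (conf c d z)) (snd c x)) / (2 * conf c d (snd c x))"
  unfolding gauss_curvature_eq[OF c x] normal_curvature_eq[OF c x R] by (simp add: diff_divide_distrib mult.commute)

lemma connected_surface: "connected (UNIV :: 's set)"
  using riem by (simp add: riemann_surface_def)

text \<open>A continuous function on a connected space whose square is constant cannot change its sign without
  vanishing.\<close>

lemma kcos_constant:
  assumes "\<And>x. (kcos x)\<^sup>2 = C"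
  shows "kcos x = kcos y"
proof (rule ccontr)
  assume ne: "kcos x \<noteq> kcos y"
  have sq: "(kcos x)\<^sup>2 = (kcos y)\<^sup>2" by (simp add: assms)
  then have "kcos x = - kcos y" using ne by (simp add: power2_eq_iff)
  have "connected (range kcos)" by (rule connected_continuous_image[OF continuous_kcos connected_surface])
  moreover have "kcos y \<in> range kcos" "- kcos y \<in> range kcos"
    using rangeI[of kcos x] \<open>kcos x = - kcos y\<close> by simp_all
  then have "\<bar>kcos y\<bar> \<in> range kcos" "- \<bar>kcos y\<bar> \<in> range kcos"
    by (simp_all add: abs_if)
  moreover have "- \<bar>kcos y\<bar> \<le> 0" "0 \<le> \<bar>kcos y\<bar>" by auto
  ultimately have "0 \<in> range kcos" unfolding connected_iff_interval by blast
  then obtain w where "kcos w = 0" by (metis imageE)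
  then have "(kcos y)\<^sup>2 = 0" using assms[of w] assms[of y] by simp
  then show False using \<open>kcos x = - kcos y\<close> ne by simp
qed

lemma kcos_const_imp_curvature_sum_zero:
  assumes real: "\<And>x. (kcos x)\<^sup>2 < 1" and const: "\<And>x y. kcos x = kcos y"
  shows "gauss_curvature S A g f x + normal_curvature S A g f x = 0"
proof -
  obtain c d where c: "c \<in> S" "d \<in> A" and x: "x \<in> fst c" "f x \<in> fst d" using charts_at .
  interpret P: chern_patch "snd d ` fst d" "g d" "rep_dom c d f" "local_rep c d f" by (rule patch[OF c])
  define m where "m = (1 - (kcos x)\<^sup>2) / 4"
  have m: "m > 0" using real[of x] by (simp add: m_def)
  let ?U = "rep_dom c d f"
  have R: "snd c x \<in> P.R" using kcos_chart(5)[OF c x] real by simp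
  have sm: "smooth_on ?U (\<lambda>z. ln (P.conf z))" by (rule smooth_on_ln[OF P.open_U P.smooth_conf P.conf_pos])
  have q: "ln (P.q y) = ln m + ln (P.conf y)" if y: "y \<in> ?U" for y
  proof -
    obtain x' where x': "x' \<in> fst c" "f x' \<in> fst d" "y = snd c x'"
      using rep_domE[OF y charts(1)[OF c(1)]] by metis
    have pos: "P.conf y > 0" by (rule P.conf_pos[OF y])
    have "m = P.e10 y * P.e01 y / (P.conf y)\<^sup>2"
      using kcos_chart(4)[OF c x'(1,2)] const[of x x'] x'(3) by (simp add: m_def)
    then have "P.e10 y * P.e01 y = m * P.conf y * P.conf y" using pos by (simp add: power2_eq_square field_simps)
    then have "P.q y = m * P.conf y" using pos by (simp add: P.q_def powr_minus)
    then show ?thesis using m pos by (simp add: ln_mult)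
  qed
  have U: "snd c x \<in> ?U" by (rule in_rep_dom[where h = f, OF x])
  have "laplacian (\<lambda>z. ln (P.q z)) (snd c x) = laplacian (\<lambda>z. ln m + ln (P.conf z)) (snd c x)"
    by (rule laplacian_cong_open[OF P.open_U U q])
  also have "\<dots> = laplacian (\<lambda>z. ln (P.conf z)) (snd c x)"
    unfolding laplacian_add[OF P.open_U U smooth_on_const sm] laplacian_const by simp
  finally show ?thesis unfolding curvature_sum_chart[OF c x R] by simp
qed

text \<open>Around a maximum point of \<open>sin\<^sup>2 \<alpha>\<close> the function \<open>u = ln (sin\<^sup>2 \<alpha> / 4)\<close> is defined and harmonic,
  because \<open>K + K\<^sup>\<bottom>\<close> is a multiple of its Laplacian.\<close>

lemma minimal_square_set_open:
  assumes K: "\<And>x. gauss_curvature S A g f x + normal_curvature S A g f x = 0"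
    and x: "(kcos x)\<^sup>2 < 1" and min: "\<And>y. (kcos x)\<^sup>2 \<le> (kcos y)\<^sup>2"
  shows "\<exists>B. open B \<and> x \<in> B \<and> (\<forall>y\<in>B. (kcos y)\<^sup>2 = (kcos x)\<^sup>2)"
proof -
  obtain c d where c: "c \<in> S" "d \<in> A" and xc: "x \<in> fst c" "f x \<in> fst d" using charts_at .
  interpret P: chern_patch "snd d ` fst d" "g d" "rep_dom c d f" "local_rep c d f" by (rule patch[OF c])
  let ?z = "snd c x"
  have R: "?z \<in> P.R" using kcos_chart(5)[OF c xc] x by simp
  obtain r where r: "r > 0" "ball ?z r \<subseteq> P.R"
    using P.open_R R by (meson openE)
  define u where "u y = ln (P.q y) + (- ln (P.conf y))" for y
  have sq: "smooth_on P.R (\<lambda>y. ln (P.q y))" by (rule smooth_on_ln[OF P.open_R P.smooth_q P.R_pos(5)])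
  have sc: "smooth_on P.R (\<lambda>y. ln (P.conf y))"
    by (rule smooth_on_ln[OF P.open_R P.smooth_on_R[OF P.smooth_conf] P.R_pos(3)])
  have su: "smooth_on P.R u"
    unfolding u_def by (rule smooth_on_add[OF P.open_R sq smooth_on_minus[OF P.open_R sc]])
  have point: "\<exists>y'. y' \<in> fst c \<and> f y' \<in> fst d \<and> y = snd c y'" if "y \<in> P.R" for y
    using rep_domE[OF P.R_U(1)[OF that] charts(1)[OF c(1)]] by metis
  have u_eq: "u (snd c y) = ln ((1 - (kcos y)\<^sup>2) / 4)" if "y \<in> fst c" "f y \<in> fst d" "snd c y \<in> P.R" for y
  proof -
    note pos = P.R_pos[OF that(3)]
    have "(1 - (kcos y)\<^sup>2) / 4 = P.q (snd c y) / P.conf (snd c y)"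
      unfolding kcos_chart(4)[OF c that(1,2)] P.q_def using pos(3)
      by (simp add: powr_minus power2_eq_square field_simps)
    then show ?thesis using pos by (simp add: u_def ln_div)
  qed
  have harm: "laplacian u y = 0" if yR: "y \<in> P.R" for y
  proof -
    obtain y' where y': "y' \<in> fst c" "f y' \<in> fst d" "y = snd c y'" using point[OF yR] by blast
    have "laplacian u y = laplacian (\<lambda>y. ln (P.q y)) y + laplacian (\<lambda>y. - ln (P.conf y)) y"
      unfolding u_def by (rule laplacian_add[OF P.open_R yR sq smooth_on_minus[OF P.open_R sc]])
    moreover have "laplacian (\<lambda>y. ln (P.conf y)) y + laplacian (\<lambda>y. - ln (P.conf y)) y = 0"
      using laplacian_add[OF P.open_R yR sc smooth_on_minus[OF P.open_R sc]] by (simp add: laplacian_const)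
    moreover have "laplacian (\<lambda>y. ln (P.q y)) y = laplacian (\<lambda>y. ln (P.conf y)) y"
      using curvature_sum_chart[OF c y'(1,2)] K[of y'] yR P.R_pos(3)[OF yR] by (simp add: y'(3))
    ultimately show ?thesis by simp
  qed
  have const: "u y = u ?z" if y: "y \<in> ball ?z r" for y
  proof (rule harmonic_maximum_principle[OF smooth_on_subset[OF su r(2)] _ _ y])
    show "laplacian u w = 0" if "w \<in> ball ?z r" for w using harm that r(2) by blast
    show "u w \<le> u ?z" if "w \<in> ball ?z r" for w
    proof -
      have w: "w \<in> P.R" using that r(2) by blast
      then obtain w' where w': "w' \<in> fst c" "f w' \<in> fst d" "w = snd c w'" using point by blast
      have "(kcos w')\<^sup>2 < 1" using kcos_chart(5)[OF c w'(1,2)] w w'(3) by simp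
      then show ?thesis
        using u_eq[OF w'(1,2)] u_eq[OF xc R] w w'(3) min[of w'] by simp
    qed
  qed
  define B where "B = (fst c \<inter> snd c -` ball ?z r)"
  have "open B" unfolding B_def by (rule chart_preimage_open[OF charts(1)[OF c(1)] open_ball])
  moreover have "x \<in> B" using xc r by (simp add: B_def)
  moreover have "(kcos y)\<^sup>2 = (kcos x)\<^sup>2" if y: "y \<in> B" for y
  proof -
    have yb: "snd c y \<in> ball ?z r" "y \<in> fst c" using y by (auto simp: B_def)
    then have yR: "snd c y \<in> P.R" using r(2) by blast
    then obtain y' where y': "y' \<in> fst c" "f y' \<in> fst d" "snd c y = snd c y'" using point by blast
    have "y = y'" using chart_inv[OF charts(1)[OF c(1)]] yb(2) y'(1,3) by metis
    then have fy: "f y \<in> fst d" using y' by simp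
    have lt: "(kcos y)\<^sup>2 < 1" using kcos_chart(5)[OF c yb(2) fy] yR by simp
    have "ln ((1 - (kcos y)\<^sup>2) / 4) = ln ((1 - (kcos x)\<^sup>2) / 4)"
      using const[OF yb(1)] u_eq[OF yb(2) fy yR] u_eq[OF xc R] by simp
    then show ?thesis using lt x by simp
  qed
  ultimately show ?thesis by blast
qed

lemma holomorphic_if_kcos_1:
  assumes "\<And>x. kcos x = 1" shows "holomorphic_map S A f"
  unfolding holomorphic_map_def
proof (intro ballI)
  fix c d z assume c: "c \<in> S" "d \<in> A" and z: "z \<in> rep_dom c d f"
  interpret P: chern_patch "snd d ` fst d" "g d" "rep_dom c d f" "local_rep c d f" by (rule patch[OF c])
  obtain x where x: "x \<in> fst c" "f x \<in> fst d" "z = snd c x"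
    using rep_domE[OF z charts(1)[OF c(1)]] by metis
  have "P.e01 z = 0"
    using kcos_chart(1)[OF c x(1,2)] assms[of x] P.conf_pos[OF z] P.conf_eq[OF z] x(3) by (simp add: field_simps)
  then have "P.F01 z = 0" by (simp add: P.e_eq_0_iff[OF z])
  then have dF: "fderiv (local_rep c d f) z v = v *s P.F10 z" for v
    using P.fderiv_F_complex[OF z, of v] by simp
  show "complex_linear ((*) \<i>) J (fderiv (local_rep c d f) z)"
    unfolding complex_linear_def
    using linear_fderiv[OF P.differentiable_F[OF z]] by (simp add: dF)
qed

lemma antiholomorphic_if_kcos_minus_1:
  assumes "\<And>x. kcos x = - 1" shows "antiholomorphic_map S A f"
  unfolding antiholomorphic_map_def
proof (intro ballI)
  fix c d z assume c: "c \<in> S" "d \<in> A" and z: "z \<in> rep_dom c d f"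
  interpret P: chern_patch "snd d ` fst d" "g d" "rep_dom c d f" "local_rep c d f" by (rule patch[OF c])
  obtain x where x: "x \<in> fst c" "f x \<in> fst d" "z = snd c x"
    using rep_domE[OF z charts(1)[OF c(1)]] by metis
  have "P.e10 z = 0"
    using kcos_chart(1)[OF c x(1,2)] assms[of x] P.conf_pos[OF z] P.conf_eq[OF z] x(3) by (simp add: field_simps)
  then have "P.F10 z = 0" by (simp add: P.e_eq_0_iff[OF z])
  then have dF: "fderiv (local_rep c d f) z v = cnj v *s P.F01 z" for v
    using P.fderiv_F_complex[OF z, of v] by simp
  show "complex_antilinear ((*) \<i>) J (fderiv (local_rep c d f) z)"
    unfolding complex_antilinear_def
    using linear_fderiv[OF P.differentiable_F[OF z]] by (simp add: dF vec_eq_iff)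
qed

lemma curvature_sum_zero_imp_kcos_const:
  assumes comp: "compact (UNIV :: 's set)"
    and K: "\<And>x. gauss_curvature S A g f x + normal_curvature S A g f x = 0"
    and gen: "\<not> holomorphic_map S A f" "\<not> antiholomorphic_map S A f"
  shows "(kcos x)\<^sup>2 < 1" "kcos x = kcos y"
proof -
  have csq: "continuous_on UNIV (\<lambda>x. (kcos x)\<^sup>2)" by (intro continuous_intros continuous_kcos)
  obtain x0 where x0: "\<And>y. (kcos x0)\<^sup>2 \<le> (kcos y)\<^sup>2"
    using continuous_attains_inf[OF comp UNIV_not_empty csq] by blast
  have le1: "(kcos x)\<^sup>2 \<le> 1" for x
    using charts_at[of x] kcos_chart(3) by metis
  have lt: "(kcos x0)\<^sup>2 < 1"
  proof (rule ccontr)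
    assume "\<not> (kcos x0)\<^sup>2 < 1"
    then have one: "(kcos x)\<^sup>2 = 1" for x using x0[of x] le1[of x] by linarith
    then have "kcos x0 = 1 \<or> kcos x0 = - 1" by (simp add: power2_eq_1_iff)
    moreover have "kcos x = kcos x0" for x by (rule kcos_constant[OF one])
    ultimately have "(\<forall>x. kcos x = 1) \<or> (\<forall>x. kcos x = - 1)" by metis
    then show False using holomorphic_if_kcos_1 antiholomorphic_if_kcos_minus_1 gen by blast
  qed
  \<comment> \<open>The maximum points of \<open>sin\<^sup>2 \<alpha>\<close>.\<close>
  define M where "M = {x. (kcos x)\<^sup>2 = (kcos x0)\<^sup>2}"
  have "open M"
  proof (subst open_subopen, intro ballI)
    fix x assume "x \<in> M"
    then have "(kcos x)\<^sup>2 < 1" "\<And>y. (kcos x)\<^sup>2 \<le> (kcos y)\<^sup>2" using lt x0 by (simp_all add: M_def)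
    from minimal_square_set_open[OF K this] \<open>x \<in> M\<close>
    show "\<exists>T. open T \<and> x \<in> T \<and> T \<subseteq> M" by (auto simp: M_def)
  qed
  moreover have "closed M"
    unfolding M_def by (rule closed_Collect_eq[OF csq continuous_on_const])
  moreover have "x0 \<in> M" by (simp add: M_def)
  ultimately have "M = UNIV"
    using connected_surface unfolding connected_clopen by (metis closed_closedin emptyE open_openin subtopology_UNIV)
  then have sq: "(kcos x)\<^sup>2 = (kcos x0)\<^sup>2" for x by (auto simp: M_def)
  show "(kcos x)\<^sup>2 < 1" unfolding sq[of x] by (rule lt)
  show "kcos x = kcos y" by (rule kcos_constant[OF sq])
qed

end

theorem theorem1p3:
  fixes S :: "('s::{t2_space,second_countable_topology}, complex) chart set"
    and A :: "('m::{t2_space,second_countable_topology}, complex ^ 2) chart set"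
    and g :: "'m hmetric"
    and f :: "'s \<Rightarrow> 'm"
  assumes "hermitian_surface A g"
    and "riemann_surface S"
    and "compact (UNIV :: 's set)"
    and "conformal_immersion S A g f"
    and "generic_chern_minimal S A g f"
  shows "(real_immersion S A g f \<and> (\<exists>\<alpha>. \<forall>x. kahler_angle S A g f x = \<alpha>)) \<longleftrightarrow>
         (\<forall>x. gauss_curvature S A g f x + normal_curvature S A g f x = 0)"
proof -
  have gen: "chern_minimal S A g f" "\<not> holomorphic_map S A f" "\<not> antiholomorphic_map S A f"
    using assms(5) by (auto simp: generic_chern_minimal_def)
  interpret chern_minimal_immersion S A g f
    by unfold_locales (fact assms gen)+
  show ?thesis
  proof
    assume "real_immersion S A g f \<and> (\<exists>\<alpha>. \<forall>x. kahler_angle S A g f x = \<alpha>)"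
    then obtain \<alpha> where "\<And>x. (kcos x)\<^sup>2 < 1" and "\<And>x. kahler_angle S A g f x = \<alpha>"
      by (auto simp: real_immersion_def real_point_iff)
    then show "\<forall>x. gauss_curvature S A g f x + normal_curvature S A g f x = 0"
      using kcos_const_imp_curvature_sum_zero by (simp add: kcos_def)
  next
    assume K: "\<forall>x. gauss_curvature S A g f x + normal_curvature S A g f x = 0"
    note k = curvature_sum_zero_imp_kcos_const[OF assms(3) K[rule_format] gen(2,3)]
    have "real_immersion S A g f"
      unfolding real_immersion_def real_point_iff using k(1) by blast
    moreover have "kahler_angle S A g f x = arccos (kcos y)" for x y
      using charts_at[of x] kcos_chart(2) k(2)[of x y] by metis
    ultimately show "real_immersion S A g f \<and> (\<exists>\<alpha>. \<forall>x. kahler_angle S A g f x = \<alpha>)" by blast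
  qed
qed

end
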